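(* Let $d\ge2$ be an integer or $d=\infty$. Then the big Hankel system $$\{\Gamma^{\mathrm{big}}_{e^{in\cdot\theta}}\}_{n\in\mathbb{Z}^d\setminus\mathbb{N}^d}\subset B\big(H^2(\mathbb{T}^d),\,L^2(\mathbb{T}^d)\ominus H^2(\mathbb{T}^d)\big)$$ has the self-absorption property (SAP), where for $d=\infty$ one reads $\mathbb{T}^\infty=\mathbb{T}^{\mathbb{N}}$ and the index set $\mathbb{Z}^d\setminus\mathbb{N}^d$ is replaced by $\mathbb{Z}^{(\mathbb{N})}\setminus\mathbb{N}^{(\mathbb{N})}$.
   Context: $\mathbb{N}=\{0,1,2,\dots\}$; $\mathbb{Z}^{(\mathbb{N})}$, $\mathbb{N}^{(\mathbb{N})}$ denote finitely supported sequences in $\mathbb{Z}$, $\mathbb{N}$. $\mathbb{T}^d$ (resp. $\mathbb{T}^{\mathbb{N}}$) has normalized Haar measure, and $H^2(\mathbb{T}^d)\subset L^2(\mathbb{T}^d)$ is the closed span of the characters $e^{in\cdot\theta}$ with $n\in\mathbb{N}^d$ (resp. $n\in\mathbb{N}^{(\mathbb{N})}$). For a symbol $\varphi$, the big Hankel operator $\Gamma^{\mathrm{big}}_\varphi:H^2(\mathbb{T}^d)\to L^2(\mathbb{T}^d)\ominus H^2(\mathbb{T}^d)$ sends $f$ to the orthogonal projection of $\varphi f$ onto the orthogonal complement of $H^2(\mathbb{T}^d)$ in $L^2(\mathbb{T}^d)$. SAP: a family $\{x_i\}_{i\in I}$ in an operator space $A$ (such as $B(H,K)$ for Hilbert spaces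 $H,K$) has the self-absorption property (SAP) if for every $C^*$-algebra $B$ and every finitely supported family $(b_i)_{i\in I}$ in $B$, $$\Big\|\sum_{i} b_i\otimes x_i\Big\|_{B\otimes_{\min}A}=\Big\|\sum_{i} b_i\otimes x_i\otimes\overline{x}_i\Big\|_{B\otimes_{\min}A\otimes_{\min}\overline{A}} .$$ Here $\otimes_{\min}$ is the minimal tensor product and $\overline{A}$ is the complex conjugate of $A$ ($\overline{B(H,K)}=B(\overline H,\overline K)$), with $\overline{x}$ being $x$ viewed in $\overline{A}$. *)

theory Defs
  imports "HOL-Probability.Probability"
begin

section \<open>Complex vector spaces, Hilbert spaces and C*-algebras\<close>

class scaleC =
  fixes scaleC :: "complex \<Rightarrow> 'a \<Rightarrow> 'a"  (infixr "*\<^sub>C" 75)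

class complex_vector = real_vector + scaleC +
  assumes scaleC_add_right: "a *\<^sub>C (x + y) = a *\<^sub>C x + a *\<^sub>C y"
    and scaleC_add_left: "(a + b) *\<^sub>C x = a *\<^sub>C x + b *\<^sub>C x"
    and scaleC_scaleC: "a *\<^sub>C b *\<^sub>C x = (a * b) *\<^sub>C x"
    and scaleC_one: "1 *\<^sub>C x = x"
    and scaleR_scaleC: "r *\<^sub>R x = complex_of_real r *\<^sub>C x"

interpretation complex_vector: vector_space "scaleC :: complex \<Rightarrow> 'a \<Rightarrow> 'a::complex_vector"
  by unfold_locales (simp_all add: scaleC_add_right scaleC_add_left scaleC_scaleC scaleC_one)

text \<open>Inner products are antilinear in the first argument and linear in the second. Norm, metric
  and topology are those of the underlying real inner product space.\<close>

class complex_inner = complex_vector + real_inner +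
  fixes cinner :: "'a \<Rightarrow> 'a \<Rightarrow> complex"
  assumes cinner_commute: "cinner x y = cnj (cinner y x)"
    and cinner_add_right: "cinner x (y + z) = cinner x y + cinner x z"
    and cinner_scaleC_right: "cinner x (c *\<^sub>C y) = c * cinner x y"
    and inner_cinner: "inner x y = Re (cinner x y)"

class chilbert_space = complex_inner + complete_space

text \<open>C*-algebras are not required to be unital.\<close>

class cstar_algebra = complex_vector + real_normed_algebra + complete_space +
  fixes star :: "'a \<Rightarrow> 'a"
  assumes norm_scaleC_cstar: "norm (c *\<^sub>C x) = cmod c * norm x"
    and mult_scaleC_left: "(c *\<^sub>C x) * y = c *\<^sub>C (x * y)"
    and mult_scaleC_right: "x * (c *\<^sub>C y) = c *\<^sub>C (x * y)"
    and star_star: "star (star x) = x"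
    and star_add: "star (x + y) = star x + star y"
    and star_scaleC: "star (c *\<^sub>C x) = cnj c *\<^sub>C star x"
    and star_mult: "star (x * y) = star y * star x"
    and cstar_identity: "norm (star x * x) = (norm x)\<^sup>2"

instantiation complex :: "{chilbert_space, cstar_algebra}"
begin

definition scaleC_complex :: "complex \<Rightarrow> complex \<Rightarrow> complex" where
  "scaleC_complex c x = c * x"

definition cinner_complex :: "complex \<Rightarrow> complex \<Rightarrow> complex" where
  "cinner_complex x y = cnj x * y"

definition star_complex :: "complex \<Rightarrow> complex" where
  "star_complex = cnj"

instance
  by standard
    (auto simp: scaleC_complex_def cinner_complex_def star_complex_def inner_complex_def
       algebra_simps scaleR_conv_of_real norm_mult power2_eq_square)

end

definition bounded_clinear :: "('a::complex_inner \<Rightarrow> 'b::complex_inner) \<Rightarrow> bool" where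
  "bounded_clinear f \<longleftrightarrow> bounded_linear f \<and> (\<forall>c x. f (c *\<^sub>C x) = c *\<^sub>C f x)"

lemma cinner_add_left: "cinner (x + y) z = cinner x z + cinner y (z::'a::complex_inner)"
  by (subst (1 2 3) cinner_commute) (simp add: cinner_add_right)

lemma cinner_scaleC_left: "cinner (c *\<^sub>C x) z = cnj c * cinner x (z::'a::complex_inner)"
  by (subst (1 2) cinner_commute) (simp add: cinner_scaleC_right)

lemma cinner_zero_right [simp]: "cinner x 0 = 0"
  using cinner_add_right[of x 0 0] by simp

lemma cinner_zero_left [simp]: "cinner 0 x = 0"
  using cinner_add_left[of 0 0 x] by simp

lemma cinner_minus_right: "cinner x (- y) = - cinner x y"
  using cinner_add_right[of x y "- y"] by (simp add: eq_neg_iff_add_eq_0 add.commute)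

lemma cinner_minus_left: "cinner (- x) y = - cinner x y"
  using cinner_add_left[of x "- x" y] by (simp add: eq_neg_iff_add_eq_0 add.commute)

lemma cinner_diff_right: "cinner x (y - z) = cinner x y - cinner x z"
  using cinner_add_right[of x y "- z"] by (simp add: cinner_minus_right)

lemma cinner_diff_left: "cinner (x - y) z = cinner x z - cinner y z"
  using cinner_add_left[of x "- y" z] by (simp add: cinner_minus_left)

lemma cinner_sum_right: "cinner x (\<Sum>i\<in>A. f i) = (\<Sum>i\<in>A. cinner x (f i))"
  by (induction A rule: infinite_finite_induct) (auto simp: cinner_add_right)

lemma cinner_sum_left: "cinner (\<Sum>i\<in>A. f i) x = (\<Sum>i\<in>A. cinner (f i) x)"
  by (induction A rule: infinite_finite_induct) (auto simp: cinner_add_left)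

lemma cinner_self: "cinner x x = complex_of_real ((norm x)\<^sup>2)"
proof -
  have "Im (cinner x x) = 0"
    using cinner_commute[of x x] by (metis cnj.simps(2) equation_minus_iff neg_equal_zero)
  then show ?thesis
    by (simp add: complex_eq_iff inner_cinner[symmetric] power2_norm_eq_inner)
qed

lemma norm_scaleC: "norm (c *\<^sub>C (x::'a::complex_inner)) = cmod c * norm x"
proof -
  have "complex_of_real ((norm (c *\<^sub>C x))\<^sup>2) = (c * cnj c) * cinner x x"
    by (simp only: cinner_self[symmetric] cinner_scaleC_left cinner_scaleC_right mult_ac)
  also have "\<dots> = complex_of_real ((cmod c)\<^sup>2) * complex_of_real ((norm x)\<^sup>2)"
    by (simp only: cinner_self complex_norm_square)
  also have "\<dots> = complex_of_real ((cmod c * norm x)\<^sup>2)"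
    by (simp add: power_mult_distrib)
  finally have "complex_of_real ((norm (c *\<^sub>C x))\<^sup>2) = complex_of_real ((cmod c * norm x)\<^sup>2)" .
  then have "(norm (c *\<^sub>C x))\<^sup>2 = (cmod c * norm x)\<^sup>2"
    using of_real_eq_iff by blast
  then show ?thesis
    by (simp add: power2_eq_iff_nonneg)
qed

lemma Cauchy_Schwarz_cinner: "cmod (cinner x y) \<le> norm x * norm y"
proof -
  obtain c where c: "cmod c = 1" "c * cinner x y = complex_of_real (cmod (cinner x y))"
  proof (cases "cinner x y = 0")
    case True
    then show ?thesis using that[of 1] by simp
  next
    case False
    show ?thesis
    proof (rule that)
      show "cmod (complex_of_real (cmod (cinner x y)) / cinner x y) = 1"
        using False by (simp add: norm_divide)
      show "complex_of_real (cmod (cinner x y)) / cinner x y * cinner x y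
        = complex_of_real (cmod (cinner x y))"
        using False by simp
    qed
  qed
  have "cmod (cinner x y) = inner x (c *\<^sub>C y)"
    by (simp add: inner_cinner cinner_scaleC_right c)
  also have "\<dots> \<le> norm x * norm (c *\<^sub>C y)"
    by (rule norm_cauchy_schwarz)
  finally show ?thesis by (simp add: norm_scaleC c)
qed

lemma cinner_scaleR_left: "cinner (r *\<^sub>R x) y = r *\<^sub>R cinner x (y::'a::complex_inner)"
  by (simp add: scaleR_scaleC[where 'a='a] cinner_scaleC_left scaleR_conv_of_real)

lemma cinner_scaleR_right: "cinner x (r *\<^sub>R y) = r *\<^sub>R cinner x (y::'a::complex_inner)"
  by (simp add: scaleR_scaleC[where 'a='a] cinner_scaleC_right scaleR_conv_of_real)

lemma bounded_bilinear_cinner: "bounded_bilinear (cinner :: 'a::complex_inner \<Rightarrow> _)"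
proof
  show "\<exists>K. \<forall>a b. norm (cinner (a::'a) b) \<le> norm a * norm b * K"
    using Cauchy_Schwarz_cinner by (intro exI[of _ 1]) auto
qed (auto simp: cinner_add_left cinner_add_right cinner_scaleR_left cinner_scaleR_right)

lemma tendsto_cinner [tendsto_intros]:
  "(f \<longlongrightarrow> a) F \<Longrightarrow> (g \<longlongrightarrow> b) F \<Longrightarrow> ((\<lambda>x. cinner (f x) (g x)) \<longlongrightarrow> cinner a b) F"
  by (rule bounded_bilinear.tendsto[OF bounded_bilinear_cinner])

lemma bounded_linear_scaleC: "bounded_linear (\<lambda>x::'a::complex_inner. c *\<^sub>C x)"
  by (rule bounded_linear_intro[of _ "cmod c"])
     (auto simp: scaleC_add_right scaleR_scaleC scaleC_scaleC norm_scaleC mult.commute)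

lemma tendsto_scaleC [tendsto_intros]:
  "(f \<longlongrightarrow> a) F \<Longrightarrow> ((\<lambda>x. c *\<^sub>C f x) \<longlongrightarrow> c *\<^sub>C (a::'a::complex_inner)) F"
  by (rule bounded_linear.tendsto[OF bounded_linear_scaleC])

section \<open>The complex conjugate of a Hilbert space\<close>

typedef 'a conj_space = "UNIV :: 'a set"
  morphisms of_conj to_conj by blast

setup_lifting type_definition_conj_space

instantiation conj_space :: (complex_inner) complex_inner
begin

lift_definition zero_conj_space :: "'a conj_space" is 0 .
lift_definition plus_conj_space :: "'a conj_space \<Rightarrow> 'a conj_space \<Rightarrow> 'a conj_space" is "(+)" .
lift_definition minus_conj_space :: "'a conj_space \<Rightarrow> 'a conj_space \<Rightarrow> 'a conj_space" is "(-)" .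
lift_definition uminus_conj_space :: "'a conj_space \<Rightarrow> 'a conj_space" is uminus .
lift_definition scaleR_conj_space :: "real \<Rightarrow> 'a conj_space \<Rightarrow> 'a conj_space" is scaleR .
lift_definition scaleC_conj_space :: "complex \<Rightarrow> 'a conj_space \<Rightarrow> 'a conj_space"
  is "\<lambda>c x. cnj c *\<^sub>C x" .
lift_definition cinner_conj_space :: "'a conj_space \<Rightarrow> 'a conj_space \<Rightarrow> complex"
  is "\<lambda>x y. cinner y x" .
lift_definition inner_conj_space :: "'a conj_space \<Rightarrow> 'a conj_space \<Rightarrow> real" is inner .
lift_definition norm_conj_space :: "'a conj_space \<Rightarrow> real" is norm .

definition dist_conj_space :: "'a conj_space \<Rightarrow> 'a conj_space \<Rightarrow> real" where
  "dist_conj_space x y = norm (x - y)"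
definition sgn_conj_space :: "'a conj_space \<Rightarrow> 'a conj_space" where
  "sgn_conj_space x = scaleR (inverse (norm x)) x"
definition uniformity_conj_space :: "('a conj_space \<times> 'a conj_space) filter" where
  "uniformity_conj_space = (INF e\<in>{0<..}. principal {(x, y). dist x y < e})"
definition open_conj_space :: "'a conj_space set \<Rightarrow> bool" where
  "open_conj_space U \<longleftrightarrow> (\<forall>x\<in>U. \<forall>\<^sub>F (x', y) in uniformity. x' = x \<longrightarrow> y \<in> U)"

instance
proof
  fix x y z :: "'a conj_space" and a b :: complex and r s :: real
  show "x + y + z = x + (y + z)" by transfer (simp add: algebra_simps)
  show "x + y = y + x" by transfer (simp add: algebra_simps)
  show "0 + x = x" by transfer simp
  show "- x + x = 0" by transfer simp
  show "x - y = x + - y" by transfer simp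
  show "r *\<^sub>R (x + y) = r *\<^sub>R x + r *\<^sub>R y" by transfer (simp add: algebra_simps)
  show "(r + s) *\<^sub>R x = r *\<^sub>R x + s *\<^sub>R x" by transfer (simp add: algebra_simps)
  show "r *\<^sub>R s *\<^sub>R x = (r * s) *\<^sub>R x" by transfer simp
  show "1 *\<^sub>R x = x" by transfer simp
  show "a *\<^sub>C (x + y) = a *\<^sub>C x + a *\<^sub>C y" by transfer (simp add: scaleC_add_right)
  show "(a + b) *\<^sub>C x = a *\<^sub>C x + b *\<^sub>C x" by transfer (simp add: scaleC_add_left)
  show "a *\<^sub>C b *\<^sub>C x = (a * b) *\<^sub>C x" by transfer (simp add: scaleC_scaleC)
  show "1 *\<^sub>C x = x" by transfer (simp add: scaleC_one)
  show "r *\<^sub>R x = complex_of_real r *\<^sub>C x" by transfer (simp add: scaleR_scaleC)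
  show "dist x y = norm (x - y)" by (fact dist_conj_space_def)
  show "sgn x = inverse (norm x) *\<^sub>R x" by (fact sgn_conj_space_def)
  show "(uniformity :: ('a conj_space \<times> 'a conj_space) filter)
      = (INF e\<in>{0<..}. principal {(x, y). dist x y < e})"
    by (fact uniformity_conj_space_def)
  show "open U \<longleftrightarrow> (\<forall>x\<in>U. \<forall>\<^sub>F (x', y) in uniformity. x' = x \<longrightarrow> y \<in> U)"
    for U :: "'a conj_space set"
    by (fact open_conj_space_def)
  show "inner x y = inner y x" by transfer (rule inner_commute)
  show "inner (x + y) z = inner x z + inner y z" by transfer (rule inner_add_left)
  show "inner (r *\<^sub>R x) y = r * inner x y" by transfer simp
  show "0 \<le> inner x x" by transfer simp
  show "inner x x = 0 \<longleftrightarrow> x = 0" by transfer simp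
  show "norm x = sqrt (inner x x)" by transfer (rule norm_eq_sqrt_inner)
  show "cinner x y = cnj (cinner y x)" by transfer (rule cinner_commute)
  show "cinner x (y + z) = cinner x y + cinner x z" by transfer (rule cinner_add_left)
  show "cinner x (a *\<^sub>C y) = a * cinner x y" by transfer (simp add: cinner_scaleC_left)
  show "inner x y = Re (cinner x y)" by transfer (metis inner_cinner inner_commute)
qed

end

lemma convergent_via_isometry:
  fixes R :: "'a::metric_space \<Rightarrow> 'b::complete_space" and X :: "nat \<Rightarrow> 'a"
  assumes iso: "\<And>x y. dist (R x) (R y) = dist x y" and cl: "closed (range R)" and "Cauchy X"
  shows "convergent X"
proof -
  have "Cauchy (\<lambda>n. R (X n))"
    using \<open>Cauchy X\<close> by (simp add: Cauchy_def iso)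
  then obtain y where y: "(\<lambda>n. R (X n)) \<longlonglongrightarrow> y"
    using Cauchy_convergent convergent_def by blast
  have "y \<in> range R"
    using closed_sequentially[OF cl _ y] by blast
  then obtain x where x: "y = R x" by blast
  have "X \<longlonglongrightarrow> x"
    using y unfolding x tendsto_iff by (simp add: iso)
  then show ?thesis by (auto simp: convergent_def)
qed

instance conj_space :: (chilbert_space) chilbert_space
proof
  fix X :: "nat \<Rightarrow> 'a conj_space"
  assume "Cauchy X"
  have "range of_conj = (UNIV :: 'a set)"
    by (metis surj_def to_conj_inverse UNIV_I)
  then have "closed (range (of_conj :: 'a conj_space \<Rightarrow> 'a))"
    by (simp only: closed_UNIV)
  moreover have "dist (of_conj x) (of_conj y) = dist x y" for x y :: "'a conj_space"
    unfolding dist_norm by transfer simp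
  ultimately show "convergent X"
    using convergent_via_isometry \<open>Cauchy X\<close> by blast
qed

definition conj_op :: "('a \<Rightarrow> 'b) \<Rightarrow> 'a conj_space \<Rightarrow> 'b conj_space" where
  "conj_op T v = to_conj (T (of_conj v))"

section \<open>Completion of a complex inner product space\<close>

definition compl_rel :: "(nat \<Rightarrow> 'a::complex_inner) \<Rightarrow> (nat \<Rightarrow> 'a) \<Rightarrow> bool" where
  "compl_rel X Y \<longleftrightarrow> Cauchy X \<and> Cauchy Y \<and> (\<lambda>n. X n - Y n) \<longlonglongrightarrow> 0"

lemma part_equivp_compl_rel: "part_equivp (compl_rel :: (nat \<Rightarrow> 'a::complex_inner) \<Rightarrow> _)"
proof (rule part_equivpI)
  have "compl_rel (\<lambda>_. 0 :: 'a) (\<lambda>_. 0)"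
    by (simp add: compl_rel_def Cauchy_def)
  then show "\<exists>X :: nat \<Rightarrow> 'a. compl_rel X X" by blast
  show "symp (compl_rel :: (nat \<Rightarrow> 'a) \<Rightarrow> _)"
  proof (rule sympI)
    fix X Y :: "nat \<Rightarrow> 'a"
    assume "compl_rel X Y"
    then show "compl_rel Y X"
      unfolding compl_rel_def using tendsto_minus[of "\<lambda>n. X n - Y n" 0 sequentially] by simp
  qed
  show "transp (compl_rel :: (nat \<Rightarrow> 'a) \<Rightarrow> _)"
  proof (rule transpI)
    fix X Y Z :: "nat \<Rightarrow> 'a"
    assume "compl_rel X Y" "compl_rel Y Z"
    then show "compl_rel X Z"
      unfolding compl_rel_def
      using tendsto_add[of "\<lambda>n. X n - Y n" 0 sequentially "\<lambda>n. Y n - Z n" 0] by simp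
  qed
qed

quotient_type (overloaded) 'a completion = "nat \<Rightarrow> 'a::complex_inner" / partial: compl_rel
  by (rule part_equivp_compl_rel)

lemma Cauchy_scaleC: "Cauchy X \<Longrightarrow> Cauchy (\<lambda>n. c *\<^sub>C (X n :: 'a::complex_inner))"
  by (rule bounded_linear.Cauchy[OF bounded_linear_scaleC])

lemma Cauchy_scaleR: "Cauchy X \<Longrightarrow> Cauchy (\<lambda>n. r *\<^sub>R (X n :: 'a::complex_inner))"
  by (rule bounded_linear.Cauchy[OF bounded_linear_scaleR_right])

lemma Cauchy_add': "Cauchy X \<Longrightarrow> Cauchy Y \<Longrightarrow> Cauchy (\<lambda>n. X n + (Y n :: 'a::complex_inner))"
proof (rule metric_CauchyI)
  fix e :: real assume e: "0 < e" and X: "Cauchy X" and Y: "Cauchy Y"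
  obtain M where M: "\<And>m n. m \<ge> M \<Longrightarrow> n \<ge> M \<Longrightarrow> dist (X m) (X n) < e / 2"
    using metric_CauchyD[OF X, of "e / 2"] e by auto
  obtain N where N: "\<And>m n. m \<ge> N \<Longrightarrow> n \<ge> N \<Longrightarrow> dist (Y m) (Y n) < e / 2"
    using metric_CauchyD[OF Y, of "e / 2"] e by auto
  show "\<exists>M. \<forall>m\<ge>M. \<forall>n\<ge>M. dist (X m + Y m) (X n + Y n) < e"
  proof (intro exI[of _ "max M N"] allI impI)
    fix m n assume "max M N \<le> m" "max M N \<le> n"
    then have "dist (X m) (X n) < e / 2" "dist (Y m) (Y n) < e / 2"
      using M N by auto
    then show "dist (X m + Y m) (X n + Y n) < e"
      using dist_triangle_add[of "X m" "Y m" "X n" "Y n"] by linarith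
  qed
qed

lemma Cauchy_uminus: "Cauchy X \<Longrightarrow> Cauchy (\<lambda>n. - (X n :: 'a::complex_inner))"
  by (simp add: Cauchy_def dist_minus)

lemma Cauchy_diff': "Cauchy X \<Longrightarrow> Cauchy Y \<Longrightarrow> Cauchy (\<lambda>n. X n - (Y n :: 'a::complex_inner))"
  using Cauchy_add'[of X "\<lambda>n. - Y n"] Cauchy_uminus[of Y] by simp

lemmas Cauchy_ops = Cauchy_scaleC Cauchy_scaleR Cauchy_add' Cauchy_diff' Cauchy_uminus

lemma Cauchy_cinner: "Cauchy X \<Longrightarrow> Cauchy Y \<Longrightarrow> Cauchy (\<lambda>n. cinner (X n) (Y n :: 'a::complex_inner))"
proof (rule metric_CauchyI)
  fix e :: real assume e: "0 < e" and X: "Cauchy X" and Y: "Cauchy Y"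
  obtain A where A: "0 < A" "\<And>n. norm (X n) \<le> A"
    using Cauchy_Bseq[OF X] by (auto simp: Bseq_def)
  obtain B where B: "0 < B" "\<And>n. norm (Y n) \<le> B"
    using Cauchy_Bseq[OF Y] by (auto simp: Bseq_def)
  obtain M where M: "\<And>m n. m \<ge> M \<Longrightarrow> n \<ge> M \<Longrightarrow> dist (X m) (X n) < e / 2 / B"
    using metric_CauchyD[OF X, of "e / 2 / B"] e B by auto
  obtain N where N: "\<And>m n. m \<ge> N \<Longrightarrow> n \<ge> N \<Longrightarrow> dist (Y m) (Y n) < e / 2 / A"
    using metric_CauchyD[OF Y, of "e / 2 / A"] e A by auto
  show "\<exists>M. \<forall>m\<ge>M. \<forall>n\<ge>M. dist (cinner (X m) (Y m)) (cinner (X n) (Y n)) < e"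
  proof (intro exI[of _ "max M N"] allI impI)
    fix m n assume "max M N \<le> m" "max M N \<le> n"
    then have d: "norm (X m - X n) < e / 2 / B" "norm (Y m - Y n) < e / 2 / A"
      using M[of m n] N[of m n] by (auto simp: dist_norm)
    have "cinner (X m) (Y m) - cinner (X n) (Y n)
        = cinner (X m) (Y m - Y n) + cinner (X m - X n) (Y n)"
      by (simp add: cinner_diff_left cinner_diff_right)
    then have "dist (cinner (X m) (Y m)) (cinner (X n) (Y n))
        \<le> cmod (cinner (X m) (Y m - Y n)) + cmod (cinner (X m - X n) (Y n))"
      by (simp add: dist_norm norm_triangle_ineq)
    also have "\<dots> \<le> norm (X m) * norm (Y m - Y n) + norm (X m - X n) * norm (Y n)"
      by (intro add_mono Cauchy_Schwarz_cinner)
    also have "\<dots> \<le> A * norm (Y m - Y n) + norm (X m - X n) * B"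
      using A B by (intro add_mono mult_mono) auto
    also have "\<dots> < A * (e / 2 / A) + (e / 2 / B) * B"
      using A B d by (intro add_strict_mono mult_strict_left_mono mult_strict_right_mono) auto
    also have "\<dots> = e" using A B by simp
    finally show "dist (cinner (X m) (Y m)) (cinner (X n) (Y n)) < e" .
  qed
qed

lemma tendsto_cinner_lim:
  fixes X Y :: "nat \<Rightarrow> 'a::complex_inner"
  assumes "Cauchy X" "Cauchy Y"
  shows "(\<lambda>n. cinner (X n) (Y n)) \<longlonglongrightarrow> lim (\<lambda>n. cinner (X n) (Y n))"
  using Cauchy_cinner[OF assms] Cauchy_convergent convergent_LIMSEQ_iff by blast

lemma cinner_null_right:
  fixes X Y :: "nat \<Rightarrow> 'a::complex_inner"
  assumes X: "Cauchy X" and Y: "Y \<longlonglongrightarrow> 0"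
  shows "(\<lambda>n. cinner (X n) (Y n)) \<longlonglongrightarrow> 0"
proof -
  obtain K where K: "\<And>n. norm (X n) \<le> K"
    using Cauchy_Bseq[OF X] by (auto simp: Bseq_def)
  have *: "\<forall>\<^sub>F n in sequentially. norm (cinner (X n) (Y n)) \<le> K * norm (Y n)"
    by (intro always_eventually allI order.trans[OF Cauchy_Schwarz_cinner] mult_right_mono K) simp
  have "(\<lambda>n. K * norm (Y n)) \<longlonglongrightarrow> 0"
    using tendsto_mult[OF tendsto_const tendsto_norm[OF Y], of K] by simp
  from Lim_null_comparison[OF * this] show ?thesis .
qed

lemma lim_cinner_cong:
  fixes X X' Y Y' :: "nat \<Rightarrow> 'a::complex_inner"
  assumes "compl_rel X X'" "compl_rel Y Y'"
  shows "lim (\<lambda>n. cinner (X n) (Y n)) = lim (\<lambda>n. cinner (X' n) (Y' n))"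
proof -
  have C: "Cauchy X" "Cauchy X'" "Cauchy Y" "Cauchy Y'"
    and X: "(\<lambda>n. X n - X' n) \<longlonglongrightarrow> 0" and Y: "(\<lambda>n. Y n - Y' n) \<longlonglongrightarrow> 0"
    using assms by (auto simp: compl_rel_def)
  have "(\<lambda>n. cnj (cinner (Y n) (X n - X' n)) + cinner (X' n) (Y n - Y' n)) \<longlonglongrightarrow> cnj 0 + 0"
    by (intro tendsto_intros cinner_null_right C X Y)
  then have *: "(\<lambda>n. cinner (X n) (Y n) - cinner (X' n) (Y' n)) \<longlonglongrightarrow> 0"
    by (simp add: cinner_commute[symmetric] cinner_diff_left cinner_diff_right)
  have "(\<lambda>n. cinner (X n) (Y n) - cinner (X' n) (Y' n))
      \<longlonglongrightarrow> lim (\<lambda>n. cinner (X n) (Y n)) - lim (\<lambda>n. cinner (X' n) (Y' n))"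
    by (intro tendsto_diff tendsto_cinner_lim C)
  from LIMSEQ_unique[OF this *] show ?thesis by simp
qed

lemma compl_rel_scale:
  fixes X Y :: "nat \<Rightarrow> 'a::complex_inner"
  assumes "compl_rel X Y"
  shows "compl_rel (\<lambda>n. c *\<^sub>C X n) (\<lambda>n. c *\<^sub>C Y n)"
proof -
  have "(\<lambda>n. c *\<^sub>C (X n - Y n)) \<longlonglongrightarrow> c *\<^sub>C 0"
    using assms by (intro tendsto_scaleC) (simp add: compl_rel_def)
  then show ?thesis
    using assms by (simp add: compl_rel_def Cauchy_scaleC complex_vector.scale_right_diff_distrib)
qed

lemma compl_rel_diff:
  fixes X Y X' Y' :: "nat \<Rightarrow> 'a::complex_inner"
  assumes "compl_rel X X'" "compl_rel Y Y'"
  shows "compl_rel (\<lambda>n. X n - Y n) (\<lambda>n. X' n - Y' n)"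
proof -
  have "(\<lambda>n. (X n - X' n) - (Y n - Y' n)) \<longlonglongrightarrow> 0 - 0"
    using assms by (intro tendsto_diff) (auto simp: compl_rel_def)
  then show ?thesis
    using assms by (simp add: compl_rel_def Cauchy_diff' algebra_simps)
qed

instantiation completion :: (complex_inner) complex_inner
begin

lift_definition zero_completion :: "'a completion" is "\<lambda>_. 0"
  by (simp add: compl_rel_def Cauchy_def)
lift_definition plus_completion :: "'a completion \<Rightarrow> 'a completion \<Rightarrow> 'a completion"
  is "\<lambda>X Y n. X n + Y n"
  unfolding compl_rel_def add_diff_add by (auto intro: Cauchy_ops tendsto_add_zero)
lift_definition uminus_completion :: "'a completion \<Rightarrow> 'a completion"
  is "\<lambda>X n. - X n"
  by (rule compl_rel_scale[of _ _ "-1", simplified])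
lift_definition minus_completion :: "'a completion \<Rightarrow> 'a completion \<Rightarrow> 'a completion"
  is "\<lambda>X Y n. X n - Y n"
  by (rule compl_rel_diff)
lift_definition scaleR_completion :: "real \<Rightarrow> 'a completion \<Rightarrow> 'a completion"
  is "\<lambda>r X n. r *\<^sub>R X n"
  unfolding scaleR_scaleC by (rule compl_rel_scale)
lift_definition scaleC_completion :: "complex \<Rightarrow> 'a completion \<Rightarrow> 'a completion"
  is "\<lambda>c X n. c *\<^sub>C X n"
  by (rule compl_rel_scale)
lift_definition cinner_completion :: "'a completion \<Rightarrow> 'a completion \<Rightarrow> complex"
  is "\<lambda>X Y. lim (\<lambda>n. cinner (X n) (Y n))"
  by (rule lim_cinner_cong)

definition inner_completion :: "'a completion \<Rightarrow> 'a completion \<Rightarrow> real" where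
  "inner_completion x y = Re (cinner x y)"
definition norm_completion :: "'a completion \<Rightarrow> real" where
  "norm_completion x = sqrt (inner x x)"
definition dist_completion :: "'a completion \<Rightarrow> 'a completion \<Rightarrow> real" where
  "dist_completion x y = norm (x - y)"
definition sgn_completion :: "'a completion \<Rightarrow> 'a completion" where
  "sgn_completion x = inverse (norm x) *\<^sub>R x"
definition uniformity_completion :: "('a completion \<times> 'a completion) filter" where
  "uniformity_completion = (INF e\<in>{0<..}. principal {(x, y). dist x y < e})"
definition open_completion :: "'a completion set \<Rightarrow> bool" where
  "open_completion U \<longleftrightarrow> (\<forall>x\<in>U. \<forall>\<^sub>F (x', y) in uniformity. x' = x \<longrightarrow> y \<in> U)"

lemma completion_self:
  fixes X :: "nat \<Rightarrow> 'a"
  assumes "Cauchy X"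
  shows "(\<lambda>n. (norm (X n))\<^sup>2) \<longlonglongrightarrow> Re (lim (\<lambda>n. cinner (X n) (X n)))"
  using tendsto_Re[OF tendsto_cinner_lim[OF assms assms]] by (simp add: cinner_self)

instance
proof
  fix x y z :: "'a completion" and a b :: complex and r s :: real
  show "x + y + z = x + (y + z)"
    by transfer (auto simp: compl_rel_def algebra_simps intro: Cauchy_ops)
  show "x + y = y + x"
    by transfer (auto simp: compl_rel_def algebra_simps intro: Cauchy_ops)
  show "0 + x = x" by transfer (auto simp: compl_rel_def)
  show "- x + x = 0" by transfer (auto simp: compl_rel_def Cauchy_def)
  show "x - y = x + - y" by transfer (auto simp: compl_rel_def intro: Cauchy_ops)
  show "r *\<^sub>R (x + y) = r *\<^sub>R x + r *\<^sub>R y"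
    by transfer (auto simp: compl_rel_def scaleR_add_right intro: Cauchy_ops)
  show "(r + s) *\<^sub>R x = r *\<^sub>R x + s *\<^sub>R x"
    by transfer (auto simp: compl_rel_def scaleR_add_left intro: Cauchy_ops)
  show "r *\<^sub>R s *\<^sub>R x = (r * s) *\<^sub>R x"
    by transfer (auto simp: compl_rel_def intro: Cauchy_ops)
  show "1 *\<^sub>R x = x" by transfer (auto simp: compl_rel_def)
  show "a *\<^sub>C (x + y) = a *\<^sub>C x + a *\<^sub>C y"
    by transfer (auto simp: compl_rel_def scaleC_add_right intro: Cauchy_ops)
  show "(a + b) *\<^sub>C x = a *\<^sub>C x + b *\<^sub>C x"
    by transfer (auto simp: compl_rel_def scaleC_add_left intro: Cauchy_ops)
  show "a *\<^sub>C b *\<^sub>C x = (a * b) *\<^sub>C x"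
    by transfer (auto simp: compl_rel_def scaleC_scaleC intro: Cauchy_ops)
  show "1 *\<^sub>C x = x" by transfer (auto simp: compl_rel_def scaleC_one)
  show "r *\<^sub>R x = complex_of_real r *\<^sub>C x"
    by transfer (auto simp: compl_rel_def scaleR_scaleC intro: Cauchy_ops)
  show "dist x y = norm (x - y)" by (fact dist_completion_def)
  show "sgn x = inverse (norm x) *\<^sub>R x" by (fact sgn_completion_def)
  show "(uniformity :: ('a completion \<times> 'a completion) filter)
      = (INF e\<in>{0<..}. principal {(x, y). dist x y < e})"
    by (fact uniformity_completion_def)
  show "open U \<longleftrightarrow> (\<forall>x\<in>U. \<forall>\<^sub>F (x', y) in uniformity. x' = x \<longrightarrow> y \<in> U)"
    for U :: "'a completion set"
    by (fact open_completion_def)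
  have commute: "cinner x y = cnj (cinner y x)" for x y :: "'a completion"
  proof transfer
    fix X Y :: "nat \<Rightarrow> 'a"
    assume "compl_rel X X" "compl_rel Y Y"
    then have C: "Cauchy X" "Cauchy Y" by (auto simp: compl_rel_def)
    have "(\<lambda>n. cnj (cinner (Y n) (X n))) \<longlonglongrightarrow> cnj (lim (\<lambda>n. cinner (Y n) (X n)))"
      by (intro tendsto_intros tendsto_cinner_lim C)
    then have "(\<lambda>n. cinner (X n) (Y n)) \<longlonglongrightarrow> cnj (lim (\<lambda>n. cinner (Y n) (X n)))"
      by (simp add: cinner_commute[symmetric])
    then show "lim (\<lambda>n. cinner (X n) (Y n)) = cnj (lim (\<lambda>n. cinner (Y n) (X n)))"
      by (rule limI)
  qed
  have add: "cinner x (y + z) = cinner x y + cinner x z" for x y z :: "'a completion"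
  proof transfer
    fix X Y Z :: "nat \<Rightarrow> 'a"
    assume "compl_rel X X" "compl_rel Y Y" "compl_rel Z Z"
    then have C: "Cauchy X" "Cauchy Y" "Cauchy Z" by (auto simp: compl_rel_def)
    show "lim (\<lambda>n. cinner (X n) (Y n + Z n))
      = lim (\<lambda>n. cinner (X n) (Y n)) + lim (\<lambda>n. cinner (X n) (Z n))"
      unfolding cinner_add_right by (intro limI tendsto_add tendsto_cinner_lim C)
  qed
  have scale: "cinner x (a *\<^sub>C y) = a * cinner x y" for x y :: "'a completion" and a
  proof transfer
    fix X Y :: "nat \<Rightarrow> 'a" and a
    assume "compl_rel X X" "compl_rel Y Y"
    then have C: "Cauchy X" "Cauchy Y" by (auto simp: compl_rel_def)
    show "lim (\<lambda>n. cinner (X n) (a *\<^sub>C Y n)) = a * lim (\<lambda>n. cinner (X n) (Y n))"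
      unfolding cinner_scaleC_right by (intro limI tendsto_intros tendsto_cinner_lim C)
  qed
  show "cinner x y = cnj (cinner y x)" by (fact commute)
  show "cinner x (y + z) = cinner x y + cinner x z" by (fact add)
  show "cinner x (a *\<^sub>C y) = a * cinner x y" by (fact scale)
  show "inner x y = Re (cinner x y)" by (fact inner_completion_def)
  show "inner x y = inner y x"
    unfolding inner_completion_def by (subst commute) simp
  have add': "cinner (x + y) z = cinner x z + cinner y z" for x y z :: "'a completion"
    by (subst (1 2 3) commute) (simp add: add)
  show "inner (x + y) z = inner x z + inner y z"
    unfolding inner_completion_def by (simp add: add')
  have "r *\<^sub>R x = complex_of_real r *\<^sub>C x"
    by transfer (auto simp: compl_rel_def scaleR_scaleC intro: Cauchy_ops)
  then have "cinner (r *\<^sub>R x) y = complex_of_real r * cinner x y"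
    by (subst (1 2) commute) (simp add: scale)
  then show "inner (r *\<^sub>R x) y = r * inner x y"
    unfolding inner_completion_def by simp
  show "0 \<le> inner x x"
    unfolding inner_completion_def
  proof transfer
    fix X :: "nat \<Rightarrow> 'a"
    assume "compl_rel X X"
    then have "Cauchy X" by (auto simp: compl_rel_def)
    from completion_self[OF this] show "0 \<le> Re (lim (\<lambda>n. cinner (X n) (X n)))"
      by (rule LIMSEQ_le_const) auto
  qed
  show "inner x x = 0 \<longleftrightarrow> x = 0"
    unfolding inner_completion_def
  proof transfer
    fix X :: "nat \<Rightarrow> 'a"
    assume "compl_rel X X"
    then have C: "Cauchy X" by (auto simp: compl_rel_def)
    have "Re (lim (\<lambda>n. cinner (X n) (X n))) = 0 \<longleftrightarrow> (\<lambda>n. (norm (X n))\<^sup>2) \<longlonglongrightarrow> 0"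
      using completion_self[OF C] LIMSEQ_unique by metis
    also have "\<dots> \<longleftrightarrow> (\<lambda>n. norm (X n)) \<longlonglongrightarrow> 0"
      using tendsto_power[of "\<lambda>n. norm (X n)" 0 sequentially 2]
        tendsto_real_sqrt[of "\<lambda>n. (norm (X n))\<^sup>2" 0 sequentially] by auto
    also have "\<dots> \<longleftrightarrow> compl_rel X (\<lambda>_. 0)"
      using C by (simp add: compl_rel_def Cauchy_def tendsto_norm_zero_iff)
    finally show "Re (lim (\<lambda>n. cinner (X n) (X n))) = 0 \<longleftrightarrow> compl_rel X (\<lambda>_. 0)" .
  qed
  show "norm x = sqrt (inner x x)" by (fact norm_completion_def)
qed

end

lift_definition to_completion :: "'a::complex_inner \<Rightarrow> 'a completion" is "\<lambda>x _. x"
  by (simp add: compl_rel_def Cauchy_def)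

lemma to_completion_add: "to_completion (x + y) = to_completion x + to_completion y"
  by transfer (simp add: compl_rel_def Cauchy_def)

lemma to_completion_diff: "to_completion (x - y) = to_completion x - to_completion y"
  by transfer (simp add: compl_rel_def Cauchy_def)

lemma to_completion_zero: "to_completion 0 = 0"
  by transfer (simp add: compl_rel_def Cauchy_def)

lemma to_completion_scaleC: "to_completion (c *\<^sub>C x) = c *\<^sub>C to_completion x"
  by transfer (simp add: compl_rel_def Cauchy_def)

lemma to_completion_sum: "to_completion (\<Sum>i\<in>A. f i) = (\<Sum>i\<in>A. to_completion (f i))"
  by (induction A rule: infinite_finite_induct) (auto simp: to_completion_add to_completion_zero)

lemma cinner_to_completion: "cinner (to_completion x) (to_completion y) = cinner x y"
  by transfer simp

lemma norm_to_completion: "norm (to_completion x) = norm x"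
  by (simp add: norm_eq_sqrt_inner inner_cinner cinner_to_completion)

lemma dist_to_completion: "dist (to_completion x) (to_completion y) = dist x y"
  by (simp add: dist_norm norm_to_completion flip: to_completion_diff)

lemma norm_abs_completion:
  assumes "Cauchy X"
  shows "(\<lambda>n. norm (X n)) \<longlonglongrightarrow> norm (abs_completion X)"
proof -
  have "compl_rel X X"
    using assms by (simp add: compl_rel_def)
  then have "cinner (abs_completion X) (abs_completion X) = lim (\<lambda>n. cinner (X n) (X n))"
    by (simp add: cinner_completion.abs_eq eq_onp_def)
  then have "(\<lambda>n. (norm (X n))\<^sup>2) \<longlonglongrightarrow> inner (abs_completion X) (abs_completion X)"
    using completion_self[OF assms] by (simp add: inner_cinner)
  from tendsto_real_sqrt[OF this] show ?thesis
    by (simp add: norm_eq_sqrt_inner[of "abs_completion X"])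
qed

lemma to_completion_tendsto:
  assumes X: "Cauchy X"
  shows "(\<lambda>n. to_completion (X n)) \<longlonglongrightarrow> abs_completion X"
proof (rule metric_LIMSEQ_I)
  fix e :: real assume e: "0 < e"
  then obtain M where M: "\<And>m n. m \<ge> M \<Longrightarrow> n \<ge> M \<Longrightarrow> dist (X m) (X n) < e / 2"
    using metric_CauchyD[OF X, of "e / 2"] by auto
  show "\<exists>no. \<forall>n\<ge>no. dist (to_completion (X n)) (abs_completion X) < e"
  proof (intro exI[of _ M] allI impI)
    fix n assume n: "M \<le> n"
    have C: "Cauchy (\<lambda>m. X n - X m)"
      using X by (intro Cauchy_ops) (auto simp: Cauchy_def)
    have "to_completion (X n) - abs_completion X = abs_completion (\<lambda>m. X n - X m)"
      using X by (subst to_completion.abs_eq, subst minus_completion.abs_eq)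
        (auto simp: compl_rel_def Cauchy_def eq_onp_def)
    moreover have "norm (abs_completion (\<lambda>m. X n - X m)) \<le> e / 2"
      by (rule LIMSEQ_le_const2[OF norm_abs_completion[OF C]])
         (use M[OF n] in \<open>auto simp: dist_norm intro!: exI[of _ M] less_imp_le\<close>)
    ultimately show "dist (to_completion (X n)) (abs_completion X) < e"
      using e by (simp add: dist_norm)
  qed
qed

lemma completion_approx:
  obtains X where "Cauchy X" "z = abs_completion X" "(\<lambda>n. to_completion (X n)) \<longlonglongrightarrow> z"
proof -
  obtain X where "compl_rel X X" "z = abs_completion X"
    by (metis Quotient_completion Quotient_abs_rep Quotient_rep_reflp)
  then show ?thesis
    using that to_completion_tendsto by (auto simp: compl_rel_def)
qed

lemma completion_dense: "closure (range to_completion) = UNIV"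
proof -
  have "z \<in> closure (range to_completion)" for z :: "'a completion"
  proof -
    obtain X where "(\<lambda>n. to_completion (X n)) \<longlonglongrightarrow> z" using completion_approx by blast
    then show ?thesis
      unfolding closure_sequential by (intro exI[of _ "\<lambda>n. to_completion (X n)"]) simp
  qed
  then show ?thesis by blast
qed

instance completion :: (complex_inner) chilbert_space
proof
  fix Z :: "nat \<Rightarrow> 'a completion"
  assume Z: "Cauchy Z"
  have "\<exists>x. dist (to_completion x) (Z n) < inverse (Suc n)" for n
  proof -
    have "Z n \<in> closure (range to_completion)" by (simp add: completion_dense)
    moreover have "0 < inverse (real (Suc n))" by simp
    ultimately show ?thesis unfolding closure_approachable by blast
  qed
  then obtain x where x: "\<And>n. dist (to_completion (x n)) (Z n) < inverse (Suc n)" by metis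
  have 0: "(\<lambda>n. dist (to_completion (x n)) (Z n)) \<longlonglongrightarrow> 0"
    by (rule Lim_null_comparison[OF _ LIMSEQ_inverse_real_of_nat])
       (use x in \<open>auto intro!: always_eventually less_imp_le\<close>)
  have "Cauchy (\<lambda>n. Z n + (to_completion (x n) - Z n))"
    using 0 by (intro Cauchy_add' Z LIMSEQ_imp_Cauchy[of _ 0]) (simp add: dist_norm tendsto_norm_zero_iff)
  then have C: "Cauchy x"
    by (simp add: Cauchy_def dist_to_completion)
  have "(\<lambda>n. Z n - to_completion (x n)) \<longlonglongrightarrow> 0"
    using 0 by (simp add: dist_norm norm_minus_commute tendsto_norm_zero_iff)
  from tendsto_add[OF to_completion_tendsto[OF C] this] show "convergent Z"
    by (auto simp: convergent_def)
qed

lemma bounded_clinear_extension: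
  fixes f :: "'a::complex_inner \<Rightarrow> 'b::chilbert_space"
  assumes f: "bounded_clinear f"
  obtains g where "bounded_clinear g" "\<And>x. g (to_completion x) = f x"
proof -
  have bl: "bounded_linear f" and fC: "\<And>c x. f (c *\<^sub>C x) = c *\<^sub>C f x"
    using f by (auto simp: bounded_clinear_def)
  interpret f: bounded_linear f by (rule bl)
  define g where "g z = lim (\<lambda>n. f (rep_completion z n))" for z
  have conv: "(\<lambda>n. f (X n)) \<longlonglongrightarrow> g (abs_completion X)" if X: "Cauchy X" for X
  proof -
    define Y where "Y = rep_completion (abs_completion X)"
    have "compl_rel Y X"
      unfolding Y_def using X by (intro Quotient3_rep_abs[OF Quotient3_completion]) (simp add: compl_rel_def)
    then have Y: "Cauchy Y" "(\<lambda>n. Y n - X n) \<longlonglongrightarrow> 0"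
      by (auto simp: compl_rel_def)
    have "(\<lambda>n. f (Y n)) \<longlonglongrightarrow> g (abs_completion X)"
      unfolding g_def Y_def[symmetric]
      using f.Cauchy[OF Y(1)] Cauchy_convergent convergent_LIMSEQ_iff by blast
    moreover have "(\<lambda>n. f (Y n - X n)) \<longlonglongrightarrow> 0"
      using f.tendsto[OF Y(2)] by simp
    ultimately show ?thesis
      using tendsto_diff by (fastforce simp: f.diff)
  qed
  obtain K where K: "\<And>x. norm (f x) \<le> norm x * K" using f.bounded by blast
  have "bounded_clinear g"
    unfolding bounded_clinear_def
  proof (intro conjI allI bounded_linear_intro[where K = K])
    fix x y :: "'a completion" and r :: real and c :: complex
    obtain X where X: "Cauchy X" "x = abs_completion X" using completion_approx by blast
    obtain Y where Y: "Cauchy Y" "y = abs_completion Y" using completion_approx by blast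
    have sum: "x + y = abs_completion (\<lambda>n. X n + Y n)"
      unfolding X Y using X Y by (subst plus_completion.abs_eq) (auto simp: compl_rel_def eq_onp_def)
    show "g (x + y) = g x + g y"
      using LIMSEQ_unique[OF conv[OF Cauchy_add'[OF X(1) Y(1)]]]
        tendsto_add[OF conv[OF X(1)] conv[OF Y(1)]] by (simp add: f.add sum flip: X(2) Y(2))
    have sc: "c *\<^sub>C x = abs_completion (\<lambda>n. c *\<^sub>C X n)" for c
      unfolding X using X by (subst scaleC_completion.abs_eq) (auto simp: compl_rel_def eq_onp_def)
    show gC: "g (c *\<^sub>C x) = c *\<^sub>C g x" for c
      using LIMSEQ_unique[OF conv[OF Cauchy_scaleC[OF X(1), of c]]]
        tendsto_scaleC[OF conv[OF X(1)], of c] by (simp add: fC sc flip: X(2))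
    show "g (r *\<^sub>R x) = r *\<^sub>R g x"
      by (simp add: scaleR_scaleC[where 'a="'a completion"] scaleR_scaleC[where 'a='b] gC)
    have "norm (g x) \<le> norm (abs_completion X) * K"
      unfolding X(2)
      by (rule LIMSEQ_le[OF tendsto_norm[OF conv[OF X(1)]]
            tendsto_mult_right[OF norm_abs_completion[OF X(1)]]]) (use K in auto)
    then show "norm (g x) \<le> norm x * K" by (simp add: X(2))
  qed
  moreover have "g (to_completion x) = f x" for x
    using conv[of "\<lambda>_. x"] by (simp add: to_completion.abs_eq Cauchy_def LIMSEQ_const_iff)
  ultimately show ?thesis using that by blast
qed

section \<open>Tensor products of Hilbert spaces and of operators\<close>

text \<open>The algebraic tensor product is realised as a space of sesquilinear forms: the elementary
  tensor of \<open>h\<close> and \<open>k\<close> is the function mapping \<open>u\<close>, \<open>v\<close> to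
  \<open>cinner u h * cinner v k\<close>. As inner products are nondegenerate, this is the usual algebraic
  tensor product.\<close>

definition tensor_form :: "('a::complex_inner \<times> 'b::complex_inner) list \<Rightarrow> 'a \<Rightarrow> 'b \<Rightarrow> complex" where
  "tensor_form xs u v = (\<Sum>(h, k)\<leftarrow>xs. cinner u h * cinner v k)"

typedef (overloaded) ('a, 'b) alg_tensor =
  "range (tensor_form :: ('a::complex_inner \<times> 'b::complex_inner) list \<Rightarrow> _)"
  by blast

setup_lifting type_definition_alg_tensor

lemma tensor_form_Nil [simp]: "tensor_form [] = (\<lambda>_ _. 0)"
  by (simp add: tensor_form_def fun_eq_iff)

lemma tensor_form_Cons [simp]:
  "tensor_form ((h, k) # xs) = (\<lambda>u v. cinner u h * cinner v k + tensor_form xs u v)"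
  by (simp add: tensor_form_def fun_eq_iff)

lemma tensor_form_append:
  "tensor_form (xs @ ys) = (\<lambda>u v. tensor_form xs u v + tensor_form ys u v)"
  by (simp add: tensor_form_def fun_eq_iff)

lemma tensor_form_scale:
  "tensor_form (map (apfst (scaleC c)) xs) = (\<lambda>u v. c * tensor_form xs u v)"
  by (induction xs) (auto simp: fun_eq_iff cinner_scaleC_right algebra_simps)

definition tensor_pair :: "('a::complex_inner \<times> 'b::complex_inner) list \<Rightarrow> ('a \<Rightarrow> 'b \<Rightarrow> complex) \<Rightarrow> complex"
  where "tensor_pair xs F = (\<Sum>(h, k)\<leftarrow>xs. F h k)"

lemma tensor_pair_zero: "tensor_pair xs (\<lambda>_ _. 0) = 0"
  by (induction xs) (auto simp: tensor_pair_def)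

lemma tensor_pair_add: "tensor_pair xs (\<lambda>u v. F u v + G u v) = tensor_pair xs F + tensor_pair xs G"
  by (induction xs) (auto simp: tensor_pair_def algebra_simps)

lemma tensor_pair_scale: "tensor_pair xs (\<lambda>u v. c * F u v) = c * tensor_pair xs F"
  by (induction xs) (auto simp: tensor_pair_def algebra_simps)

lemma tensor_pair_commute: "tensor_pair xs (tensor_form ys) = cnj (tensor_pair ys (tensor_form xs))"
proof (induction xs)
  case Nil
  then show ?case by (induction ys) (auto simp: tensor_pair_def)
next
  case (Cons x xs)
  obtain h k where x: "x = (h, k)" by (cases x)
  have 1: "tensor_pair ys (\<lambda>u v. cinner u h * cinner v k) = cnj (tensor_form ys h k)"
  proof (induction ys)
    case (Cons y ys)
    then show ?case
      using cinner_commute[of h "fst y"] cinner_commute[of k "snd y"]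
      by (cases y) (simp add: tensor_pair_def)
  qed (simp add: tensor_pair_def)
  show ?case
    using Cons by (simp add: x 1 tensor_pair_add) (simp add: tensor_pair_def)
qed

lemma tensor_pair_cong:
  "tensor_form xs = tensor_form xs' \<Longrightarrow> tensor_pair xs (tensor_form ys) = tensor_pair xs' (tensor_form ys)"
  by (simp add: tensor_pair_commute[of _ ys])

text \<open>Finite sums of elementary tensors can be rewritten with orthonormal second factors.\<close>

definition onormal :: "'a::complex_inner set \<Rightarrow> bool" where
  "onormal E \<longleftrightarrow> finite E \<and> (\<forall>e\<in>E. \<forall>f\<in>E. cinner e f = (if e = f then 1 else 0))"

definition cbilinear :: "('a::complex_inner \<Rightarrow> 'b::complex_inner \<Rightarrow> complex) \<Rightarrow> bool" where
  "cbilinear B \<longleftrightarrow> (\<forall>h h' k. B (h + h') k = B h k + B h' k) \<and> (\<forall>h k k'. B h (k + k') = B h k + B h k') \<and>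
    (\<forall>c h k. B (c *\<^sub>C h) k = c * B h k) \<and> (\<forall>c h k. B h (c *\<^sub>C k) = c * B h k)"

lemma cbilinear_zero:
  assumes "cbilinear B"
  shows "B 0 k = 0" "B h 0 = 0"
proof -
  have "B (0 + 0) k = B 0 k + B 0 k" "B h (0 + 0) = B h 0 + B h 0"
    using assms unfolding cbilinear_def by blast+
  then show "B 0 k = 0" "B h 0 = 0" by auto
qed

lemma cbilinear_sum_right:
  assumes "cbilinear B"
  shows "B h (\<Sum>i\<in>A. c i *\<^sub>C f i) = (\<Sum>i\<in>A. c i * B h (f i))"
  by (induction A rule: infinite_finite_induct)
    (use assms in \<open>auto simp: cbilinear_zero[OF assms] cbilinear_def\<close>)

lemma onormal_form:
  fixes xs :: "('a::complex_inner \<times> 'b::complex_inner) list"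
  obtains E g where "onormal E"
    "\<And>B. cbilinear B \<Longrightarrow> (\<Sum>(h, k)\<leftarrow>xs. B h k) = (\<Sum>e\<in>E. B (g e) e)"
proof (induction xs arbitrary: thesis)
  case Nil
  show ?case by (rule Nil[of "{}"]) (auto simp: onormal_def)
next
  case (Cons x xs)
  obtain h k where x: "x = (h, k)" by (cases x)
  obtain E g where E: "onormal E"
    and g: "\<And>B. cbilinear B \<Longrightarrow> (\<Sum>(h, k)\<leftarrow>xs. B h k) = (\<Sum>e\<in>E. B (g e) e)"
    using Cons.IH by blast
  have fin: "finite E" and on: "\<And>e f. e \<in> E \<Longrightarrow> f \<in> E \<Longrightarrow> cinner e f = (if e = f then 1 else 0)"
    using E by (auto simp: onormal_def)
  define r where "r = k - (\<Sum>e\<in>E. cinner e k *\<^sub>C e)"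
  define g1 where "g1 e = g e + cinner e k *\<^sub>C h" for e
  have k: "k = r + (\<Sum>e\<in>E. cinner e k *\<^sub>C e)" by (simp add: r_def)
  have orth: "cinner f r = 0" if "f \<in> E" for f
  proof -
    have "(\<Sum>e\<in>E. cinner f (cinner e k *\<^sub>C e)) = (\<Sum>e\<in>E. if e = f then cinner f k else 0)"
      using that by (intro sum.cong) (auto simp: cinner_scaleC_right on)
    then show ?thesis
      using that fin by (simp add: r_def cinner_diff_right cinner_sum_right)
  qed
  have main: "(\<Sum>(h, k)\<leftarrow>x # xs. B h k) = B h r + (\<Sum>e\<in>E. B (g1 e) e)" if B: "cbilinear B" for B
  proof -
    have "B h k = B h r + B h (\<Sum>e\<in>E. cinner e k *\<^sub>C e)"
      using B by (subst k) (simp add: cbilinear_def)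
    also have "B h (\<Sum>e\<in>E. cinner e k *\<^sub>C e) = (\<Sum>e\<in>E. B (cinner e k *\<^sub>C h) e)"
      using B by (simp add: cbilinear_sum_right[OF B]) (simp add: cbilinear_def)
    finally have "B h k = B h r + (\<Sum>e\<in>E. B (cinner e k *\<^sub>C h) e)" .
    moreover have "B (g1 e) e = B (g e) e + B (cinner e k *\<^sub>C h) e" for e
      using B by (simp add: g1_def cbilinear_def)
    ultimately show ?thesis
      by (simp add: x g[OF B] sum.distrib)
  qed
  show ?case
  proof (cases "r = 0")
    case True
    show ?thesis
      using main by (intro Cons.prems[OF E, of g1]) (simp add: True cbilinear_zero)
  next
    case False
    define f where "f = complex_of_real (inverse (norm r)) *\<^sub>C r"
    have ff: "cinner f f = 1"
      using False by (simp add: f_def cinner_self norm_scaleC norm_inverse flip: of_real_inverse)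
    have fe: "cinner e f = 0" "cinner f e = 0" if "e \<in> E" for e
      using orth[OF that] cinner_commute[of r e]
      by (simp_all add: f_def cinner_scaleC_left cinner_scaleC_right)
    have fE: "f \<notin> E" using ff fe by fastforce
    have r: "r = complex_of_real (norm r) *\<^sub>C f"
      using False by (simp add: f_def scaleC_scaleC flip: of_real_mult)
    define g2 where "g2 e = (if e = f then complex_of_real (norm r) *\<^sub>C h else g1 e)" for e
    show ?thesis
    proof (rule Cons.prems)
      show "onormal (insert f E)"
        using fin on ff fe fE unfolding onormal_def by auto
      fix B :: "'a \<Rightarrow> 'b \<Rightarrow> complex" assume B: "cbilinear B"
      have "B h r = B (g2 f) f"
        using B by (subst r) (simp add: g2_def cbilinear_def)
      moreover have "(\<Sum>e\<in>E. B (g1 e) e) = (\<Sum>e\<in>E. B (g2 e) e)"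
        using fE by (intro sum.cong) (auto simp: g2_def)
      ultimately show "(\<Sum>(h, k)\<leftarrow>x # xs. B h k) = (\<Sum>e\<in>insert f E. B (g2 e) e)"
        using main[OF B] fin fE by simp
    qed
  qed
qed

lemma cbilinear_form: "cbilinear (\<lambda>h k. cinner u h * cinner v k)"
  by (auto simp: cbilinear_def cinner_add_right cinner_scaleC_right algebra_simps)

lemma tensor_form_sesq:
  "tensor_form xs (u + u') v = tensor_form xs u v + tensor_form xs u' v"
  "tensor_form xs u (v + v') = tensor_form xs u v + tensor_form xs u v'"
  "tensor_form xs (c *\<^sub>C u) v = cnj c * tensor_form xs u v"
  "tensor_form xs u (c *\<^sub>C v) = cnj c * tensor_form xs u v"
  by (induction xs) (auto simp: cinner_add_left cinner_scaleC_left algebra_simps)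

lemma cbilinear_cnj_form: "cbilinear (\<lambda>h k. cnj (tensor_form xs h k))"
  by (auto simp: cbilinear_def tensor_form_sesq)

lemma tensor_pair_onormal:
  assumes E: "onormal E"
    and g: "\<And>B. cbilinear B \<Longrightarrow> (\<Sum>(h, k)\<leftarrow>xs. B h k) = (\<Sum>e\<in>E. B (g e) e)"
  shows "tensor_pair xs (tensor_form xs) = complex_of_real (\<Sum>e\<in>E. (norm (g e))\<^sup>2)"
proof -
  have cnj_pair: "cnj (tensor_pair xs F) = (\<Sum>(h, k)\<leftarrow>xs. cnj (F h k))" for F
    by (induction xs) (auto simp: tensor_pair_def)
  have 1: "tensor_form xs (g e) e = (norm (g e))\<^sup>2" if "e \<in> E" for e
  proof -
    have "tensor_form xs (g e) e = (\<Sum>f\<in>E. cinner (g e) (g f) * cinner e f)"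
      using g[OF cbilinear_form] by (simp add: tensor_form_def)
    also have "\<dots> = (\<Sum>f\<in>E. if f = e then cinner (g e) (g e) else 0)"
      using that E by (intro sum.cong) (auto simp: onormal_def)
    also have "\<dots> = (norm (g e))\<^sup>2"
      using that E by (simp add: onormal_def cinner_self)
    finally show ?thesis .
  qed
  have "cnj (tensor_pair xs (tensor_form xs)) = (\<Sum>e\<in>E. cnj (tensor_form xs (g e) e))"
    using g[OF cbilinear_cnj_form[of xs]] by (simp add: cnj_pair)
  also have "\<dots> = complex_of_real (\<Sum>e\<in>E. (norm (g e))\<^sup>2)"
    by (simp add: 1)
  finally show ?thesis
    by (metis complex_cnj_cnj complex_cnj_complex_of_real)
qed

lemma tensor_pair_ge0: "0 \<le> Re (tensor_pair xs (tensor_form xs))"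
  by (rule onormal_form[of xs]) (simp add: tensor_pair_onormal sum_nonneg)

lemma tensor_pair_eq_0D:
  fixes xs :: "('a::complex_inner \<times> 'b::complex_inner) list"
  assumes "Re (tensor_pair xs (tensor_form xs)) = 0" and B: "cbilinear B"
  shows "(\<Sum>(h, k)\<leftarrow>xs. B h k) = 0"
proof -
  obtain E g where E: "onormal (E :: 'b set)"
    and g: "\<And>B. cbilinear B \<Longrightarrow> (\<Sum>(h, k)\<leftarrow>xs. B h k) = (\<Sum>e\<in>E. B (g e) e)"
    using onormal_form by blast
  have "(\<Sum>e\<in>E. (norm (g e))\<^sup>2) = 0"
    using assms tensor_pair_onormal[OF E g] by simp
  then have "\<forall>e\<in>E. g e = 0"
    using E by (subst (asm) sum_nonneg_eq_0_iff) (auto simp: onormal_def)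
  then show ?thesis by (simp add: g[OF B] cbilinear_zero[OF B])
qed

lemma tensor_form_eq_0D:
  assumes "tensor_form xs = (\<lambda>_ _. 0)" and "cbilinear B"
  shows "(\<Sum>(h, k)\<leftarrow>xs. B h k) = 0"
proof (rule tensor_pair_eq_0D[OF _ assms(2)])
  show "Re (tensor_pair xs (tensor_form xs)) = 0"
    by (simp add: assms(1) tensor_pair_zero)
qed

instantiation alg_tensor :: (complex_inner, complex_inner) complex_inner
begin

lift_definition zero_alg_tensor :: "('a, 'b) alg_tensor" is "\<lambda>_ _. 0"
  by (rule range_eqI[of _ _ "[]"]) simp
lift_definition plus_alg_tensor :: "('a, 'b) alg_tensor \<Rightarrow> ('a, 'b) alg_tensor \<Rightarrow> ('a, 'b) alg_tensor"
  is "\<lambda>F G u v. F u v + G u v"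
  by (auto simp flip: tensor_form_append)
lift_definition scaleC_alg_tensor :: "complex \<Rightarrow> ('a, 'b) alg_tensor \<Rightarrow> ('a, 'b) alg_tensor"
  is "\<lambda>c F u v. c * F u v"
  by (auto simp flip: tensor_form_scale)
definition scaleR_alg_tensor :: "real \<Rightarrow> ('a, 'b) alg_tensor \<Rightarrow> ('a, 'b) alg_tensor" where
  "scaleR_alg_tensor r F = complex_of_real r *\<^sub>C F"
definition uminus_alg_tensor :: "('a, 'b) alg_tensor \<Rightarrow> ('a, 'b) alg_tensor" where
  "uminus_alg_tensor F = (- 1) *\<^sub>C F"
definition minus_alg_tensor :: "('a, 'b) alg_tensor \<Rightarrow> ('a, 'b) alg_tensor \<Rightarrow> ('a, 'b) alg_tensor" where
  "minus_alg_tensor F G = F + - G"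
lift_definition cinner_alg_tensor :: "('a, 'b) alg_tensor \<Rightarrow> ('a, 'b) alg_tensor \<Rightarrow> complex"
  is "\<lambda>F G. tensor_pair (SOME xs. F = tensor_form xs) G" .
definition inner_alg_tensor :: "('a, 'b) alg_tensor \<Rightarrow> ('a, 'b) alg_tensor \<Rightarrow> real" where
  "inner_alg_tensor x y = Re (cinner x y)"
definition norm_alg_tensor :: "('a, 'b) alg_tensor \<Rightarrow> real" where
  "norm_alg_tensor x = sqrt (inner x x)"
definition dist_alg_tensor :: "('a, 'b) alg_tensor \<Rightarrow> ('a, 'b) alg_tensor \<Rightarrow> real" where
  "dist_alg_tensor x y = norm (x - y)"
definition sgn_alg_tensor :: "('a, 'b) alg_tensor \<Rightarrow> ('a, 'b) alg_tensor" where
  "sgn_alg_tensor x = inverse (norm x) *\<^sub>R x"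
definition uniformity_alg_tensor :: "(('a, 'b) alg_tensor \<times> ('a, 'b) alg_tensor) filter" where
  "uniformity_alg_tensor = (INF e\<in>{0<..}. principal {(x, y). dist x y < e})"
definition open_alg_tensor :: "('a, 'b) alg_tensor set \<Rightarrow> bool" where
  "open_alg_tensor U \<longleftrightarrow> (\<forall>x\<in>U. \<forall>\<^sub>F (x', y) in uniformity. x' = x \<longrightarrow> y \<in> U)"

lemma tensor_pair_some:
  "tensor_pair (SOME xs. tensor_form ys = tensor_form xs) (tensor_form zs)
    = tensor_pair ys (tensor_form zs)"
  by (rule tensor_pair_cong, rule someI2[of _ ys]) auto

instance
proof
  fix x y z :: "('a, 'b) alg_tensor" and a b :: complex and r s :: real
  show 1: "x + y + z = x + (y + z)" by transfer (simp add: algebra_simps)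
  show "x + y = y + x" by transfer (simp add: algebra_simps)
  show "0 + x = x" by transfer simp
  show "- x + x = 0" unfolding uminus_alg_tensor_def by transfer simp
  show "x - y = x + - y" by (fact minus_alg_tensor_def)
  show "r *\<^sub>R (x + y) = r *\<^sub>R x + r *\<^sub>R y"
    unfolding scaleR_alg_tensor_def by transfer (simp add: algebra_simps)
  show "(r + s) *\<^sub>R x = r *\<^sub>R x + s *\<^sub>R x"
    unfolding scaleR_alg_tensor_def by transfer (simp add: algebra_simps)
  show "r *\<^sub>R s *\<^sub>R x = (r * s) *\<^sub>R x"
    unfolding scaleR_alg_tensor_def by transfer (simp add: mult.assoc)
  show "1 *\<^sub>R x = x" unfolding scaleR_alg_tensor_def by transfer simp
  show "a *\<^sub>C (x + y) = a *\<^sub>C x + a *\<^sub>C y" by transfer (simp add: algebra_simps)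
  show "(a + b) *\<^sub>C x = a *\<^sub>C x + b *\<^sub>C x" by transfer (simp add: algebra_simps)
  show "a *\<^sub>C b *\<^sub>C x = (a * b) *\<^sub>C x" by transfer (simp add: mult.assoc)
  show "1 *\<^sub>C x = x" by transfer simp
  show "r *\<^sub>R x = complex_of_real r *\<^sub>C x" by (fact scaleR_alg_tensor_def)
  show "dist x y = norm (x - y)" by (fact dist_alg_tensor_def)
  show "sgn x = inverse (norm x) *\<^sub>R x" by (fact sgn_alg_tensor_def)
  show "(uniformity :: (('a, 'b) alg_tensor \<times> ('a, 'b) alg_tensor) filter)
      = (INF e\<in>{0<..}. principal {(x, y). dist x y < e})"
    by (fact uniformity_alg_tensor_def)
  show "open U \<longleftrightarrow> (\<forall>x\<in>U. \<forall>\<^sub>F (x', y) in uniformity. x' = x \<longrightarrow> y \<in> U)"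
    for U :: "('a, 'b) alg_tensor set"
    by (fact open_alg_tensor_def)
  have commute: "cinner x y = cnj (cinner y x)" for x y :: "('a, 'b) alg_tensor"
  proof transfer
    fix F G :: "'a \<Rightarrow> 'b \<Rightarrow> complex"
    assume "F \<in> range tensor_form" "G \<in> range tensor_form"
    then obtain xs ys where FG: "F = tensor_form xs" "G = tensor_form ys" by blast
    show "tensor_pair (SOME xs. F = tensor_form xs) G
        = cnj (tensor_pair (SOME xs. G = tensor_form xs) F)"
      unfolding FG tensor_pair_some by (rule tensor_pair_commute)
  qed
  have add: "cinner x (y + z) = cinner x y + cinner x z" for x y z :: "('a, 'b) alg_tensor"
    by transfer (rule tensor_pair_add)
  have scale: "cinner x (a *\<^sub>C y) = a * cinner x y" for x y :: "('a, 'b) alg_tensor" and a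
    by transfer (rule tensor_pair_scale)
  show "cinner x y = cnj (cinner y x)" by (fact commute)
  show "cinner x (y + z) = cinner x y + cinner x z" by (fact add)
  show "cinner x (a *\<^sub>C y) = a * cinner x y" by (fact scale)
  show "inner x y = Re (cinner x y)" by (fact inner_alg_tensor_def)
  show "inner x y = inner y x"
    unfolding inner_alg_tensor_def by (subst commute) simp
  have add': "cinner (x + y) z = cinner x z + cinner y z" for x y z :: "('a, 'b) alg_tensor"
    by (subst (1 2 3) commute) (simp add: add)
  show "inner (x + y) z = inner x z + inner y z"
    unfolding inner_alg_tensor_def by (simp add: add')
  have "cinner (r *\<^sub>R x) y = complex_of_real r * cinner x y"
    unfolding scaleR_alg_tensor_def by (subst (1 2) commute) (simp add: scale)
  then show "inner (r *\<^sub>R x) y = r * inner x y"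
    unfolding inner_alg_tensor_def by simp
  show "0 \<le> inner x x"
    unfolding inner_alg_tensor_def by transfer (auto simp: tensor_pair_some tensor_pair_ge0)
  show "inner x x = 0 \<longleftrightarrow> x = 0"
    unfolding inner_alg_tensor_def
  proof transfer
    fix F :: "'a \<Rightarrow> 'b \<Rightarrow> complex" assume "F \<in> range tensor_form"
    then obtain xs where F: "F = tensor_form xs" by blast
    show "Re (tensor_pair (SOME xs. F = tensor_form xs) F) = 0 \<longleftrightarrow> F = (\<lambda>_ _. 0)"
    proof
      assume "Re (tensor_pair (SOME xs. F = tensor_form xs) F) = 0"
      then have *: "Re (tensor_pair xs (tensor_form xs)) = 0" by (simp add: F tensor_pair_some)
      show "F = (\<lambda>_ _. 0)"
        using tensor_pair_eq_0D[OF * cbilinear_form] by (simp add: F tensor_form_def fun_eq_iff)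
    next
      assume "F = (\<lambda>_ _. 0)"
      then show "Re (tensor_pair (SOME xs. F = tensor_form xs) F) = 0"
        by (simp add: tensor_pair_zero)
    qed
  qed
  show "norm x = sqrt (inner x x)" by (fact norm_alg_tensor_def)
qed

end

lift_definition elem_tensor :: "'a::complex_inner \<Rightarrow> 'b::complex_inner \<Rightarrow> ('a, 'b) alg_tensor"
  is "\<lambda>h k u v. cinner u h * cinner v k"
  by (rule image_eqI[of _ _ "[(h, k)]" for h k]) auto

lemma elem_tensor_add_left: "elem_tensor (h + h') k = elem_tensor h k + elem_tensor h' k"
  by transfer (simp add: cinner_add_right algebra_simps)

lemma elem_tensor_add_right: "elem_tensor h (k + k') = elem_tensor h k + elem_tensor h k'"
  by transfer (simp add: cinner_add_right algebra_simps)

lemma elem_tensor_scaleC_left: "elem_tensor (c *\<^sub>C h) k = c *\<^sub>C elem_tensor h k"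
  by transfer (simp add: cinner_scaleC_right algebra_simps)

lemma elem_tensor_scaleC_right: "elem_tensor h (c *\<^sub>C k) = c *\<^sub>C elem_tensor h k"
  by transfer (simp add: cinner_scaleC_right algebra_simps)

lemma cinner_elem_tensor: "cinner (elem_tensor h k) (elem_tensor h' k') = cinner h h' * cinner k k'"
proof transfer
  fix h h' :: 'a and k k' :: 'b
  have "tensor_form [(h, k)] = (\<lambda>u v. cinner u h * cinner v k)" for h :: 'a and k :: 'b
    by simp
  then show "tensor_pair (SOME xs. (\<lambda>u v. cinner u h * cinner v k) = tensor_form xs)
      (\<lambda>u v. cinner u h' * cinner v k') = cinner h h' * cinner k k'"
    using tensor_pair_some[of "[(h, k)]" "[(h', k')]"] by (simp add: tensor_pair_def)
qed

lemma alg_tensor_sum_list: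
  obtains xs where "F = (\<Sum>(h, k)\<leftarrow>xs. elem_tensor h k)"
proof -
  obtain xs where xs: "Rep_alg_tensor F = tensor_form xs"
    using Rep_alg_tensor by blast
  have "Rep_alg_tensor (\<Sum>(h, k)\<leftarrow>xs. elem_tensor h k) = tensor_form xs"
    by (induction xs) (auto simp: zero_alg_tensor.rep_eq plus_alg_tensor.rep_eq elem_tensor.rep_eq)
  then have "F = (\<Sum>(h, k)\<leftarrow>xs. elem_tensor h k)"
    by (simp add: xs flip: Rep_alg_tensor_inject)
  then show ?thesis by (rule that)
qed

definition elem_sum :: "('a::complex_inner \<times> 'b::complex_inner) list \<Rightarrow> ('a, 'b) alg_tensor" where
  "elem_sum xs = (\<Sum>(h, k)\<leftarrow>xs. elem_tensor h k)"

lemma Rep_elem_sum: "Rep_alg_tensor (elem_sum xs) = tensor_form xs"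
  by (induction xs)
    (auto simp: elem_sum_def zero_alg_tensor.rep_eq plus_alg_tensor.rep_eq elem_tensor.rep_eq)

lemma elem_sum_append: "elem_sum (xs @ ys) = elem_sum xs + elem_sum ys"
  by (simp add: elem_sum_def)

lemma elem_sum_scale: "elem_sum (map (apfst (scaleC c)) xs) = c *\<^sub>C elem_sum xs"
  by (induction xs) (auto simp: elem_sum_def scaleC_add_right elem_tensor_scaleC_left)

lemma elem_sum_eqI: "tensor_form xs = tensor_form ys \<Longrightarrow> elem_sum xs = elem_sum ys"
  by (simp add: Rep_elem_sum flip: Rep_alg_tensor_inject)

lemma elem_sum_cases: obtains xs where "F = elem_sum xs"
  using alg_tensor_sum_list[of F] unfolding elem_sum_def by blast

lemma norm_elem_sum: "(norm (elem_sum xs))\<^sup>2 = Re (tensor_pair xs (tensor_form xs))"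
proof -
  have "cinner (elem_sum xs) (elem_sum xs) = tensor_pair xs (tensor_form xs)"
    by (simp add: cinner_alg_tensor.rep_eq Rep_elem_sum tensor_pair_some)
  then show ?thesis
    by (simp add: cinner_self complex_eq_iff)
qed

lemma alg_tensor_op_left:
  fixes S :: "'a::complex_inner \<Rightarrow> 'c::complex_inner"
  assumes S: "bounded_clinear S"
  obtains R :: "('a, 'b::complex_inner) alg_tensor \<Rightarrow> ('c, 'b) alg_tensor"
  where "bounded_clinear R" "\<And>h k. R (elem_tensor h k) = elem_tensor (S h) k"
proof -
  have bl: "bounded_linear S" and SC: "\<And>c x. S (c *\<^sub>C x) = c *\<^sub>C S x"
    using S by (auto simp: bounded_clinear_def)
  interpret S: bounded_linear S by (rule bl)
  define m where "m = map (apfst S :: 'a \<times> 'b \<Rightarrow> _)"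
  have bil: "cbilinear (\<lambda>h. B (S h))" if "cbilinear B" for B :: "'c \<Rightarrow> 'b \<Rightarrow> complex"
    using that by (simp add: cbilinear_def S.add SC)
  have sum_m: "(\<Sum>(h, k)\<leftarrow>m xs. B h k) = (\<Sum>(h, k)\<leftarrow>xs. B (S h) k)" for xs and B :: "'c \<Rightarrow> 'b \<Rightarrow> complex"
    by (induction xs) (auto simp: m_def)
  have wd: "elem_sum (m xs) = elem_sum (m ys)" if eq: "elem_sum xs = elem_sum ys" for xs ys
  proof (rule elem_sum_eqI, intro ext)
    fix u v
    define zs where "zs = xs @ map (apfst (scaleC (- 1))) ys"
    have "tensor_form xs = tensor_form ys"
      using eq by (metis Rep_elem_sum)
    then have "tensor_form zs = (\<lambda>_ _. 0)"
      unfolding zs_def tensor_form_append tensor_form_scale by simp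
    from tensor_form_eq_0D[OF this bil[OF cbilinear_form]]
    have "tensor_form (m zs) u v = 0"
      by (simp add: tensor_form_def sum_m)
    moreover have "m (map (apfst (scaleC (- 1))) ys) = map (apfst (scaleC (- 1))) (m ys)"
      by (auto simp: m_def S.neg)
    then have "m zs = m xs @ map (apfst (scaleC (- 1))) (m ys)"
      by (simp add: zs_def m_def)
    ultimately show "tensor_form (m xs) u v = tensor_form (m ys) u v"
      by (simp only: tensor_form_append tensor_form_scale) simp
  qed
  define R where "R F = elem_sum (m (SOME xs. F = elem_sum xs))" for F
  have R: "R (elem_sum xs) = elem_sum (m xs)" for xs
    unfolding R_def by (rule someI2[of _ xs]) (auto intro: wd)
  obtain K where K: "0 \<le> K" "\<And>x. norm (S x) \<le> norm x * K"
    using S.nonneg_bounded by blast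
  have "bounded_clinear R"
    unfolding bounded_clinear_def
  proof (intro conjI allI bounded_linear_intro[where K = K])
    fix F G :: "('a, 'b) alg_tensor" and r :: real and c :: complex
    obtain xs where F: "F = elem_sum xs" by (rule elem_sum_cases)
    obtain ys where G: "G = elem_sum ys" by (rule elem_sum_cases)
    have "F + G = elem_sum (xs @ ys)" by (simp add: F G elem_sum_append)
    then show "R (F + G) = R F + R G"
      by (simp add: F G R) (simp add: m_def elem_sum_append)
    show RC: "R (c *\<^sub>C F) = c *\<^sub>C R F" for c
    proof -
      have "m (map (apfst (scaleC c)) xs) = map (apfst (scaleC c)) (m xs)"
        by (auto simp: m_def SC)
      then show ?thesis
        unfolding F elem_sum_scale[symmetric] R by simp
    qed
    show "R (r *\<^sub>R F) = r *\<^sub>R R F"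
      by (simp add: scaleR_alg_tensor_def RC)
    obtain E g where E: "onormal (E :: 'b set)"
      and g: "\<And>B. cbilinear B \<Longrightarrow> (\<Sum>(h, k)\<leftarrow>xs. B h k) = (\<Sum>e\<in>E. B (g e) e)"
      using onormal_form by blast
    have "(norm (R F))\<^sup>2 = (\<Sum>e\<in>E. (norm (S (g e)))\<^sup>2)"
      unfolding F R norm_elem_sum
      by (subst tensor_pair_onormal[OF E, of _ "\<lambda>e. S (g e)"]) (use g bil in \<open>simp_all add: sum_m\<close>)
    also have "\<dots> \<le> (\<Sum>e\<in>E. (norm (g e) * K)\<^sup>2)"
      by (intro sum_mono power_mono K) auto
    also have "\<dots> = (\<Sum>e\<in>E. (norm (g e))\<^sup>2) * K\<^sup>2"
      by (simp add: power_mult_distrib sum_distrib_right)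
    also have "(\<Sum>e\<in>E. (norm (g e))\<^sup>2) = (norm F)\<^sup>2"
      unfolding F norm_elem_sum by (subst tensor_pair_onormal[OF E g]) simp_all
    finally have "(norm (R F))\<^sup>2 \<le> (norm F * K)\<^sup>2"
      by (simp add: power_mult_distrib)
    then show "norm (R F) \<le> norm F * K"
      using K(1) by (simp add: power2_le_iff_abs_le)
  qed
  moreover have "R (elem_tensor h k) = elem_tensor (S h) k" for h k
    using R[of "[(h, k)]"] by (simp add: elem_sum_def m_def)
  ultimately show ?thesis using that by blast
qed

lemma alg_tensor_swap:
  obtains R :: "('a::complex_inner, 'b::complex_inner) alg_tensor \<Rightarrow> ('b, 'a) alg_tensor"
  where "bounded_clinear R" "\<And>h k. R (elem_tensor h k) = elem_tensor k h"
proof -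
  define m where "m = map (prod.swap :: 'a \<times> 'b \<Rightarrow> _)"
  have form: "tensor_form (m xs) = (\<lambda>v u. tensor_form xs u v)" for xs
    by (induction xs) (auto simp: m_def fun_eq_iff)
  have pair: "tensor_pair (m xs) (\<lambda>v u. H u v) = tensor_pair xs H" for xs H
    by (induction xs) (auto simp: m_def tensor_pair_def)
  have wd: "elem_sum (m xs) = elem_sum (m ys)" if "elem_sum xs = elem_sum ys" for xs ys
  proof (rule elem_sum_eqI)
    have "tensor_form xs = tensor_form ys" using that by (metis Rep_elem_sum)
    then show "tensor_form (m xs) = tensor_form (m ys)" by (simp only: form)
  qed
  define R where "R F = elem_sum (m (SOME xs. F = elem_sum xs))" for F
  have R: "R (elem_sum xs) = elem_sum (m xs)" for xs
    unfolding R_def by (rule someI2[of _ xs]) (auto intro: wd)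
  have "bounded_clinear R"
    unfolding bounded_clinear_def
  proof (intro conjI allI bounded_linear_intro[where K = 1])
    fix F G :: "('a, 'b) alg_tensor" and r :: real and c :: complex
    obtain xs where F: "F = elem_sum xs" by (rule elem_sum_cases)
    obtain ys where G: "G = elem_sum ys" by (rule elem_sum_cases)
    have "F + G = elem_sum (xs @ ys)" by (simp add: F G elem_sum_append)
    then show "R (F + G) = R F + R G"
      by (simp add: F G R) (simp add: m_def elem_sum_append)
    show RC: "R (c *\<^sub>C F) = c *\<^sub>C R F" for c
    proof -
      have "elem_sum (m (map (apfst (scaleC c)) xs)) = elem_sum (map (apfst (scaleC c)) (m xs))"
        by (rule elem_sum_eqI) (simp add: form tensor_form_scale)
      then show ?thesis
        unfolding F elem_sum_scale[symmetric] R by simp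
    qed
    show "R (r *\<^sub>R F) = r *\<^sub>R R F"
      by (simp add: scaleR_alg_tensor_def RC)
    have "(norm (R F))\<^sup>2 = (norm F)\<^sup>2"
      unfolding F R norm_elem_sum form pair ..
    then show "norm (R F) \<le> norm F * 1"
      by (simp add: power2_eq_iff_nonneg)
  qed
  moreover have "R (elem_tensor h k) = elem_tensor k h" for h k
    using R[of "[(h, k)]"] by (simp add: elem_sum_def m_def)
  ultimately show ?thesis using that by blast
qed

lemma bounded_clinear_compose:
  "bounded_clinear f \<Longrightarrow> bounded_clinear g \<Longrightarrow> bounded_clinear (\<lambda>x. f (g x))"
  unfolding bounded_clinear_def by (auto intro: bounded_linear_compose)

lemma bounded_clinear_to_completion: "bounded_clinear to_completion"
  unfolding bounded_clinear_def
  by (auto intro!: bounded_linear_intro[where K = 1]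
      simp: to_completion_add to_completion_scaleC norm_to_completion
        scaleR_scaleC[where 'a="'a completion"] scaleR_scaleC[where 'a='a])

text \<open>The Hilbert space tensor product is the completion of the algebraic tensor product.\<close>

type_synonym ('a, 'b) hilbert_tensor = "('a, 'b) alg_tensor completion"

definition tensor_vec :: "'a::complex_inner \<Rightarrow> 'b::complex_inner \<Rightarrow> ('a, 'b) hilbert_tensor"
    (infixr "\<otimes>\<^sub>v" 70)
  where "h \<otimes>\<^sub>v k = to_completion (elem_tensor h k)"

lemma tensor_vec_add_left: "(h + h') \<otimes>\<^sub>v k = h \<otimes>\<^sub>v k + h' \<otimes>\<^sub>v k"
  and tensor_vec_add_right: "h \<otimes>\<^sub>v (k + k') = h \<otimes>\<^sub>v k + h \<otimes>\<^sub>v k'"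
  and tensor_vec_scaleC_left: "(c *\<^sub>C h) \<otimes>\<^sub>v k = c *\<^sub>C (h \<otimes>\<^sub>v k)"
  and tensor_vec_scaleC_right: "h \<otimes>\<^sub>v (c *\<^sub>C k) = c *\<^sub>C (h \<otimes>\<^sub>v k)"
  by (simp_all add: tensor_vec_def elem_tensor_add_left elem_tensor_add_right
      elem_tensor_scaleC_left elem_tensor_scaleC_right to_completion_add to_completion_scaleC)

lemma cinner_tensor_vec: "cinner (h \<otimes>\<^sub>v k) (h' \<otimes>\<^sub>v k') = cinner h h' * cinner k k'"
  by (simp add: tensor_vec_def cinner_to_completion cinner_elem_tensor)

lemma tensor_vec_total:
  "closure (complex_vector.span (range (\<lambda>(h, k). h \<otimes>\<^sub>v k)))
    = (UNIV :: ('a::complex_inner, 'b::complex_inner) hilbert_tensor set)" (is "closure ?S = _")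
proof -
  have "to_completion F \<in> ?S" for F :: "('a, 'b) alg_tensor"
  proof -
    obtain xs where F: "F = elem_sum xs" by (rule elem_sum_cases)
    show ?thesis
      unfolding F
    proof (induction xs)
      case Nil
      then show ?case by (simp add: elem_sum_def to_completion_zero complex_vector.span_zero)
    next
      case (Cons x xs)
      obtain h k where x: "x = (h, k)" by (cases x)
      have "to_completion (elem_sum (x # xs)) = h \<otimes>\<^sub>v k + to_completion (elem_sum xs)"
        by (simp add: x elem_sum_def tensor_vec_def to_completion_add)
      moreover have "h \<otimes>\<^sub>v k \<in> ?S" by (rule complex_vector.span_base) force
      ultimately show ?case using Cons by (simp add: complex_vector.span_add)
    qed
  qed
  then have "closure (range to_completion) \<subseteq> closure ?S"
    by (intro closure_mono) auto
  then show ?thesis by (simp add: completion_dense top.extremum_unique)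
qed

lemma bounded_clinear_eq_on_tensor:
  fixes R R' :: "('a::complex_inner, 'b::complex_inner) hilbert_tensor \<Rightarrow> 'c::complex_inner"
  assumes R: "bounded_clinear R" and R': "bounded_clinear R'"
    and eq: "\<And>h k. R (h \<otimes>\<^sub>v k) = R' (h \<otimes>\<^sub>v k)"
  shows "R = R'"
proof
  fix x
  have bl: "bounded_linear R" "bounded_linear R'"
    using R R' by (auto simp: bounded_clinear_def)
  interpret R: bounded_linear R by (rule bl)
  interpret R': bounded_linear R' by (rule bl)
  have span: "R y = R' y" if "y \<in> complex_vector.span (range (\<lambda>(h, k). h \<otimes>\<^sub>v k))" for y
    using that
  proof (induction rule: complex_vector.span_induct_alt)
    case base
    then show ?case by (simp add: R.zero R'.zero)
  next
    case (step c x y)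
    then show ?case
      using R R' eq by (auto simp: R.add R'.add bounded_clinear_def)
  qed
  have "closed {y. R y = R' y}"
    by (intro closed_Collect_eq linear_continuous_on bl)
  then have "closure (complex_vector.span (range (\<lambda>(h, k). h \<otimes>\<^sub>v k))) \<subseteq> {y. R y = R' y}"
    using span by (intro closure_minimal) auto
  then show "R x = R' x"
    unfolding tensor_vec_total by blast
qed

text \<open>Meaningful for bounded operators: existence and uniqueness are \<open>tensor_op_props\<close> and
  \<open>bounded_clinear_eq_on_tensor\<close>.\<close>

definition tensor_op ::
  "('a::complex_inner \<Rightarrow> 'c::complex_inner) \<Rightarrow> ('b::complex_inner \<Rightarrow> 'd::complex_inner) \<Rightarrow>
    ('a, 'b) hilbert_tensor \<Rightarrow> ('c, 'd) hilbert_tensor"  (infixr "\<otimes>\<^sub>o" 70) where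
  "S \<otimes>\<^sub>o T = (THE R. bounded_clinear R \<and> (\<forall>h k. R (h \<otimes>\<^sub>v k) = S h \<otimes>\<^sub>v T k))"

lemma tensor_op_props:
  fixes S :: "'a::complex_inner \<Rightarrow> 'c::complex_inner" and T :: "'b::complex_inner \<Rightarrow> 'd::complex_inner"
  assumes S: "bounded_clinear S" and T: "bounded_clinear T"
  shows "bounded_clinear (S \<otimes>\<^sub>o T)" "(S \<otimes>\<^sub>o T) (h \<otimes>\<^sub>v k) = S h \<otimes>\<^sub>v T k"
proof -
  let ?P = "\<lambda>R. bounded_clinear R \<and> (\<forall>h k. R (h \<otimes>\<^sub>v k) = S h \<otimes>\<^sub>v T k)"
  obtain A :: "('a, 'b) alg_tensor \<Rightarrow> ('c, 'b) alg_tensor"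
    where A: "bounded_clinear A" "\<And>h k. A (elem_tensor h k) = elem_tensor (S h) k"
    using alg_tensor_op_left[OF S] by blast
  obtain B :: "('b, 'c) alg_tensor \<Rightarrow> ('d, 'c) alg_tensor"
    where B: "bounded_clinear B" "\<And>h k. B (elem_tensor h k) = elem_tensor (T h) k"
    using alg_tensor_op_left[OF T] by blast
  obtain s :: "('c, 'b) alg_tensor \<Rightarrow> ('b, 'c) alg_tensor"
    where s: "bounded_clinear s" "\<And>h k. s (elem_tensor h k) = elem_tensor k h"
    using alg_tensor_swap by blast
  obtain s' :: "('d, 'c) alg_tensor \<Rightarrow> ('c, 'd) alg_tensor"
    where s': "bounded_clinear s'" "\<And>h k. s' (elem_tensor h k) = elem_tensor k h"
    using alg_tensor_swap by blast
  have "bounded_clinear (\<lambda>x. to_completion (s' (B (s (A x)))))"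
    by (intro bounded_clinear_compose[OF bounded_clinear_to_completion]
        bounded_clinear_compose[OF s'(1)] bounded_clinear_compose[OF B(1)]
        bounded_clinear_compose[OF s(1)] A(1))
  then obtain R where R: "bounded_clinear R"
    "\<And>x. R (to_completion x) = to_completion (s' (B (s (A x))))"
    by (rule bounded_clinear_extension) blast
  have R': "?P R"
    using R by (simp add: tensor_vec_def A B s s')
  have "?P (S \<otimes>\<^sub>o T)"
    unfolding tensor_op_def
  proof (rule theI[of ?P, OF R'])
    fix R' assume "?P R'"
    then show "R' = R"
      using R' by (intro bounded_clinear_eq_on_tensor) auto
  qed
  then show "bounded_clinear (S \<otimes>\<^sub>o T)" "(S \<otimes>\<^sub>o T) (h \<otimes>\<^sub>v k) = S h \<otimes>\<^sub>v T k" by auto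
qed

section \<open>The space $L^2$ of a torus\<close>

text \<open>The circle with normalised arc length, and the torus with coordinates indexed by a type:
  \<open>'d\<close> finite with \<open>d\<close> elements gives the \<open>d\<close>-dimensional torus, \<open>'d\<close> countably infinite
  the infinite-dimensional one. A point is written \<open>z\<close> with \<open>z j = cis (\<theta> j)\<close>.\<close>

definition circle_measure :: "complex measure" where
  "circle_measure = distr (uniform_measure lborel {0..<2 * pi}) (restrict_space borel (sphere 0 1)) cis"

definition torus :: "('d \<Rightarrow> complex) measure" where
  "torus = (\<Pi>\<^sub>M j\<in>UNIV. circle_measure)"

lemma prob_space_circle_measure: "prob_space circle_measure"
  unfolding circle_measure_def
proof (rule prob_space.prob_space_distr)
  show "prob_space (uniform_measure lborel {0..<2 * pi})"
    by (rule prob_space_uniform_measure) auto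
  have "cis \<in> borel_measurable borel"
    by (intro borel_measurable_continuous_onI continuous_intros)
  then have "cis \<in> borel_measurable (uniform_measure lborel {0..<2 * pi})"
    by simp
  then show "cis \<in> uniform_measure lborel {0..<2 * pi} \<rightarrow>\<^sub>M restrict_space borel (sphere 0 1)"
    by (intro measurable_restrict_space2) auto
qed

lemma prob_space_torus: "prob_space torus"
  unfolding torus_def by (intro prob_space_PiM prob_space_circle_measure)

definition square_integrable :: "'z measure \<Rightarrow> ('z \<Rightarrow> complex) \<Rightarrow> bool" where
  "square_integrable M f \<longleftrightarrow> f \<in> borel_measurable M \<and> integrable M (\<lambda>z. (cmod (f z))\<^sup>2)"

lemma square_integrable_add:
  assumes "square_integrable M f" "square_integrable M g"
  shows "square_integrable M (\<lambda>z. f z + g z)"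
proof -
  have [measurable]: "f \<in> borel_measurable M" "g \<in> borel_measurable M"
    using assms by (auto simp: square_integrable_def)
  have "integrable M (\<lambda>z. (cmod (f z + g z))\<^sup>2)"
  proof (rule Bochner_Integration.integrable_bound)
    show "integrable M (\<lambda>z. 2 * (cmod (f z))\<^sup>2 + 2 * (cmod (g z))\<^sup>2)"
      using assms by (simp add: square_integrable_def)
    have "(cmod (a + b))\<^sup>2 \<le> 2 * (cmod a)\<^sup>2 + 2 * (cmod b)\<^sup>2" for a b
    proof -
      have "(cmod (a + b))\<^sup>2 \<le> (cmod a + cmod b)\<^sup>2"
        by (intro power_mono norm_triangle_ineq) simp
      also have "\<dots> \<le> 2 * (cmod a)\<^sup>2 + 2 * (cmod b)\<^sup>2"
        using zero_le_power2[of "cmod a - cmod b"] by (simp add: power2_eq_square algebra_simps)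
      finally show ?thesis .
    qed
    then show "AE z in M. norm ((cmod (f z + g z))\<^sup>2) \<le> norm (2 * (cmod (f z))\<^sup>2 + 2 * (cmod (g z))\<^sup>2)"
      by (auto intro!: AE_I2 order.trans[OF _ abs_ge_self])
  qed simp
  then show ?thesis by (simp add: square_integrable_def)
qed

lemma square_integrable_scale:
  assumes "square_integrable M f"
  shows "square_integrable M (\<lambda>z. c * f z)"
  using assms by (simp add: square_integrable_def norm_mult power_mult_distrib borel_measurable_times)

lemma square_integrable_uminus: "square_integrable M f \<Longrightarrow> square_integrable M (\<lambda>z. - f z)"
  by (simp add: square_integrable_def)

lemma square_integrable_diff:
  "square_integrable M f \<Longrightarrow> square_integrable M g \<Longrightarrow> square_integrable M (\<lambda>z. f z - g z)"
  using square_integrable_add[of M f "\<lambda>z. - g z"] square_integrable_uminus[of M g] by simp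

lemma square_integrable_cong_AE:
  assumes "square_integrable M f" "g \<in> borel_measurable M" "AE z in M. f z = g z"
  shows "square_integrable M g"
proof -
  have [measurable]: "f \<in> borel_measurable M" "g \<in> borel_measurable M"
    using assms by (auto simp: square_integrable_def)
  have "integrable M (\<lambda>z. (cmod (f z))\<^sup>2) \<longleftrightarrow> integrable M (\<lambda>z. (cmod (g z))\<^sup>2)"
    using assms(3) by (intro integrable_cong_AE) auto
  then show ?thesis using assms by (simp add: square_integrable_def)
qed

lemma borel_measurable_cnj [measurable]:
  "f \<in> borel_measurable M \<Longrightarrow> (\<lambda>z. cnj (f z)) \<in> borel_measurable M"
  by (rule borel_measurable_continuous_on[of cnj f]) (auto intro!: continuous_intros)

lemma square_integrable_mult:
  assumes "square_integrable M f" "square_integrable M g"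
  shows "integrable M (\<lambda>z. cnj (f z) * g z)"
proof (rule Bochner_Integration.integrable_bound)
  have [measurable]: "f \<in> borel_measurable M" "g \<in> borel_measurable M"
    using assms by (auto simp: square_integrable_def)
  show "integrable M (\<lambda>z. (cmod (f z))\<^sup>2 + (cmod (g z))\<^sup>2)"
    using assms by (simp add: square_integrable_def)
  show "(\<lambda>z. cnj (f z) * g z) \<in> borel_measurable M" by measurable
  have "cmod a * cmod b \<le> (cmod a)\<^sup>2 + (cmod b)\<^sup>2" for a b
  proof -
    have "2 * (cmod a * cmod b) \<le> (cmod a)\<^sup>2 + (cmod b)\<^sup>2"
      using zero_le_power2[of "cmod a - cmod b"] by (simp add: power2_diff)
    moreover have "0 \<le> cmod a * cmod b" by simp
    ultimately show ?thesis by linarith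
  qed
  then show "AE z in M. norm (cnj (f z) * g z) \<le> norm ((cmod (f z))\<^sup>2 + (cmod (g z))\<^sup>2)"
    by (auto intro!: AE_I2 order.trans[OF _ abs_ge_self] simp: norm_mult)
qed

definition L2_rel :: "(('d \<Rightarrow> complex) \<Rightarrow> complex) \<Rightarrow> (('d \<Rightarrow> complex) \<Rightarrow> complex) \<Rightarrow> bool" where
  "L2_rel f g \<longleftrightarrow> square_integrable torus f \<and> square_integrable torus g \<and> (AE z in torus. f z = g z)"

quotient_type 'd torus_L2 = "('d \<Rightarrow> complex) \<Rightarrow> complex" / partial: L2_rel
proof (rule part_equivpI)
  have "L2_rel (\<lambda>_. 0) (\<lambda>_. 0)"
    by (simp add: L2_rel_def square_integrable_def)
  then show "\<exists>f :: ('d \<Rightarrow> complex) \<Rightarrow> complex. L2_rel f f" by blast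
  show "symp (L2_rel :: (('d \<Rightarrow> complex) \<Rightarrow> complex) \<Rightarrow> _)"
    by (rule sympI) (auto simp: L2_rel_def elim: AE_mp)
  show "transp (L2_rel :: (('d \<Rightarrow> complex) \<Rightarrow> complex) \<Rightarrow> _)"
    by (rule transpI) (auto simp: L2_rel_def elim: AE_mp)
qed

instantiation torus_L2 :: (type) complex_inner
begin

lift_definition zero_torus_L2 :: "'a torus_L2" is "\<lambda>_. 0"
  by (simp add: L2_rel_def square_integrable_def)
lift_definition plus_torus_L2 :: "'a torus_L2 \<Rightarrow> 'a torus_L2 \<Rightarrow> 'a torus_L2"
  is "\<lambda>f g z. f z + g z"
  unfolding L2_rel_def by (auto intro: square_integrable_add)
lift_definition minus_torus_L2 :: "'a torus_L2 \<Rightarrow> 'a torus_L2 \<Rightarrow> 'a torus_L2"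
  is "\<lambda>f g z. f z - g z"
  unfolding L2_rel_def by (auto intro: square_integrable_diff)
lift_definition uminus_torus_L2 :: "'a torus_L2 \<Rightarrow> 'a torus_L2" is "\<lambda>f z. - f z"
  unfolding L2_rel_def by (auto intro: square_integrable_uminus)
lift_definition scaleC_torus_L2 :: "complex \<Rightarrow> 'a torus_L2 \<Rightarrow> 'a torus_L2" is "\<lambda>c f z. c * f z"
  unfolding L2_rel_def by (auto intro: square_integrable_scale)
definition scaleR_torus_L2 :: "real \<Rightarrow> 'a torus_L2 \<Rightarrow> 'a torus_L2" where
  "scaleR_torus_L2 r x = complex_of_real r *\<^sub>C x"
lift_definition cinner_torus_L2 :: "'a torus_L2 \<Rightarrow> 'a torus_L2 \<Rightarrow> complex"
  is "\<lambda>f g. LINT z|torus. cnj (f z) * g z"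
  unfolding L2_rel_def square_integrable_def
  by (rule integral_cong_AE) (auto intro!: borel_measurable_times borel_measurable_cnj)
definition inner_torus_L2 :: "'a torus_L2 \<Rightarrow> 'a torus_L2 \<Rightarrow> real" where
  "inner_torus_L2 x y = Re (cinner x y)"
definition norm_torus_L2 :: "'a torus_L2 \<Rightarrow> real" where
  "norm_torus_L2 x = sqrt (inner x x)"
definition dist_torus_L2 :: "'a torus_L2 \<Rightarrow> 'a torus_L2 \<Rightarrow> real" where
  "dist_torus_L2 x y = norm (x - y)"
definition sgn_torus_L2 :: "'a torus_L2 \<Rightarrow> 'a torus_L2" where
  "sgn_torus_L2 x = inverse (norm x) *\<^sub>R x"
definition uniformity_torus_L2 :: "('a torus_L2 \<times> 'a torus_L2) filter" where
  "uniformity_torus_L2 = (INF e\<in>{0<..}. principal {(x, y). dist x y < e})"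
definition open_torus_L2 :: "'a torus_L2 set \<Rightarrow> bool" where
  "open_torus_L2 U \<longleftrightarrow> (\<forall>x\<in>U. \<forall>\<^sub>F (x', y) in uniformity. x' = x \<longrightarrow> y \<in> U)"

instance
proof
  fix x y z :: "'a torus_L2" and a b :: complex and r s :: real
  note defs = L2_rel_def square_integrable_add square_integrable_diff square_integrable_uminus
    square_integrable_scale
  show "x + y + z = x + (y + z)" by transfer (auto simp: defs algebra_simps)
  show "x + y = y + x" by transfer (auto simp: defs algebra_simps)
  show "0 + x = x" by transfer (auto simp: defs)
  show "- x + x = 0" by transfer (auto simp: defs square_integrable_def)
  show "x - y = x + - y" by transfer (auto simp: defs)
  show "r *\<^sub>R (x + y) = r *\<^sub>R x + r *\<^sub>R y"
    unfolding scaleR_torus_L2_def by transfer (auto simp: defs distrib_left)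
  show "(r + s) *\<^sub>R x = r *\<^sub>R x + s *\<^sub>R x"
    unfolding scaleR_torus_L2_def by transfer (auto simp: defs distrib_right)
  show "r *\<^sub>R s *\<^sub>R x = (r * s) *\<^sub>R x"
    unfolding scaleR_torus_L2_def by transfer (auto simp: defs mult.assoc)
  show "1 *\<^sub>R x = x" unfolding scaleR_torus_L2_def by transfer (auto simp: defs)
  show "a *\<^sub>C (x + y) = a *\<^sub>C x + a *\<^sub>C y" by transfer (auto simp: defs distrib_left)
  show "(a + b) *\<^sub>C x = a *\<^sub>C x + b *\<^sub>C x" by transfer (auto simp: defs distrib_right)
  show "a *\<^sub>C b *\<^sub>C x = (a * b) *\<^sub>C x" by transfer (auto simp: defs mult.assoc)
  show "1 *\<^sub>C x = x" by transfer (auto simp: defs)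
  show "r *\<^sub>R x = complex_of_real r *\<^sub>C x" by (fact scaleR_torus_L2_def)
  show "dist x y = norm (x - y)" by (fact dist_torus_L2_def)
  show "sgn x = inverse (norm x) *\<^sub>R x" by (fact sgn_torus_L2_def)
  show "(uniformity :: ('a torus_L2 \<times> 'a torus_L2) filter)
      = (INF e\<in>{0<..}. principal {(x, y). dist x y < e})"
    by (fact uniformity_torus_L2_def)
  show "open U \<longleftrightarrow> (\<forall>x\<in>U. \<forall>\<^sub>F (x', y) in uniformity. x' = x \<longrightarrow> y \<in> U)"
    for U :: "'a torus_L2 set"
    by (fact open_torus_L2_def)
  have commute: "cinner x y = cnj (cinner y x)" for x y :: "'a torus_L2"
  proof transfer
    fix f g :: "('a \<Rightarrow> complex) \<Rightarrow> complex"
    have "cnj (LINT z|torus. cnj (g z) * f z) = (LINT z|torus. cnj (cnj (g z) * f z))"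
      by (rule Bochner_Integration.integral_cnj[symmetric])
    then show "(LINT z|torus. cnj (f z) * g z) = cnj (LINT z|torus. cnj (g z) * f z)"
      by (simp only: complex_cnj_mult complex_cnj_cnj mult.commute)
  qed
  have add: "cinner x (y + z) = cinner x y + cinner x z" for x y z :: "'a torus_L2"
    by transfer (simp add: L2_rel_def square_integrable_mult distrib_left)
  have scale: "cinner x (a *\<^sub>C y) = a * cinner x y" for x y :: "'a torus_L2" and a
    by transfer (simp add: mult.left_commute)
  show "cinner x y = cnj (cinner y x)" by (fact commute)
  show "cinner x (y + z) = cinner x y + cinner x z" by (fact add)
  show "cinner x (a *\<^sub>C y) = a * cinner x y" by (fact scale)
  show "inner x y = Re (cinner x y)" by (fact inner_torus_L2_def)
  show "inner x y = inner y x"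
    unfolding inner_torus_L2_def by (subst commute) simp
  have add': "cinner (x + y) z = cinner x z + cinner y z" for x y z :: "'a torus_L2"
    by (subst (1 2 3) commute) (simp add: add)
  show "inner (x + y) z = inner x z + inner y z"
    unfolding inner_torus_L2_def by (simp add: add')
  have "cinner (r *\<^sub>R x) y = complex_of_real r * cinner x y"
    unfolding scaleR_torus_L2_def by (subst (1 2) commute) (simp add: scale)
  then show "inner (r *\<^sub>R x) y = r * inner x y"
    unfolding inner_torus_L2_def by simp
  have self: "Re (LINT z|torus. cnj (f z) * f z) = (LINT z|torus. (cmod (f z))\<^sup>2)" for f :: "('a \<Rightarrow> complex) \<Rightarrow> complex"
  proof -
    have "cnj (f z) * f z = complex_of_real ((cmod (f z))\<^sup>2)" for z
      by (simp only: complex_norm_square mult.commute)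
    then show ?thesis by (simp only: integral_complex_of_real Re_complex_of_real)
  qed
  show "0 \<le> inner x x"
    unfolding inner_torus_L2_def by transfer (simp add: self)
  show "inner x x = 0 \<longleftrightarrow> x = 0"
    unfolding inner_torus_L2_def
  proof transfer
    fix f :: "('a \<Rightarrow> complex) \<Rightarrow> complex" assume "L2_rel f f"
    then have f: "square_integrable torus f" by (simp add: L2_rel_def)
    have "(LINT z|torus. (cmod (f z))\<^sup>2) = 0 \<longleftrightarrow> (AE z in torus. (cmod (f z))\<^sup>2 = 0)"
      using f by (intro integral_nonneg_eq_0_iff_AE) (auto simp: square_integrable_def)
    also have "\<dots> \<longleftrightarrow> L2_rel f (\<lambda>_. 0)"
      using f by (simp add: L2_rel_def square_integrable_def)
    finally show "Re (LINT z|torus. cnj (f z) * f z) = 0 \<longleftrightarrow> L2_rel f (\<lambda>_. 0)"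
      by (simp only: self)
  qed
  show "norm x = sqrt (inner x x)" by (fact norm_torus_L2_def)
qed

end

lemma square_integrable_rep: "square_integrable torus (rep_torus_L2 x)"
  using Quotient3_rep_reflp[OF Quotient3_torus_L2, of x] by (simp add: L2_rel_def)

lemma abs_rep_torus_L2 [simp]: "abs_torus_L2 (rep_torus_L2 x) = x"
  by (rule Quotient3_abs_rep[OF Quotient3_torus_L2])

lemma cinner_abs_L2:
  assumes "square_integrable torus f" "square_integrable torus g"
  shows "cinner (abs_torus_L2 f) (abs_torus_L2 g) = (LINT z|torus. cnj (f z) * g z)"
  using assms by (subst cinner_torus_L2.abs_eq) (auto simp: L2_rel_def eq_onp_def)

lemma diff_abs_L2:
  assumes "square_integrable torus f" "square_integrable torus g"
  shows "abs_torus_L2 f - abs_torus_L2 g = abs_torus_L2 (\<lambda>z. f z - g z)"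
  using assms by (subst minus_torus_L2.abs_eq) (auto simp: L2_rel_def eq_onp_def)

lemma norm_abs_L2:
  assumes "square_integrable torus f"
  shows "(norm (abs_torus_L2 f))\<^sup>2 = (LINT z|torus. (cmod (f z))\<^sup>2)"
proof -
  have "cnj (f z) * f z = complex_of_real ((cmod (f z))\<^sup>2)" for z
    by (simp only: complex_norm_square mult.commute)
  then have "cinner (abs_torus_L2 f) (abs_torus_L2 f) = complex_of_real (LINT z|torus. (cmod (f z))\<^sup>2)"
    unfolding cinner_abs_L2[OF assms assms] by (simp only: integral_complex_of_real)
  then show ?thesis
    unfolding cinner_self of_real_eq_iff .
qed

lemma nn_integral_L2_diff:
  assumes "square_integrable torus f" "square_integrable torus g"
  shows "(\<integral>\<^sup>+ z. ennreal ((cmod (f z - g z))\<^sup>2) \<partial>torus) = ennreal ((dist (abs_torus_L2 f) (abs_torus_L2 g))\<^sup>2)"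
proof -
  have d: "square_integrable torus (\<lambda>z. f z - g z)"
    using assms by (rule square_integrable_diff)
  have "(\<integral>\<^sup>+ z. ennreal ((cmod (f z - g z))\<^sup>2) \<partial>torus) = ennreal (LINT z|torus. (cmod (f z - g z))\<^sup>2)"
    using d by (intro nn_integral_eq_integral) (auto simp: square_integrable_def)
  then show ?thesis
    using assms d by (simp add: dist_norm diff_abs_L2 norm_abs_L2)
qed

text \<open>Riesz-Fischer: a sequence converging fast enough in norm converges almost everywhere.\<close>

lemma L2_fast_convergent:
  fixes G :: "nat \<Rightarrow> 'd torus_L2"
  assumes G: "\<And>k m. k \<le> m \<Longrightarrow> dist (G m) (G k) < (1 / 2) ^ k"
  shows "convergent G"
proof -
  interpret prob_space "torus :: ('d \<Rightarrow> complex) measure" by (rule prob_space_torus)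
  define g where "g k = rep_torus_L2 (G k)" for k
  have sq: "square_integrable torus (g k)" and absg: "abs_torus_L2 (g k) = G k" for k
    by (simp_all add: g_def square_integrable_rep)
  have [measurable]: "g k \<in> borel_measurable torus" for k
    using sq by (simp add: square_integrable_def)
  have nn: "(\<integral>\<^sup>+ z. ennreal ((cmod (g m z - g k z))\<^sup>2) \<partial>torus) \<le> ennreal (((1 / 2) ^ k)\<^sup>2)"
    if "k \<le> m" for k m
    unfolding nn_integral_L2_diff[OF sq sq] absg
    using G[OF that] by (intro ennreal_leI power_mono) auto
  have step: "(\<integral>\<^sup>+ z. ennreal (cmod (g (Suc k) z - g k z)) \<partial>torus) \<le> ennreal (2 * (1 / 2) ^ k)" for k
  proof -
    let ?q = "(1 / 2 :: real) ^ k"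
    have am: "a \<le> 1 / ?q * a\<^sup>2 + ?q" for a :: real
    proof -
      have "0 \<le> (a - ?q)\<^sup>2 + a\<^sup>2 + ?q\<^sup>2" by simp
      then have "a * ?q \<le> a\<^sup>2 + ?q\<^sup>2" by (simp add: power2_eq_square algebra_simps)
      then have "a * ?q / ?q \<le> (a\<^sup>2 + ?q\<^sup>2) / ?q" by (rule divide_right_mono) simp
      then show ?thesis by (simp add: add_divide_distrib power2_eq_square)
    qed
    have "(\<integral>\<^sup>+ z. ennreal (cmod (g (Suc k) z - g k z)) \<partial>torus)
        \<le> (\<integral>\<^sup>+ z. ennreal (1 / ?q) * ennreal ((cmod (g (Suc k) z - g k z))\<^sup>2) + ennreal ?q \<partial>torus)"
      using am by (intro nn_integral_mono) (simp add: ennreal_mult[symmetric] ennreal_plus[symmetric] del: ennreal_plus)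
    also have "\<dots> = ennreal (1 / ?q) * (\<integral>\<^sup>+ z. ennreal ((cmod (g (Suc k) z - g k z))\<^sup>2) \<partial>torus) + ennreal ?q"
      by (simp add: nn_integral_add nn_integral_cmult emeasure_space_1)
    also have "\<dots> \<le> ennreal (1 / ?q) * ennreal (?q\<^sup>2) + ennreal ?q"
      by (intro add_right_mono mult_left_mono nn) auto
    also have "\<dots> = ennreal (2 * ?q)"
      by (simp add: ennreal_mult[symmetric] ennreal_plus[symmetric] power2_eq_square del: ennreal_plus)
    finally show ?thesis .
  qed
  have "(\<integral>\<^sup>+ z. (\<Sum>k. ennreal (cmod (g (Suc k) z - g k z))) \<partial>torus)
      = (\<Sum>k. \<integral>\<^sup>+ z. ennreal (cmod (g (Suc k) z - g k z)) \<partial>torus)"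
    by (rule nn_integral_suminf) simp
  also have "\<dots> \<le> (\<Sum>k. ennreal (2 * (1 / 2) ^ k))"
    by (intro suminf_le step) auto
  also have "\<dots> < \<infinity>"
    by (subst suminf_ennreal2) (auto intro!: summable_mult summable_geometric)
  finally have "AE z in torus. (\<Sum>k. ennreal (cmod (g (Suc k) z - g k z))) \<noteq> \<infinity>"
    by (intro nn_integral_noteq_infinite) auto
  then have conv: "AE z in torus. convergent (\<lambda>k. g k z)"
  proof (rule AE_mp, intro AE_I2 impI)
    fix z assume "(\<Sum>k. ennreal (cmod (g (Suc k) z - g k z))) \<noteq> \<infinity>"
    then have "summable (\<lambda>k. cmod (g (Suc k) z - g k z))"
      by (intro summable_suminf_not_top) auto
    then have "summable (\<lambda>k. g (Suc k) z - g k z)"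
      by (rule summable_norm_cancel)
    then have "convergent (\<lambda>n. g n z - g 0 z)"
      by (simp only: summable_iff_convergent sum_lessThan_telescope[of "\<lambda>k. g k z"])
    then show "convergent (\<lambda>k. g k z)"
      by (simp add: convergent_diff_const_right_iff)
  qed
  define f where "f z = lim (\<lambda>k. g k z)" for z
  have [measurable]: "f \<in> borel_measurable torus"
    unfolding f_def by measurable
  have lim: "AE z in torus. (\<lambda>k. g k z) \<longlonglongrightarrow> f z"
    using conv by (simp add: f_def convergent_LIMSEQ_iff)
  have fatou: "(\<integral>\<^sup>+ z. ennreal ((cmod (f z - g k z))\<^sup>2) \<partial>torus) \<le> ennreal (((1 / 2) ^ k)\<^sup>2)" for k
  proof -
    have "(\<integral>\<^sup>+ z. ennreal ((cmod (f z - g k z))\<^sup>2) \<partial>torus)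
        = (\<integral>\<^sup>+ z. liminf (\<lambda>m. ennreal ((cmod (g m z - g k z))\<^sup>2)) \<partial>torus)"
    proof (rule nn_integral_cong_AE, rule AE_mp[OF lim], intro AE_I2 impI)
      fix z assume "(\<lambda>k. g k z) \<longlonglongrightarrow> f z"
      then have "(\<lambda>m. ennreal ((cmod (g m z - g k z))\<^sup>2)) \<longlonglongrightarrow> ennreal ((cmod (f z - g k z))\<^sup>2)"
        by (intro tendsto_intros tendsto_ennrealI)
      then show "ennreal ((cmod (f z - g k z))\<^sup>2) = liminf (\<lambda>m. ennreal ((cmod (g m z - g k z))\<^sup>2))"
        by (intro lim_imp_Liminf[symmetric]) auto
    qed
    also have "\<dots> \<le> liminf (\<lambda>m. \<integral>\<^sup>+ z. ennreal ((cmod (g m z - g k z))\<^sup>2) \<partial>torus)"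
      by (rule nn_integral_liminf) simp
    also have "\<dots> \<le> liminf (\<lambda>m. ennreal (((1 / 2) ^ k)\<^sup>2))"
      by (rule Liminf_mono, rule eventually_sequentiallyI[of k]) (rule nn)
    also have "\<dots> = ennreal (((1 / 2) ^ k)\<^sup>2)"
      by (simp add: Liminf_const)
    finally show ?thesis .
  qed
  have "square_integrable torus (\<lambda>z. f z - g 0 z)"
    unfolding square_integrable_def
    using fatou[of 0] by (auto simp: integrable_iff_bounded intro: le_less_trans)
  from square_integrable_add[OF this sq[of 0]] have sqf: "square_integrable torus f" by simp
  have "dist (abs_torus_L2 f) (G k) \<le> (1 / 2) ^ k" for k
  proof -
    have "(dist (abs_torus_L2 f) (G k))\<^sup>2 \<le> ((1 / 2) ^ k)\<^sup>2"
      using fatou[of k] unfolding nn_integral_L2_diff[OF sqf sq] absg by simp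
    then show ?thesis by (simp add: power2_le_iff_abs_le)
  qed
  then have "(\<lambda>k. dist (G k) (abs_torus_L2 f)) \<longlonglongrightarrow> 0"
    by (intro Lim_null_comparison[OF _ LIMSEQ_power_zero[of "1 / 2 :: real"]])
      (auto simp: dist_commute)
  then have "G \<longlonglongrightarrow> abs_torus_L2 f"
    using tendsto_dist_iff by blast
  then show ?thesis by (auto simp: convergent_def)
qed

instance torus_L2 :: (type) chilbert_space
proof
  fix F :: "nat \<Rightarrow> 'a torus_L2"
  assume F: "Cauchy F"
  have "\<exists>N. \<forall>m\<ge>N. \<forall>n\<ge>N. dist (F m) (F n) < (1 / 2) ^ k" for k
    by (rule metric_CauchyD[OF F]) simp
  then obtain N where N: "\<And>k m n. m \<ge> N k \<Longrightarrow> n \<ge> N k \<Longrightarrow> dist (F m) (F n) < (1 / 2) ^ k"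
    by metis
  define r where "r k = (\<Sum>j\<le>k. N j)" for k
  have r: "N k \<le> r m" if "k \<le> m" for k m
    unfolding r_def using that by (intro member_le_sum) auto
  have "convergent (\<lambda>k. F (r k))"
    by (rule L2_fast_convergent) (auto intro!: N r)
  then obtain x where x: "(\<lambda>k. F (r k)) \<longlonglongrightarrow> x" by (auto simp: convergent_def)
  have "F \<longlonglongrightarrow> x"
  proof (rule metric_LIMSEQ_I)
    fix e :: real assume e: "0 < e"
    obtain K where K: "(1 / 2) ^ K < e / 2"
      using real_arch_pow_inv[of "e / 2" "1 / 2"] e by auto
    obtain K' where K': "\<And>k. k \<ge> K' \<Longrightarrow> dist (F (r k)) x < e / 2"
      using metric_LIMSEQ_D[OF x, of "e / 2"] e by auto
    show "\<exists>no. \<forall>n\<ge>no. dist (F n) x < e"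
    proof (intro exI[of _ "N K"] allI impI)
      fix n assume n: "N K \<le> n"
      let ?k = "max K K'"
      have "dist (F n) (F (r ?k)) < (1 / 2) ^ K" by (intro N n r) simp
      moreover have "dist (F (r ?k)) x < e / 2" by (rule K') simp
      ultimately show "dist (F n) x < e"
        using K dist_triangle[of "F n" x "F (r ?k)"] by linarith
    qed
  qed
  then show "convergent F" by (auto simp: convergent_def)
qed

section \<open>The Hardy space and its orthogonal complement\<close>

definition char_index :: "('d \<Rightarrow> int) set" where
  "char_index = {n. finite {j. n j \<noteq> 0}}"

definition hardy_index :: "('d \<Rightarrow> int) set" where
  "hardy_index = {n \<in> char_index. \<forall>j. 0 \<le> n j}"

definition character :: "('d \<Rightarrow> int) \<Rightarrow> ('d \<Rightarrow> complex) \<Rightarrow> complex" where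
  "character n z = (\<Prod>j | n j \<noteq> 0. z j powi n j)"

lemma character_cis:
  assumes "n \<in> char_index"
  shows "character n (\<lambda>j. cis (\<theta> j)) = cis (\<Sum>j | n j \<noteq> 0. of_int (n j) * \<theta> j)"
proof -
  have "finite {j. n j \<noteq> 0}" using assms by (simp add: char_index_def)
  then have "(\<Prod>j | n j \<noteq> 0. cis (of_int (n j) * \<theta> j)) = cis (\<Sum>j | n j \<noteq> 0. of_int (n j) * \<theta> j)"
    by (induction rule: finite_induct) (auto simp: cis_mult)
  then show ?thesis
    by (simp add: character_def cis_power_int)
qed

lemma space_torus: "space torus = {z :: 'd \<Rightarrow> complex. \<forall>j. cmod (z j) = 1}"
  by (auto simp: torus_def space_PiM circle_measure_def space_restrict_space PiE_def Pi_def
      extensional_def)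

lemma square_integrable_character: "square_integrable torus (character n)"
proof -
  interpret prob_space "torus :: ('a \<Rightarrow> complex) measure" by (rule prob_space_torus)
  have norm1: "cmod (character n z) = 1" if "z \<in> space torus" for z
    using that by (simp add: character_def space_torus prod_norm[symmetric] norm_power_int)
  have coord: "(\<lambda>z. z j) \<in> borel_measurable torus" for j
  proof -
    have "(\<lambda>z. z j) \<in> torus \<rightarrow>\<^sub>M circle_measure"
      unfolding torus_def by (rule measurable_component_singleton) simp
    then have "(\<lambda>z. z j) \<in> torus \<rightarrow>\<^sub>M restrict_space borel (sphere 0 1)"
      by (simp add: circle_measure_def)
    then show ?thesis by (rule measurable_restrict_space2_iff[THEN iffD1, THEN conjunct1])
  qed
  have pow: "(\<lambda>z. z j powi k) \<in> borel_measurable torus" for j k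
    unfolding power_int_def
    by (cases "0 \<le> k") (auto intro!: borel_measurable_power borel_measurable_inverse coord)
  have meas: "character n \<in> borel_measurable torus"
    unfolding character_def[abs_def] by (intro borel_measurable_prod pow)
  have "integrable torus (\<lambda>z. (cmod (character n z))\<^sup>2) \<longleftrightarrow> integrable torus (\<lambda>z :: 'a \<Rightarrow> complex. 1 :: real)"
    by (rule Bochner_Integration.integrable_cong) (simp_all add: norm1)
  then show ?thesis
    using meas by (simp add: square_integrable_def)
qed

definition hardy_space :: "'d torus_L2 set" where
  "hardy_space = closure (complex_vector.span ((\<lambda>n. abs_torus_L2 (character n)) ` hardy_index))"

definition hardy_complement :: "'d torus_L2 set" where
  "hardy_complement = {x. \<forall>h\<in>hardy_space. cinner h x = 0}"

lemma subspace_closure: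
  fixes S :: "'a::complex_inner set"
  assumes "complex_vector.subspace S"
  shows "complex_vector.subspace (closure S)"
  unfolding complex_vector.subspace_def
proof (intro conjI ballI allI)
  show "0 \<in> closure S"
    using closure_subset complex_vector.subspace_0[OF assms] by blast
next
  fix x y assume "x \<in> closure S" "y \<in> closure S"
  then obtain X Y where "\<forall>n. X n \<in> S" "X \<longlonglongrightarrow> x" "\<forall>n. Y n \<in> S" "Y \<longlonglongrightarrow> y"
    unfolding closure_sequential by blast
  then show "x + y \<in> closure S"
    unfolding closure_sequential
    by (intro exI[of _ "\<lambda>n. X n + Y n"]) (auto intro: tendsto_add complex_vector.subspace_add[OF assms])
next
  fix c x assume "x \<in> closure S"
  then obtain X where "\<forall>n. X n \<in> S" "X \<longlonglongrightarrow> x"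
    unfolding closure_sequential by blast
  then show "c *\<^sub>C x \<in> closure S"
    unfolding closure_sequential
    by (intro exI[of _ "\<lambda>n. c *\<^sub>C X n"]) (auto intro: tendsto_scaleC complex_vector.subspace_scale[OF assms])
qed

lemma subspace_hardy_space: "complex_vector.subspace hardy_space"
  unfolding hardy_space_def by (intro subspace_closure complex_vector.subspace_span)

lemma closed_hardy_space: "closed hardy_space"
  by (simp add: hardy_space_def)

lemma subspace_hardy_complement: "complex_vector.subspace hardy_complement"
  by (auto simp: complex_vector.subspace_def hardy_complement_def cinner_add_right cinner_scaleC_right)

lemma closed_hardy_complement: "closed (hardy_complement :: 'd torus_L2 set)"
proof -
  have cl: "closed {x :: 'd torus_L2. cinner h x = 0}" for h
    by (intro closed_Collect_eq continuous_intros linear_continuous_on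
        bounded_bilinear.bounded_linear_right[OF bounded_bilinear_cinner])
  have "closed (\<Inter>h\<in>hardy_space. {x :: 'd torus_L2. cinner h x = 0})"
    by (intro closed_INT ballI cl)
  also have "(\<Inter>h\<in>hardy_space. {x :: 'd torus_L2. cinner h x = 0}) = hardy_complement"
    by (auto simp: hardy_complement_def)
  finally show ?thesis .
qed

typedef 'd hardy = "hardy_space :: 'd torus_L2 set"
  using complex_vector.subspace_0[OF subspace_hardy_space] by blast

typedef 'd hardy_perp = "hardy_complement :: 'd torus_L2 set"
  using complex_vector.subspace_0[OF subspace_hardy_complement] by blast

setup_lifting type_definition_hardy

instantiation hardy :: (type) complex_inner
begin

lift_definition zero_hardy :: "'a hardy" is 0
  by (rule complex_vector.subspace_0[OF subspace_hardy_space])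
lift_definition plus_hardy :: "'a hardy \<Rightarrow> 'a hardy \<Rightarrow> 'a hardy" is "(+)"
  by (rule complex_vector.subspace_add[OF subspace_hardy_space])
lift_definition minus_hardy :: "'a hardy \<Rightarrow> 'a hardy \<Rightarrow> 'a hardy" is "(-)"
  by (rule complex_vector.subspace_diff[OF subspace_hardy_space])
lift_definition uminus_hardy :: "'a hardy \<Rightarrow> 'a hardy" is uminus
  by (rule complex_vector.subspace_neg[OF subspace_hardy_space])
lift_definition scaleC_hardy :: "complex \<Rightarrow> 'a hardy \<Rightarrow> 'a hardy" is scaleC
  by (rule complex_vector.subspace_scale[OF subspace_hardy_space])
lift_definition scaleR_hardy :: "real \<Rightarrow> 'a hardy \<Rightarrow> 'a hardy" is scaleR
  unfolding scaleR_scaleC by (rule complex_vector.subspace_scale[OF subspace_hardy_space])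
lift_definition cinner_hardy :: "'a hardy \<Rightarrow> 'a hardy \<Rightarrow> complex" is cinner .
lift_definition inner_hardy :: "'a hardy \<Rightarrow> 'a hardy \<Rightarrow> real" is inner .
lift_definition norm_hardy :: "'a hardy \<Rightarrow> real" is norm .

definition dist_hardy :: "'a hardy \<Rightarrow> 'a hardy \<Rightarrow> real" where
  "dist_hardy x y = norm (x - y)"
definition sgn_hardy :: "'a hardy \<Rightarrow> 'a hardy" where
  "sgn_hardy x = inverse (norm x) *\<^sub>R x"
definition uniformity_hardy :: "('a hardy \<times> 'a hardy) filter" where
  "uniformity_hardy = (INF e\<in>{0<..}. principal {(x, y). dist x y < e})"
definition open_hardy :: "'a hardy set \<Rightarrow> bool" where
  "open_hardy U \<longleftrightarrow> (\<forall>x\<in>U. \<forall>\<^sub>F (x', y) in uniformity. x' = x \<longrightarrow> y \<in> U)"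

instance
proof
  fix x y z :: "'a hardy" and a b :: complex and r s :: real
  show "x + y + z = x + (y + z)" by transfer (simp add: algebra_simps)
  show "x + y = y + x" by transfer (simp add: algebra_simps)
  show "0 + x = x" by transfer simp
  show "- x + x = 0" by transfer simp
  show "x - y = x + - y" by transfer simp
  show "r *\<^sub>R (x + y) = r *\<^sub>R x + r *\<^sub>R y" by transfer (simp add: algebra_simps)
  show "(r + s) *\<^sub>R x = r *\<^sub>R x + s *\<^sub>R x" by transfer (simp add: algebra_simps)
  show "r *\<^sub>R s *\<^sub>R x = (r * s) *\<^sub>R x" by transfer simp
  show "1 *\<^sub>R x = x" by transfer simp
  show "a *\<^sub>C (x + y) = a *\<^sub>C x + a *\<^sub>C y" by transfer (simp add: scaleC_add_right)
  show "(a + b) *\<^sub>C x = a *\<^sub>C x + b *\<^sub>C x" by transfer (simp add: scaleC_add_left)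
  show "a *\<^sub>C b *\<^sub>C x = (a * b) *\<^sub>C x" by transfer (simp add: scaleC_scaleC)
  show "1 *\<^sub>C x = x" by transfer (simp add: scaleC_one)
  show "r *\<^sub>R x = complex_of_real r *\<^sub>C x" by transfer (simp add: scaleR_scaleC)
  show "dist x y = norm (x - y)" by (fact dist_hardy_def)
  show "sgn x = inverse (norm x) *\<^sub>R x" by (fact sgn_hardy_def)
  show "(uniformity :: ('a hardy \<times> 'a hardy) filter)
      = (INF e\<in>{0<..}. principal {(x, y). dist x y < e})"
    by (fact uniformity_hardy_def)
  show "open U \<longleftrightarrow> (\<forall>x\<in>U. \<forall>\<^sub>F (x', y) in uniformity. x' = x \<longrightarrow> y \<in> U)"
    for U :: "'a hardy set"
    by (fact open_hardy_def)
  show "inner x y = inner y x" by transfer (rule inner_commute)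
  show "inner (x + y) z = inner x z + inner y z" by transfer (rule inner_add_left)
  show "inner (r *\<^sub>R x) y = r * inner x y" by transfer simp
  show "0 \<le> inner x x" by transfer simp
  show "inner x x = 0 \<longleftrightarrow> x = 0" by transfer simp
  show "norm x = sqrt (inner x x)" by transfer (rule norm_eq_sqrt_inner)
  show "cinner x y = cnj (cinner y x)" by transfer (rule cinner_commute)
  show "cinner x (y + z) = cinner x y + cinner x z" by transfer (rule cinner_add_right)
  show "cinner x (a *\<^sub>C y) = a * cinner x y" by transfer (rule cinner_scaleC_right)
  show "inner x y = Re (cinner x y)" by transfer (rule inner_cinner)
qed

end

instance hardy :: (type) chilbert_space
proof
  fix X :: "nat \<Rightarrow> 'a hardy"
  assume "Cauchy X"
  have "range (Rep_hardy :: 'a hardy \<Rightarrow> _) = hardy_space"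
    by (rule type_definition.Rep_range[OF type_definition_hardy])
  then have "closed (range (Rep_hardy :: 'a hardy \<Rightarrow> _))"
    by (simp add: closed_hardy_space)
  moreover have "dist (Rep_hardy x) (Rep_hardy y) = dist x y" for x y :: "'a hardy"
    unfolding dist_norm by transfer simp
  ultimately show "convergent X"
    using convergent_via_isometry \<open>Cauchy X\<close> by blast
qed

setup_lifting type_definition_hardy_perp

instantiation hardy_perp :: (type) complex_inner
begin

lift_definition zero_hardy_perp :: "'a hardy_perp" is 0
  by (rule complex_vector.subspace_0[OF subspace_hardy_complement])
lift_definition plus_hardy_perp :: "'a hardy_perp \<Rightarrow> 'a hardy_perp \<Rightarrow> 'a hardy_perp" is "(+)"
  by (rule complex_vector.subspace_add[OF subspace_hardy_complement])
lift_definition minus_hardy_perp :: "'a hardy_perp \<Rightarrow> 'a hardy_perp \<Rightarrow> 'a hardy_perp" is "(-)"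
  by (rule complex_vector.subspace_diff[OF subspace_hardy_complement])
lift_definition uminus_hardy_perp :: "'a hardy_perp \<Rightarrow> 'a hardy_perp" is uminus
  by (rule complex_vector.subspace_neg[OF subspace_hardy_complement])
lift_definition scaleC_hardy_perp :: "complex \<Rightarrow> 'a hardy_perp \<Rightarrow> 'a hardy_perp" is scaleC
  by (rule complex_vector.subspace_scale[OF subspace_hardy_complement])
lift_definition scaleR_hardy_perp :: "real \<Rightarrow> 'a hardy_perp \<Rightarrow> 'a hardy_perp" is scaleR
  unfolding scaleR_scaleC by (rule complex_vector.subspace_scale[OF subspace_hardy_complement])
lift_definition cinner_hardy_perp :: "'a hardy_perp \<Rightarrow> 'a hardy_perp \<Rightarrow> complex" is cinner .
lift_definition inner_hardy_perp :: "'a hardy_perp \<Rightarrow> 'a hardy_perp \<Rightarrow> real" is inner .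
lift_definition norm_hardy_perp :: "'a hardy_perp \<Rightarrow> real" is norm .

definition dist_hardy_perp :: "'a hardy_perp \<Rightarrow> 'a hardy_perp \<Rightarrow> real" where
  "dist_hardy_perp x y = norm (x - y)"
definition sgn_hardy_perp :: "'a hardy_perp \<Rightarrow> 'a hardy_perp" where
  "sgn_hardy_perp x = inverse (norm x) *\<^sub>R x"
definition uniformity_hardy_perp :: "('a hardy_perp \<times> 'a hardy_perp) filter" where
  "uniformity_hardy_perp = (INF e\<in>{0<..}. principal {(x, y). dist x y < e})"
definition open_hardy_perp :: "'a hardy_perp set \<Rightarrow> bool" where
  "open_hardy_perp U \<longleftrightarrow> (\<forall>x\<in>U. \<forall>\<^sub>F (x', y) in uniformity. x' = x \<longrightarrow> y \<in> U)"

instance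
proof
  fix x y z :: "'a hardy_perp" and a b :: complex and r s :: real
  show "x + y + z = x + (y + z)" by transfer (simp add: algebra_simps)
  show "x + y = y + x" by transfer (simp add: algebra_simps)
  show "0 + x = x" by transfer simp
  show "- x + x = 0" by transfer simp
  show "x - y = x + - y" by transfer simp
  show "r *\<^sub>R (x + y) = r *\<^sub>R x + r *\<^sub>R y" by transfer (simp add: algebra_simps)
  show "(r + s) *\<^sub>R x = r *\<^sub>R x + s *\<^sub>R x" by transfer (simp add: algebra_simps)
  show "r *\<^sub>R s *\<^sub>R x = (r * s) *\<^sub>R x" by transfer simp
  show "1 *\<^sub>R x = x" by transfer simp
  show "a *\<^sub>C (x + y) = a *\<^sub>C x + a *\<^sub>C y" by transfer (simp add: scaleC_add_right)
  show "(a + b) *\<^sub>C x = a *\<^sub>C x + b *\<^sub>C x" by transfer (simp add: scaleC_add_left)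
  show "a *\<^sub>C b *\<^sub>C x = (a * b) *\<^sub>C x" by transfer (simp add: scaleC_scaleC)
  show "1 *\<^sub>C x = x" by transfer (simp add: scaleC_one)
  show "r *\<^sub>R x = complex_of_real r *\<^sub>C x" by transfer (simp add: scaleR_scaleC)
  show "dist x y = norm (x - y)" by (fact dist_hardy_perp_def)
  show "sgn x = inverse (norm x) *\<^sub>R x" by (fact sgn_hardy_perp_def)
  show "(uniformity :: ('a hardy_perp \<times> 'a hardy_perp) filter)
      = (INF e\<in>{0<..}. principal {(x, y). dist x y < e})"
    by (fact uniformity_hardy_perp_def)
  show "open U \<longleftrightarrow> (\<forall>x\<in>U. \<forall>\<^sub>F (x', y) in uniformity. x' = x \<longrightarrow> y \<in> U)"
    for U :: "'a hardy_perp set"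
    by (fact open_hardy_perp_def)
  show "inner x y = inner y x" by transfer (rule inner_commute)
  show "inner (x + y) z = inner x z + inner y z" by transfer (rule inner_add_left)
  show "inner (r *\<^sub>R x) y = r * inner x y" by transfer simp
  show "0 \<le> inner x x" by transfer simp
  show "inner x x = 0 \<longleftrightarrow> x = 0" by transfer simp
  show "norm x = sqrt (inner x x)" by transfer (rule norm_eq_sqrt_inner)
  show "cinner x y = cnj (cinner y x)" by transfer (rule cinner_commute)
  show "cinner x (y + z) = cinner x y + cinner x z" by transfer (rule cinner_add_right)
  show "cinner x (a *\<^sub>C y) = a * cinner x y" by transfer (rule cinner_scaleC_right)
  show "inner x y = Re (cinner x y)" by transfer (rule inner_cinner)
qed

end

instance hardy_perp :: (type) chilbert_space
proof
  fix X :: "nat \<Rightarrow> 'a hardy_perp"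
  assume "Cauchy X"
  have "range (Rep_hardy_perp :: 'a hardy_perp \<Rightarrow> _) = hardy_complement"
    by (rule type_definition.Rep_range[OF type_definition_hardy_perp])
  then have "closed (range (Rep_hardy_perp :: 'a hardy_perp \<Rightarrow> _))"
    by (simp add: closed_hardy_complement)
  moreover have "dist (Rep_hardy_perp x) (Rep_hardy_perp y) = dist x y" for x y :: "'a hardy_perp"
    unfolding dist_norm by transfer simp
  ultimately show "convergent X"
    using convergent_via_isometry \<open>Cauchy X\<close> by blast
qed

section \<open>Big Hankel operators\<close>

definition orth_proj :: "'a::complex_inner set \<Rightarrow> 'a \<Rightarrow> 'a" where
  "orth_proj S x = (THE y. y \<in> S \<and> (\<forall>s\<in>S. cinner s (x - y) = 0))"

text \<open>Meaningful for essentially bounded measurable symbols; for these the choice of the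
  representative of \<open>x\<close> is irrelevant.\<close>

definition mult_L2 :: "(('d \<Rightarrow> complex) \<Rightarrow> complex) \<Rightarrow> 'd torus_L2 \<Rightarrow> 'd torus_L2" where
  "mult_L2 \<phi> x = abs_torus_L2 (\<lambda>z. \<phi> z * rep_torus_L2 x z)"

definition big_hankel :: "(('d \<Rightarrow> complex) \<Rightarrow> complex) \<Rightarrow> 'd hardy \<Rightarrow> 'd hardy_perp" where
  "big_hankel \<phi> f = Abs_hardy_perp (orth_proj hardy_complement (mult_L2 \<phi> (Rep_hardy f)))"

section \<open>The self-absorption property\<close>

definition faithful_rep :: "('b::cstar_algebra \<Rightarrow> 'l::chilbert_space \<Rightarrow> 'l) \<Rightarrow> bool" where
  "faithful_rep \<pi> \<longleftrightarrow>
    (\<forall>a. bounded_clinear (\<pi> a)) \<and>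
    (\<forall>a b v. \<pi> (a + b) v = \<pi> a v + \<pi> b v) \<and>
    (\<forall>c a v. \<pi> (c *\<^sub>C a) v = c *\<^sub>C \<pi> a v) \<and>
    (\<forall>a b v. \<pi> (a * b) v = \<pi> a (\<pi> b v)) \<and>
    (\<forall>a u v. cinner (\<pi> (star a) u) v = cinner u (\<pi> a v)) \<and>
    inj \<pi>"

text \<open>The norm of the finite sum of the \<open>b i \<otimes> x i\<close> in the minimal tensor product of a C*-algebra
  with a space of operators between Hilbert spaces, computed in a faithful representation \<open>\<pi>\<close> of
  the C*-algebra. It does not depend on the choice of \<open>\<pi>\<close>.\<close>

definition min_norm ::
  "('b::cstar_algebra \<Rightarrow> 'l::chilbert_space \<Rightarrow> 'l) \<Rightarrow> ('i \<Rightarrow> 'b) \<Rightarrow>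
    ('i \<Rightarrow> 'h::complex_inner \<Rightarrow> 'k::complex_inner) \<Rightarrow> real" where
  "min_norm \<pi> b x = onorm (\<lambda>\<xi>. \<Sum>i | b i \<noteq> 0. (\<pi> (b i) \<otimes>\<^sub>o x i) \<xi>)"

text \<open>Quantification over all C*-algebras, and over Hilbert spaces on which they are faithfully
  represented, is quantification over the types \<open>'b\<close> and \<open>'l\<close>.\<close>

definition SAP ::
  "'b::cstar_algebra itself \<Rightarrow> 'l::chilbert_space itself \<Rightarrow>
    'i set \<Rightarrow> ('i \<Rightarrow> 'h::chilbert_space \<Rightarrow> 'k::chilbert_space) \<Rightarrow> bool" where
  "SAP B L I x \<longleftrightarrow>
    (\<forall>i\<in>I. bounded_clinear (x i)) \<and>
    (\<forall>(\<pi> :: 'b \<Rightarrow> 'l \<Rightarrow> 'l) b.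
      faithful_rep \<pi> \<and> finite {i. b i \<noteq> 0} \<and> {i. b i \<noteq> 0} \<subseteq> I \<longrightarrow>
      min_norm \<pi> b x = min_norm \<pi> b (\<lambda>i. x i \<otimes>\<^sub>o conj_op (x i)))"

end

theory Submission
  imports Defs "HOL-Library.Function_Algebras"
begin

text \<open>Why the theorem holds. Write \<open>e k\<close> for the character with frequency \<open>k\<close>. The big Hankel operator
  with symbol \<open>e n\<close> is a truncated translation: it sends \<open>e k\<close>, for \<open>k\<close> a frequency of the Hardy space,
  to \<open>e (n + k)\<close> if \<open>n + k\<close> has left the set of Hardy frequencies, and to \<open>0\<close> otherwise. So the sum \<open>T\<close>
  of the \<open>b n \<otimes> x n\<close> is the operator matrix with entry \<open>b (p - k)\<close> in row \<open>p\<close> and column \<open>k\<close>.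

  The operator \<open>x n \<otimes> conj_op (x n)\<close> moves a pair of frequencies \<open>(k, l)\<close> to \<open>(n + k, n + l)\<close>; the
  difference \<open>m = - l + k\<close> does not change. Hence the sum of the \<open>b n \<otimes> x n \<otimes> conj_op (x n)\<close> is an
  orthogonal direct sum of operators \<open>T m\<close>, one for each \<open>m\<close>. Identifying \<open>(l + m, l)\<close> with \<open>l\<close>, the
  operator \<open>T m\<close> has the entries of \<open>T\<close>, but only the columns \<open>l\<close> for which \<open>l + m\<close> is a Hardy frequency
  too, and only the rows \<open>p\<close> for which \<open>p + m\<close> is not one. A submatrix of \<open>T\<close> has norm at most the norm
  of \<open>T\<close>, and \<open>T 0\<close> is \<open>T\<close> itself; so both sums have the same norm.

  This argument makes sense for any truncation of the translations of any group, and is carried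
  out in that generality in \<open>SAP_truncated_translations\<close>, with \<open>norm_truncated_translation_sum\<close> as the
  computation behind it. The rest checks that the Hankel system is an instance: characters are
  orthonormal (\<open>orthonormal_characters\<close>), those with Hardy frequencies are total in the Hardy space
  (\<open>total_hardy_basis\<close>), and the Hankel operators are bounded and act on characters as described
  (\<open>bounded_clinear_big_hankel\<close>, \<open>big_hankel_basis\<close>).\<close>

section \<open>Total sets and orthonormal families in tensor products\<close>

definition total_set :: "'a::complex_inner set \<Rightarrow> bool" where
  "total_set E \<longleftrightarrow> closure (complex_vector.span E) = UNIV"

definition orthonormal_on :: "'i set \<Rightarrow> ('i \<Rightarrow> 'a::complex_inner) \<Rightarrow> bool" where
  "orthonormal_on A e \<longleftrightarrow> (\<forall>k\<in>A. \<forall>l\<in>A. cinner (e k) (e l) = of_bool (k = l))"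

text \<open>The principle by which identities and memberships pass from a total set to the whole space.\<close>

lemma total_set_induct:
  assumes "total_set E" "complex_vector.subspace M" "closed M" "E \<subseteq> M"
  shows "x \<in> M"
proof -
  have "closure (complex_vector.span E) \<subseteq> M"
    by (intro closure_minimal complex_vector.span_minimal assms)
  then show ?thesis
    using assms(1) by (auto simp: total_set_def)
qed

lemma norm_tensor_vec: "norm (h \<otimes>\<^sub>v k) = norm h * norm k"
proof -
  have "complex_of_real ((norm (h \<otimes>\<^sub>v k))\<^sup>2) = complex_of_real ((norm h * norm k)\<^sup>2)"
    using cinner_tensor_vec[of h k h k] by (simp add: cinner_self power_mult_distrib)
  then have "(norm (h \<otimes>\<^sub>v k))\<^sup>2 = (norm h * norm k)\<^sup>2"
    using of_real_eq_iff by blast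
  then show ?thesis
    by (simp add: power2_eq_iff_nonneg)
qed

lemma bounded_clinear_tensor_left: "bounded_clinear (\<lambda>h. h \<otimes>\<^sub>v k)"
  unfolding bounded_clinear_def
  by (auto intro!: bounded_linear_intro[where K = "norm k"]
      simp: tensor_vec_add_left tensor_vec_scaleC_left norm_tensor_vec scaleR_scaleC)

lemma bounded_clinear_tensor_right: "bounded_clinear (\<lambda>k. h \<otimes>\<^sub>v k)"
  unfolding bounded_clinear_def
  by (auto intro!: bounded_linear_intro[where K = "norm h"]
      simp: tensor_vec_add_right tensor_vec_scaleC_right norm_tensor_vec scaleR_scaleC mult.commute)

lemma bounded_clinearD:
  assumes "bounded_clinear f"
  shows "bounded_linear f" "f (x + y) = f x + f y" "f 0 = 0" "f (c *\<^sub>C x) = c *\<^sub>C f x"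
    "f (\<Sum>i\<in>S. g i) = (\<Sum>i\<in>S. f (g i))"
proof -
  show bl: "bounded_linear f" and "f (c *\<^sub>C x) = c *\<^sub>C f x"
    using assms by (auto simp: bounded_clinear_def)
  interpret bounded_linear f by (rule bl)
  show "f (x + y) = f x + f y" "f 0 = 0" "f (\<Sum>i\<in>S. g i) = (\<Sum>i\<in>S. f (g i))"
    by (rule add zero sum)+
qed

lemma closed_subspace_vimage:
  fixes f :: "'a::complex_inner \<Rightarrow> 'b::complex_inner"
  assumes "bounded_clinear f" "complex_vector.subspace M" "closed M"
  shows "complex_vector.subspace (f -` M)" "closed (f -` M)"
proof -
  note f = bounded_clinearD[OF assms(1)]
  show "complex_vector.subspace (f -` M)"
    using assms(2) by (auto simp: complex_vector.subspace_def f)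
  show "closed (f -` M)"
    by (rule closed_vimage[OF assms(3) linear_continuous_on[OF f(1)]])
qed

lemma closed_subspace_closure_span:
  fixes E :: "'a::complex_inner set"
  shows
  "complex_vector.subspace (closure (complex_vector.span E))" "closed (closure (complex_vector.span E))"
  by (auto intro: subspace_closure complex_vector.subspace_span)

lemma subset_closure_span: "(E :: 'a::complex_inner set) \<subseteq> closure (complex_vector.span E)"
  using closure_subset complex_vector.span_superset by blast

text \<open>Two applications of \<open>total_set_induct\<close>, one for each factor: the vectors \<open>h\<close> for which
  \<open>h \<otimes>\<^sub>v k\<close> lies in a given closed subspace again form a closed subspace, and likewise for \<open>k\<close>.\<close>

lemma total_set_tensor:
  fixes E :: "'a::complex_inner set" and E' :: "'b::complex_inner set"
  assumes E: "total_set E" and E': "total_set E'"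
  shows "total_set ((\<lambda>(h, k). h \<otimes>\<^sub>v k) ` (E \<times> E'))"
proof -
  let ?T = "(\<lambda>(h, k). h \<otimes>\<^sub>v k) ` (E \<times> E')"
  let ?M = "closure (complex_vector.span ?T)"
  note M = closed_subspace_closure_span[of ?T]
  have left: "h \<otimes>\<^sub>v k \<in> ?M" if "k \<in> E'" for h k
  proof -
    have "h \<in> (\<lambda>h. h \<otimes>\<^sub>v k) -` ?M"
    proof (rule total_set_induct[OF E closed_subspace_vimage[OF bounded_clinear_tensor_left M]])
      show "E \<subseteq> (\<lambda>h. h \<otimes>\<^sub>v k) -` ?M"
        using that subset_closure_span[of ?T] by fastforce
    qed
    then show ?thesis by simp
  qed
  have both: "h \<otimes>\<^sub>v k \<in> ?M" for h k
  proof -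
    have "k \<in> (\<lambda>k. h \<otimes>\<^sub>v k) -` ?M"
      by (rule total_set_induct[OF E' closed_subspace_vimage[OF bounded_clinear_tensor_right M]])
        (use left in auto)
    then show ?thesis by simp
  qed
  have "total_set (range (\<lambda>(h, k). h \<otimes>\<^sub>v k) :: ('a, 'b) hilbert_tensor set)"
    by (simp add: total_set_def tensor_vec_total)
  then have "x \<in> ?M" for x
    by (rule total_set_induct[OF _ M]) (use both in auto)
  then show ?thesis
    unfolding total_set_def by blast
qed

lemma to_conj_linear:
  "to_conj 0 = 0" "to_conj (x + y) = to_conj x + to_conj y"
  "to_conj (c *\<^sub>C x) = cnj c *\<^sub>C to_conj x" "to_conj (r *\<^sub>R x) = r *\<^sub>R to_conj x"
  by (simp_all add: zero_conj_space.abs_eq plus_conj_space.abs_eq scaleC_conj_space.abs_eq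
      scaleR_conj_space.abs_eq)

text \<open>The argument is repeated for \<open>to_conj\<close> because this map is antilinear; its preimages of closed
  subspaces are nevertheless closed subspaces.\<close>

lemma total_set_to_conj:
  assumes "total_set E"
  shows "total_set (to_conj ` E)"
proof -
  let ?M = "closure (complex_vector.span (to_conj ` E))"
  note M = closed_subspace_closure_span[of "to_conj ` E"]
  have "bounded_linear (to_conj :: 'a \<Rightarrow> _)"
    by (rule bounded_linear_intro[where K = 1]) (simp_all add: to_conj_linear norm_conj_space.abs_eq)
  then have "closed (to_conj -` ?M)"
    by (intro closed_vimage[OF M(2)] linear_continuous_on)
  moreover have "complex_vector.subspace (to_conj -` ?M)"
    using M(1) by (auto simp: complex_vector.subspace_def to_conj_linear)
  ultimately have "x \<in> to_conj -` ?M" for x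
    by (intro total_set_induct[OF assms]) (use subset_closure_span[of "to_conj ` E"] in auto)
  then have "to_conj (of_conj y) \<in> ?M" for y
    by blast
  then show ?thesis
    by (auto simp: total_set_def of_conj_inverse)
qed

lemma norm_sum_tensor_orthonormal:
  assumes "orthonormal_on J f" "P \<subseteq> J" "finite P"
  shows "(norm (\<Sum>p\<in>P. a p \<otimes>\<^sub>v f p))\<^sup>2 = (\<Sum>p\<in>P. (norm (a p))\<^sup>2)"
proof -
  let ?v = "\<Sum>p\<in>P. a p \<otimes>\<^sub>v f p"
  have "complex_of_real ((norm ?v)\<^sup>2) = (\<Sum>p\<in>P. \<Sum>q\<in>P. cinner (a p) (a q) * cinner (f p) (f q))"
    unfolding cinner_self[symmetric]
    by (simp add: cinner_sum_left cinner_sum_right cinner_tensor_vec) (rule sum.swap)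
  also have "\<dots> = (\<Sum>p\<in>P. \<Sum>q\<in>P. if p = q then cinner (a p) (a q) else 0)"
    using assms by (intro sum.cong) (auto simp: orthonormal_on_def subset_eq)
  also have "\<dots> = complex_of_real (\<Sum>p\<in>P. (norm (a p))\<^sup>2)"
    using assms(3) by (simp add: cinner_self)
  finally show ?thesis
    unfolding of_real_eq_iff .
qed

text \<open>Norm estimates need only be made for vectors with finitely many coefficients, which keeps
  infinite series out of the later computations. The coefficient function is normalised to vanish
  off the index set, so that it can be evaluated at arbitrary indices.\<close>

lemma onorm_le_on_finite_sums:
  fixes e :: "'i \<Rightarrow> 'h::complex_inner"
    and R :: "('l::complex_inner, 'h) hilbert_tensor \<Rightarrow> 'c::complex_inner"
  assumes e: "total_set (e ` A)" and R: "bounded_clinear R" and C: "0 \<le> C"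
    and le: "\<And>F h. finite F \<Longrightarrow> F \<subseteq> A \<Longrightarrow> (\<And>k. k \<notin> F \<Longrightarrow> h k = 0) \<Longrightarrow>
      norm (R (\<Sum>k\<in>F. h k \<otimes>\<^sub>v e k)) \<le> C * norm (\<Sum>k\<in>F. h k \<otimes>\<^sub>v e k)"
  shows "onorm R \<le> C"
proof (rule onorm_bound[OF C])
  fix \<xi>
  let ?T = "(\<lambda>(h, k). h \<otimes>\<^sub>v k) ` (UNIV \<times> e ` A) :: ('l, 'h) hilbert_tensor set"
  let ?M = "{\<xi>. norm (R \<xi>) \<le> C * norm \<xi>}"
  have sums: "\<exists>F h. finite F \<and> F \<subseteq> A \<and> (\<forall>k. k \<notin> F \<longrightarrow> h k = 0) \<and> y = (\<Sum>k\<in>F. h k \<otimes>\<^sub>v e k)"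
    if "y \<in> complex_vector.span ?T" for y
    using that
  proof (induction rule: complex_vector.span_induct_alt)
    case base
    show ?case by (intro exI[of _ "{}"] exI[of _ "\<lambda>_. 0"]) simp
  next
    case (step c t y)
    then obtain g k F h where t: "t = g \<otimes>\<^sub>v e k" "k \<in> A"
      and F: "finite F" "F \<subseteq> A" "\<forall>k. k \<notin> F \<longrightarrow> h k = 0" "y = (\<Sum>k\<in>F. h k \<otimes>\<^sub>v e k)"
      by fastforce
    let ?h = "\<lambda>j. (if j = k then c *\<^sub>C g else 0) + h j"
    have zero: "(0::'l) \<otimes>\<^sub>v v = 0" for v :: 'h
      by (rule bounded_clinearD(3)[OF bounded_clinear_tensor_left])
    have "(\<Sum>j\<in>insert k F. ?h j \<otimes>\<^sub>v e j)
        = (\<Sum>j\<in>insert k F. if j = k then (c *\<^sub>C g) \<otimes>\<^sub>v e k else 0) + (\<Sum>j\<in>insert k F. h j \<otimes>\<^sub>v e j)"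
      unfolding sum.distrib[symmetric] by (intro sum.cong) (auto simp: tensor_vec_add_left zero)
    also have "(\<Sum>j\<in>insert k F. h j \<otimes>\<^sub>v e j) = y"
      unfolding F(4) using F(1,3) by (intro sum.mono_neutral_right) (auto simp: zero)
    finally have "c *\<^sub>C t + y = (\<Sum>j\<in>insert k F. ?h j \<otimes>\<^sub>v e j)"
      using F(1) by (simp add: t tensor_vec_scaleC_left)
    then show ?case
      using F t by (intro exI[of _ "insert k F"] exI[of _ ?h]) auto
  qed
  have "total_set ?T"
    by (intro total_set_tensor e) (simp add: total_set_def)
  moreover have "closure (complex_vector.span ?T) \<subseteq> ?M"
  proof (rule closure_minimal)
    show "complex_vector.span ?T \<subseteq> ?M"
      using sums le by blast
    show "closed ?M"
      using bounded_clinearD(1)[OF R]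
      by (intro closed_Collect_le continuous_intros linear_continuous_on)
  qed
  ultimately show "norm (R \<xi>) \<le> C * norm \<xi>"
    by (auto simp: total_set_def)
qed

lemma bounded_clinear_conj_op:
  assumes "bounded_clinear T"
  shows "bounded_clinear (conj_op T)"
proof -
  note T = bounded_clinearD[OF assms]
  interpret bounded_linear T by (rule T(1))
  obtain K where K: "\<And>x. norm (T x) \<le> norm x * K" using bounded by blast
  show ?thesis
    unfolding bounded_clinear_def conj_op_def
    by (intro conjI allI bounded_linear_intro[where K = K])
      (simp_all add: T(2,4) K scaleR plus_conj_space.rep_eq scaleC_conj_space.rep_eq
        scaleR_conj_space.rep_eq norm_conj_space.rep_eq to_conj_linear to_conj_inverse)
qed

lemma bounded_clinear_sum:
  assumes "\<And>i. i \<in> S \<Longrightarrow> bounded_clinear (f i)"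
  shows "bounded_clinear (\<lambda>\<xi>. \<Sum>i\<in>S. f i \<xi>)"
proof -
  have "(\<Sum>i\<in>S. f i (c *\<^sub>C x)) = c *\<^sub>C (\<Sum>i\<in>S. f i x)" for c x
    unfolding complex_vector.scale_sum_right using bounded_clinearD(4)[OF assms] by (rule sum.cong[OF refl])
  then show ?thesis
    using assms unfolding bounded_clinear_def by (auto intro: bounded_linear_sum)
qed

section \<open>Truncated translations\<close>

text \<open>The vector with coefficients \<open>h\<close> is mapped to one whose coefficient at \<open>p\<close> collects the
  \<open>B n (h k)\<close> with \<open>act n k = p\<close>, that is, with \<open>k = act' n p\<close>; the norm is then read off from
  Pythagoras. The group enters only through bijections \<open>act n\<close>, because the lemma is used for two
  actions: translations of a group \<open>G\<close>, and the diagonal translations of \<open>G \<times> G\<close>. Any finite \<open>P\<close>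
  containing all translates of \<open>F\<close> serves; this freedom allows a convenient choice of \<open>P\<close> later.\<close>

lemma norm_truncated_translation_sum:
  fixes B :: "'n \<Rightarrow> 'l::complex_inner \<Rightarrow> 'm::complex_inner"
    and x :: "'n \<Rightarrow> 'h::complex_inner \<Rightarrow> 'k::complex_inner"
    and act :: "'n \<Rightarrow> 'x \<Rightarrow> 'x"
  assumes fin: "finite F" "finite P" and F: "F \<subseteq> A"
    and B: "\<And>n. n \<in> S \<Longrightarrow> bounded_clinear (B n)"
    and X: "\<And>n. n \<in> S \<Longrightarrow> bounded_clinear (x n)"
    and f: "orthonormal_on J f"
    and x: "\<And>n k. n \<in> S \<Longrightarrow> k \<in> A \<Longrightarrow> x n (e k) = (if act n k \<in> J then f (act n k) else 0)"
    and act: "\<And>n k. act' n (act n k) = k" "\<And>n p. act n (act' n p) = p"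
    and P: "\<And>n k. n \<in> S \<Longrightarrow> k \<in> F \<Longrightarrow> act n k \<in> P"
    and h: "\<And>k. k \<notin> F \<Longrightarrow> h k = 0"
  shows "(norm (\<Sum>n\<in>S. (B n \<otimes>\<^sub>o x n) (\<Sum>k\<in>F. h k \<otimes>\<^sub>v e k)))\<^sup>2
    = (\<Sum>p\<in>P \<inter> J. (norm (\<Sum>n\<in>S. B n (h (act' n p))))\<^sup>2)"
proof -
  have zero: "(0::'m) \<otimes>\<^sub>v v = 0" "v' \<otimes>\<^sub>v (0::'k) = 0" for v :: 'k and v' :: 'm
    by (rule bounded_clinearD(3)[OF bounded_clinear_tensor_left]
        bounded_clinearD(3)[OF bounded_clinear_tensor_right])+
  have "(B n \<otimes>\<^sub>o x n) (\<Sum>k\<in>F. h k \<otimes>\<^sub>v e k) = (\<Sum>p\<in>P \<inter> J. B n (h (act' n p)) \<otimes>\<^sub>v f p)"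
    if n: "n \<in> S" for n
  proof -
    note T = tensor_op_props[OF B[OF n] X[OF n]]
    have B0: "B n 0 = 0"
      by (rule bounded_clinearD(3)[OF B[OF n]])
    have "(B n \<otimes>\<^sub>o x n) (\<Sum>k\<in>F. h k \<otimes>\<^sub>v e k) = (\<Sum>k\<in>F. B n (h k) \<otimes>\<^sub>v x n (e k))"
      by (simp add: bounded_clinearD(5)[OF T(1)] T(2))
    also have "\<dots> = (\<Sum>k\<in>F. if act n k \<in> J then B n (h k) \<otimes>\<^sub>v f (act n k) else 0)"
      using F x[OF n] by (intro sum.cong) (auto simp: zero subset_eq)
    also have "\<dots> = (\<Sum>k | k \<in> F \<and> act n k \<in> J. B n (h k) \<otimes>\<^sub>v f (act n k))"
      by (rule sum.inter_filter[OF fin(1), symmetric])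
    also have "\<dots> = (\<Sum>p\<in>P \<inter> J. B n (h (act' n p)) \<otimes>\<^sub>v f p)"
      by (rule sum.reindex_bij_witness_not_neutral
          [where S' = "{}" and T' = "{p \<in> P \<inter> J. act' n p \<notin> F}" and i = "act' n" and j = "act n"])
        (use fin n P in \<open>auto simp: act zero h B0\<close>)
    finally show ?thesis .
  qed
  then have "(\<Sum>n\<in>S. (B n \<otimes>\<^sub>o x n) (\<Sum>k\<in>F. h k \<otimes>\<^sub>v e k))
      = (\<Sum>p\<in>P \<inter> J. (\<Sum>n\<in>S. B n (h (act' n p))) \<otimes>\<^sub>v f p)"
    by (simp add: sum.swap[of _ S] bounded_clinearD(5)[OF bounded_clinear_tensor_left])
  then show ?thesis
    using norm_sum_tensor_orthonormal[OF f, of "P \<inter> J"] fin by simp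
qed

text \<open>The direct sum argument of the introduction. The lower bound for the norm of the tensor square
  comes from the diagonal vectors, which form the summand \<open>m = 0\<close>. The upper bound splits a vector
  of the tensor square according to the value of \<open>- l + k\<close> at the index \<open>(k, l)\<close>.\<close>

theorem SAP_truncated_translations:
  fixes e :: "'g::group_add \<Rightarrow> 'h::chilbert_space" and f :: "'g \<Rightarrow> 'k::chilbert_space"
  assumes e: "orthonormal_on A e" "total_set (e ` A)" and f: "orthonormal_on J f"
    and X: "\<And>n. n \<in> I \<Longrightarrow> bounded_clinear (x n)"
    and x: "\<And>n k. n \<in> I \<Longrightarrow> k \<in> A \<Longrightarrow> x n (e k) = (if n + k \<in> J then f (n + k) else 0)"
  shows "SAP TYPE('b::cstar_algebra) TYPE('l::chilbert_space) I x"
  unfolding SAP_def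
proof (intro conjI ballI allI impI X)
  fix \<pi> :: "'b \<Rightarrow> 'l \<Rightarrow> 'l" and b :: "'g \<Rightarrow> 'b"
  assume "faithful_rep \<pi> \<and> finite {i. b i \<noteq> 0} \<and> {i. b i \<noteq> 0} \<subseteq> I"
  then have B: "\<And>n. bounded_clinear (\<pi> (b n))" and S: "finite {i. b i \<noteq> 0}" "{i. b i \<noteq> 0} \<subseteq> I"
    by (auto simp: faithful_rep_def)
  define S where "S = {i. b i \<noteq> 0}"
  note S = S[folded S_def]
  define x2 where "x2 n = x n \<otimes>\<^sub>o conj_op (x n)" for n
  define T where "T = (\<lambda>\<xi>. \<Sum>n\<in>S. (\<pi> (b n) \<otimes>\<^sub>o x n) \<xi>)"
  define T2 where "T2 = (\<lambda>\<xi>. \<Sum>n\<in>S. (\<pi> (b n) \<otimes>\<^sub>o x2 n) \<xi>)"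
  define e2 where "e2 = (\<lambda>(k, l). e k \<otimes>\<^sub>v to_conj (e l))"
  define f2 where "f2 = (\<lambda>(k, l). f k \<otimes>\<^sub>v to_conj (f l))"
  define act where "act n = map_prod ((+) n) ((+) n)" for n :: 'g
  define act' where "act' n = map_prod ((+) (- n)) ((+) (- n))" for n :: 'g
  have X: "bounded_clinear (x n)" if "n \<in> S" for n
    using X S that by blast
  have X2: "bounded_clinear (x2 n)" if "n \<in> S" for n
    unfolding x2_def by (intro tensor_op_props(1) bounded_clinear_conj_op X that)
  have T: "bounded_clinear T"
    unfolding T_def by (intro bounded_clinear_sum tensor_op_props(1) B X)
  have T2: "bounded_clinear T2"
    unfolding T2_def by (intro bounded_clinear_sum tensor_op_props(1) B X2)
  have conj: "cinner (to_conj u) (to_conj v) = cinner v u" for u v :: "'a::complex_inner"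
    by (rule cinner_conj_space.abs_eq)
  have e2: "orthonormal_on (A \<times> A) e2" and f2: "orthonormal_on (J \<times> J) f2"
    using e f by (auto simp: orthonormal_on_def e2_def f2_def cinner_tensor_vec conj)
  have total_e2: "total_set (e2 ` (A \<times> A))"
  proof -
    have "e2 ` (A \<times> A) = (\<lambda>(h, k). h \<otimes>\<^sub>v k) ` (e ` A \<times> to_conj ` e ` A)"
      by (auto simp: e2_def image_iff)
    then show ?thesis
      using total_set_tensor[OF e(2) total_set_to_conj[OF e(2)]] by simp
  qed
  have x2: "x2 n (e2 k) = (if act n k \<in> J \<times> J then f2 (act n k) else 0)"
    if n: "n \<in> S" and k_in: "k \<in> A \<times> A" for n k
  proof -
    obtain k1 k2 where k: "k = (k1, k2)" "k1 \<in> A" "k2 \<in> A" using k_in by auto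
    have "x2 n (e2 k) = x n (e k1) \<otimes>\<^sub>v to_conj (x n (e k2))"
      unfolding x2_def e2_def k(1)
      using tensor_op_props(2)[OF X[OF n] bounded_clinear_conj_op[OF X[OF n]]]
      by (simp add: conj_op_def to_conj_inverse)
    then show ?thesis
      using n S x k bounded_clinearD(3)[OF bounded_clinear_tensor_left]
        bounded_clinearD(3)[OF bounded_clinear_tensor_right]
      by (auto simp: act_def f2_def subset_eq simp flip: zero_conj_space.abs_eq)
  qed
  have normT: "(norm (T (\<Sum>k\<in>F. h k \<otimes>\<^sub>v e k)))\<^sup>2
      = (\<Sum>p\<in>P \<inter> J. (norm (\<Sum>n\<in>S. \<pi> (b n) (h (- n + p))))\<^sup>2)"
    if "finite F" "finite P" "F \<subseteq> A" "\<And>n k. n \<in> S \<Longrightarrow> k \<in> F \<Longrightarrow> n + k \<in> P" "\<And>k. k \<notin> F \<Longrightarrow> h k = 0"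
    for F P h
    unfolding T_def
    by (rule norm_truncated_translation_sum[where act = "(+)" and A = A and f = f])
      (use that B X f x S in \<open>auto simp: add.assoc[symmetric]\<close>)
  have normT2: "(norm (T2 (\<Sum>k\<in>F. h k \<otimes>\<^sub>v e2 k)))\<^sup>2
      = (\<Sum>p\<in>P \<inter> J \<times> J. (norm (\<Sum>n\<in>S. \<pi> (b n) (h (act' n p))))\<^sup>2)"
    if "finite F" "finite P" "F \<subseteq> A \<times> A" "\<And>n k. n \<in> S \<Longrightarrow> k \<in> F \<Longrightarrow> act n k \<in> P"
      "\<And>k. k \<notin> F \<Longrightarrow> h k = 0" for F P h
    unfolding T2_def
    by (rule norm_truncated_translation_sum[where act = act and A = "A \<times> A" and f = f2])
      (use that B X2 f2 x2 S in \<open>auto simp: act_def act'_def map_prod_def add.assoc[symmetric]\<close>)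
  have "onorm T \<le> onorm T2"
  proof (rule onorm_le_on_finite_sums[OF e(2) T onorm_pos_le[OF bounded_clinearD(1)[OF T2]]])
    fix F and h :: "'g \<Rightarrow> 'l"
    assume F: "finite F" "F \<subseteq> A" and h: "\<And>k. k \<notin> F \<Longrightarrow> h k = 0"
    define P where "P = (\<lambda>(n, k). n + k) ` (S \<times> F)"
    \<comment> \<open>The vector is copied to the diagonal of \<open>A \<times> A\<close>, where \<open>T2\<close> acts as \<open>T\<close> does on \<open>A\<close>.\<close>
    define h2 where "h2 = (\<lambda>(k, l). if k = l then h k else 0)"
    have h2_0: "h2 p = 0" if "p \<notin> (\<lambda>k. (k, k)) ` F" for p
      using that h by (cases p) (auto simp: h2_def)
    let ?v = "\<Sum>k\<in>F. h k \<otimes>\<^sub>v e k" and ?w = "\<Sum>k\<in>(\<lambda>k. (k, k)) ` F. h2 k \<otimes>\<^sub>v e2 k"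
    have inj: "inj_on (\<lambda>k. (k, k)) D" for D :: "'g set"
      by (rule inj_onI) simp
    have "(norm (T2 ?w))\<^sup>2 = (\<Sum>p\<in>(\<lambda>k. (k, k)) ` P \<inter> J \<times> J. (norm (\<Sum>n\<in>S. \<pi> (b n) (h2 (act' n p))))\<^sup>2)"
      by (rule normT2) (use F S h2_0 in \<open>auto simp: P_def act_def\<close>)
    also have "(\<lambda>k. (k, k)) ` P \<inter> J \<times> J = (\<lambda>k. (k, k)) ` (P \<inter> J)"
      by auto
    also have "(\<Sum>p\<in>(\<lambda>k. (k, k)) ` (P \<inter> J). (norm (\<Sum>n\<in>S. \<pi> (b n) (h2 (act' n p))))\<^sup>2)
        = (\<Sum>p\<in>P \<inter> J. (norm (\<Sum>n\<in>S. \<pi> (b n) (h (- n + p))))\<^sup>2)"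
      by (simp add: sum.reindex[OF inj] act'_def h2_def)
    also have "\<dots> = (norm (T ?v))\<^sup>2"
      by (rule normT[symmetric]) (use F h S in \<open>auto simp: P_def\<close>)
    finally have "norm (T2 ?w) = norm (T ?v)"
      by (simp add: power2_eq_iff_nonneg)
    moreover have "(norm ?w)\<^sup>2 = (norm ?v)\<^sup>2"
    proof -
      have "(norm ?w)\<^sup>2 = (\<Sum>k\<in>(\<lambda>k. (k, k)) ` F. (norm (h2 k))\<^sup>2)"
        by (rule norm_sum_tensor_orthonormal[OF e2]) (use F in auto)
      also have "\<dots> = (\<Sum>k\<in>F. (norm (h k))\<^sup>2)"
        by (simp add: sum.reindex[OF inj] h2_def)
      also have "\<dots> = (norm ?v)\<^sup>2"
        by (rule norm_sum_tensor_orthonormal[OF e(1), symmetric]) (use F in auto)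
      finally show ?thesis .
    qed
    then have "norm ?w = norm ?v"
      by (simp add: power2_eq_iff_nonneg)
    ultimately show "norm (T ?v) \<le> onorm T2 * norm ?v"
      using onorm[OF bounded_clinearD(1)[OF T2], of ?w] by simp
  qed
  moreover have "onorm T2 \<le> onorm T"
  proof (rule onorm_le_on_finite_sums[OF total_e2 T2 onorm_pos_le[OF bounded_clinearD(1)[OF T]]])
    fix F and h :: "'g \<times> 'g \<Rightarrow> 'l"
    assume F: "finite F" "F \<subseteq> A \<times> A" and h: "\<And>k. k \<notin> F \<Longrightarrow> h k = 0"
    \<comment> \<open>\<open>M\<close> holds the differences that occur. By \<open>\<tau>\<close> the summand with difference \<open>m\<close> is indexed by
      second coordinates: it has column indices in \<open>D\<close> and row indices in \<open>Q\<close>, for every \<open>m\<close>.\<close>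
    define M where "M = (\<lambda>(k, l). - l + k) ` F"
    define D where "D = snd ` F"
    define Q where "Q = (\<lambda>(n, l). n + l) ` (S \<times> D)"
    define \<tau> where "\<tau> = (\<lambda>(m, l). (l + m, l) :: 'g \<times> 'g)"
    have fin: "finite M" "finite D" "finite Q"
      using F S by (auto simp: M_def Q_def D_def)
    have inj: "inj_on \<tau> C" for C
      by (rule inj_onI) (auto simp: \<tau>_def)
    have D: "D \<subseteq> A"
      using F by (auto simp: D_def)
    have F_sub: "F \<subseteq> \<tau> ` (M \<times> D)"
    proof
      fix p assume p: "p \<in> F"
      then have "p = \<tau> (- snd p + fst p, snd p)"
        by (cases p) (simp add: \<tau>_def add.assoc[symmetric])
      moreover have "(- snd p + fst p, snd p) \<in> M \<times> D"
        using p by (cases p) (force simp: M_def D_def)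
      ultimately show "p \<in> \<tau> ` (M \<times> D)" by blast
    qed
    have h0: "h (l + m, l) = 0" if "l \<notin> D" for l m
      using that by (intro h) (force simp: D_def)
    let ?w = "\<Sum>k\<in>F. h k \<otimes>\<^sub>v e2 k" and ?v = "\<lambda>m. \<Sum>l\<in>D. h (l + m, l) \<otimes>\<^sub>v e l"
    \<comment> \<open>\<open>?v m\<close> is the summand of \<open>?w\<close> with difference \<open>m\<close>, brought back to \<open>A\<close>.\<close>
    let ?a = "\<lambda>m q. (norm (\<Sum>n\<in>S. \<pi> (b n) (h (- n + q + m, - n + q))))\<^sup>2"
    have "(norm (T2 ?w))\<^sup>2 = (\<Sum>p\<in>\<tau> ` (M \<times> Q) \<inter> J \<times> J. (norm (\<Sum>n\<in>S. \<pi> (b n) (h (act' n p))))\<^sup>2)"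
    proof (rule normT2)
      fix n k assume n: "n \<in> S" and "k \<in> F"
      then obtain m l where "k = \<tau> (m, l)" "m \<in> M" "l \<in> D"
        using F_sub by blast
      then have "act n k = \<tau> (m, n + l)" "(m, n + l) \<in> M \<times> Q"
        using n by (auto simp: \<tau>_def act_def Q_def add.assoc)
      then show "act n k \<in> \<tau> ` (M \<times> Q)" by blast
    qed (use F h fin in auto)
    \<comment> \<open>Rows of \<open>T\<close> missing from a summand are filled in here: both \<open>q + m\<close> and \<open>q\<close> had to lie in \<open>J\<close>
      before, and now only \<open>q\<close>.\<close>
    also have "\<dots> \<le> (\<Sum>p\<in>\<tau> ` (M \<times> (Q \<inter> J)). (norm (\<Sum>n\<in>S. \<pi> (b n) (h (act' n p))))\<^sup>2)"
      using fin by (intro sum_mono2) (auto simp: \<tau>_def)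
    also have "\<dots> = (\<Sum>(m, q)\<in>M \<times> (Q \<inter> J). ?a m q)"
      unfolding sum.reindex[OF inj] by (intro sum.cong) (auto simp: \<tau>_def act'_def add.assoc)
    also have "\<dots> = (\<Sum>m\<in>M. \<Sum>q\<in>Q \<inter> J. ?a m q)"
      by (simp add: sum.cartesian_product)
    also have "\<dots> = (\<Sum>m\<in>M. (norm (T (?v m)))\<^sup>2)"
      by (intro sum.cong refl normT[symmetric]) (use fin D h0 in \<open>auto simp: Q_def\<close>)
    also have "\<dots> \<le> (\<Sum>m\<in>M. (onorm T * norm (?v m))\<^sup>2)"
      by (intro sum_mono power_mono onorm bounded_clinearD(1)[OF T]) simp
    also have "\<dots> = (onorm T)\<^sup>2 * (\<Sum>m\<in>M. (norm (?v m))\<^sup>2)"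
      by (simp add: power_mult_distrib sum_distrib_left)
    also have "(\<Sum>m\<in>M. (norm (?v m))\<^sup>2) = (\<Sum>m\<in>M. \<Sum>l\<in>D. (norm (h (l + m, l)))\<^sup>2)"
      using fin D by (intro sum.cong refl norm_sum_tensor_orthonormal[OF e(1)])
    also have "\<dots> = (\<Sum>p\<in>\<tau> ` (M \<times> D). (norm (h p))\<^sup>2)"
      unfolding sum.reindex[OF inj] sum.cartesian_product by (intro sum.cong) (auto simp: \<tau>_def)
    also have "\<dots> = (\<Sum>p\<in>F. (norm (h p))\<^sup>2)"
      using fin F_sub h by (intro sum.mono_neutral_right) auto
    also have "\<dots> = (norm ?w)\<^sup>2"
      by (rule norm_sum_tensor_orthonormal[OF e2, symmetric]) (use F in auto)
    finally have "(norm (T2 ?w))\<^sup>2 \<le> (onorm T * norm ?w)\<^sup>2"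
      by (simp add: power_mult_distrib)
    then show "norm (T2 ?w) \<le> onorm T * norm ?w"
      by (simp add: power2_le_iff_abs_le onorm_pos_le[OF bounded_clinearD(1)[OF T]])
  qed
  ultimately show "min_norm \<pi> b x = min_norm \<pi> b (\<lambda>i. x i \<otimes>\<^sub>o conj_op (x i))"
    unfolding min_norm_def S_def[symmetric] T_def T2_def x2_def by simp
qed

section \<open>Orthogonal projections\<close>

text \<open>The projection of \<open>x\<close> is a point of \<open>M\<close> at minimal distance. A minimising sequence is Cauchy by
  the parallelogram law, so completeness provides such a point.\<close>

lemma orthogonal_projection_exists:
  fixes M :: "'a::chilbert_space set"
  assumes M: "complex_vector.subspace M" "closed M"
  obtains y where "y \<in> M" "\<And>s. s \<in> M \<Longrightarrow> cinner s (x - y) = 0"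
proof -
  note sub = complex_vector.subspace_add[OF M(1)] complex_vector.subspace_diff[OF M(1)]
    complex_vector.subspace_scale[OF M(1)]
  have ne: "M \<noteq> {}"
    using complex_vector.subspace_0[OF M(1)] by blast
  \<comment> \<open>Squared distances, as the parallelogram law is about squares.\<close>
  define d where "d = (infdist x M)\<^sup>2"
  have d: "d \<le> (norm (x - s))\<^sup>2" if "s \<in> M" for s
    unfolding d_def dist_norm[symmetric] by (intro power_mono infdist_le that infdist_nonneg)
  have "\<exists>s\<in>M. (norm (x - s))\<^sup>2 < d + inverse (Suc n)" for n
  proof (rule ccontr)
    assume "\<not> ?thesis"
    then have "sqrt (d + inverse (Suc n)) \<le> dist x s" if "s \<in> M" for s
      using that by (intro real_le_lsqrt) (simp_all add: not_less dist_norm)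
    then have "sqrt (d + inverse (Suc n)) \<le> infdist x M"
      unfolding infdist_notempty[OF ne] by (intro cINF_greatest ne)
    then have "(sqrt (d + inverse (Suc n)))\<^sup>2 \<le> d"
      unfolding d_def by (intro power_mono) (auto simp: add_nonneg_nonneg)
    moreover have "(sqrt (d + inverse (Suc n)))\<^sup>2 = d + inverse (Suc n)"
      by (intro real_sqrt_pow2) (auto simp: d_def)
    moreover have "0 < inverse (real (Suc n))"
      by simp
    ultimately show False
      by linarith
  qed
  then obtain s where s: "\<And>n. s n \<in> M" "\<And>n. (norm (x - s n))\<^sup>2 < d + inverse (Suc n)"
    by metis
  have par: "(norm (s m - s n))\<^sup>2 \<le> 2 * inverse (Suc m) + 2 * inverse (Suc n)" for m n
  proof -
    let ?h = "complex_of_real (1/2) *\<^sub>C (s m + s n)"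
    have h: "?h = (1/2) *\<^sub>R (s m + s n)"
      by (simp only: scaleR_scaleC)
    have "(norm (s m - s n))\<^sup>2 = 2 * (norm (x - s m))\<^sup>2 + 2 * (norm (x - s n))\<^sup>2 - 4 * (norm (x - ?h))\<^sup>2"
      unfolding h power2_norm_eq_inner
      by (simp add: inner_diff_left inner_diff_right inner_add_left inner_add_right inner_commute algebra_simps)
    moreover have "d \<le> (norm (x - ?h))\<^sup>2"
      by (intro d sub s)
    ultimately show ?thesis
      using s(2)[of m] s(2)[of n] by linarith
  qed
  have "Cauchy s"
  proof (rule metric_CauchyI)
    fix \<epsilon> :: real assume \<epsilon>: "0 < \<epsilon>"
    then obtain N where N: "inverse (real (Suc N)) < \<epsilon>\<^sup>2 / 4"
      using reals_Archimedean[of "\<epsilon>\<^sup>2 / 4"] by auto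
    show "\<exists>N. \<forall>m\<ge>N. \<forall>n\<ge>N. dist (s m) (s n) < \<epsilon>"
    proof (intro exI[of _ N] allI impI)
      fix m n assume mn: "N \<le> m" "N \<le> n"
      have "inverse (real (Suc m)) \<le> inverse (real (Suc N))" "inverse (real (Suc n)) \<le> inverse (real (Suc N))"
        using mn by (auto intro!: le_imp_inverse_le)
      then have "(norm (s m - s n))\<^sup>2 < \<epsilon>\<^sup>2"
        using par[of m n] N by linarith
      then show "dist (s m) (s n) < \<epsilon>"
        using \<epsilon> by (simp add: dist_norm power2_less_imp_less)
    qed
  qed
  then obtain y where y: "s \<longlonglongrightarrow> y"
    using Cauchy_convergent convergent_def by blast
  have yM: "y \<in> M"
    using closed_sequentially[OF M(2) s(1) y] .
  have yd: "(norm (x - y))\<^sup>2 \<le> d"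
  proof (rule LIMSEQ_le)
    show "(\<lambda>n. (norm (x - s n))\<^sup>2) \<longlonglongrightarrow> (norm (x - y))\<^sup>2"
      by (intro tendsto_intros y)
    show "(\<lambda>n. d + inverse (real (Suc n))) \<longlonglongrightarrow> d"
      using tendsto_add[OF tendsto_const LIMSEQ_inverse_real_of_nat, of d] by simp
  qed (use s in \<open>auto intro: less_imp_le\<close>)
  have "cinner t (x - y) = 0" if t: "t \<in> M" for t
  proof (cases "t = 0")
    case False
    \<comment> \<open>\<open>c *\<^sub>C t\<close> is the component of \<open>x - y\<close> along \<open>t\<close>: if it were not \<open>0\<close>, then \<open>y + c *\<^sub>C t\<close> would
      be closer to \<open>x\<close> than \<open>y\<close> is.\<close>
    define c where "c = cinner t (x - y) / complex_of_real ((norm t)\<^sup>2)"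
    have tt: "cinner t t \<noteq> 0"
      using False by (simp add: cinner_self)
    have orth: "cinner t (x - y - c *\<^sub>C t) = 0"
      using tt by (simp add: cinner_diff_right cinner_scaleC_right c_def cinner_self)
    have "x - y = (x - y - c *\<^sub>C t) + c *\<^sub>C t"
      by simp
    then have "(norm (x - y))\<^sup>2 = (norm ((x - y - c *\<^sub>C t) + c *\<^sub>C t))\<^sup>2"
      by simp
    also have "\<dots> = (norm (x - y - c *\<^sub>C t))\<^sup>2 + 2 * inner (c *\<^sub>C t) (x - y - c *\<^sub>C t) + (norm (c *\<^sub>C t))\<^sup>2"
      unfolding power2_norm_eq_inner by (simp only: inner_add_left inner_add_right inner_commute)
    also have "inner (c *\<^sub>C t) (x - y - c *\<^sub>C t) = 0"
      unfolding inner_cinner cinner_scaleC_left orth by simp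
    finally have "(norm (x - (y + c *\<^sub>C t)))\<^sup>2 + (norm (c *\<^sub>C t))\<^sup>2 = (norm (x - y))\<^sup>2"
      by (simp add: algebra_simps)
    moreover have "d \<le> (norm (x - (y + c *\<^sub>C t)))\<^sup>2"
      by (intro d sub yM t)
    ultimately have "(norm (c *\<^sub>C t))\<^sup>2 \<le> 0"
      using yd by linarith
    then have "c = 0"
      using False by (simp add: norm_scaleC)
    then show ?thesis
      using False by (simp add: c_def)
  qed simp
  then show ?thesis
    using that yM by blast
qed

lemma orth_proj_eqI:
  assumes M: "complex_vector.subspace M" and y: "y \<in> M" "\<And>s. s \<in> M \<Longrightarrow> cinner s (x - y) = 0"
  shows "orth_proj M x = y"
  unfolding orth_proj_def
proof (rule the_equality)
  fix z assume z: "z \<in> M \<and> (\<forall>s\<in>M. cinner s (x - z) = 0)"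
  then have "z - y \<in> M"
    using y complex_vector.subspace_diff[OF M] by blast
  then have "cinner (z - y) ((x - y) - (x - z)) = 0"
    using y z by (simp only: cinner_diff_right) simp
  then show "z = y"
    by (simp add: cinner_self)
qed (use y in auto)

lemma orth_proj_props:
  fixes M :: "'a::chilbert_space set"
  assumes M: "complex_vector.subspace M" "closed M"
  shows "orth_proj M x \<in> M" "s \<in> M \<Longrightarrow> cinner s (x - orth_proj M x) = 0"
    "bounded_clinear (orth_proj M)"
proof -
  have *: "orth_proj M x \<in> M \<and> (\<forall>s\<in>M. cinner s (x - orth_proj M x) = 0)" for x
    using orthogonal_projection_exists[OF M, of x] orth_proj_eqI[OF M(1)] by metis
  then show "orth_proj M x \<in> M" and "s \<in> M \<Longrightarrow> cinner s (x - orth_proj M x) = 0"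
    by auto
  note sub = complex_vector.subspace_add[OF M(1)] complex_vector.subspace_scale[OF M(1)]
  have add: "orth_proj M (x + y) = orth_proj M x + orth_proj M y" for x y
    using * by (intro orth_proj_eqI M sub) (auto simp: add_diff_add cinner_add_right)
  have scale: "orth_proj M (c *\<^sub>C x) = c *\<^sub>C orth_proj M x" for c x
  proof (intro orth_proj_eqI M sub)
    show "orth_proj M x \<in> M"
      using * by blast
    fix s assume "s \<in> M"
    then show "cinner s (c *\<^sub>C x - c *\<^sub>C orth_proj M x) = 0"
      using * by (simp add: cinner_scaleC_right complex_vector.scale_right_diff_distrib[symmetric])
  qed
  have "norm (orth_proj M x) \<le> norm x" for x
  proof (cases "orth_proj M x = 0")
    case False
    have "cinner (orth_proj M x) (x - orth_proj M x) = 0"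
      using * by blast
    then have "cinner (orth_proj M x) (orth_proj M x) = cinner (orth_proj M x) x"
      unfolding cinner_diff_right by simp
    then have "complex_of_real ((norm (orth_proj M x))\<^sup>2) = cinner (orth_proj M x) x"
      by (simp only: cinner_self)
    then have "(norm (orth_proj M x))\<^sup>2 \<le> norm (orth_proj M x) * norm x"
      by (metis Cauchy_Schwarz_cinner abs_power2 norm_of_real)
    then show ?thesis
      using False by (simp add: power2_eq_square)
  qed simp
  then show "bounded_clinear (orth_proj M)"
    unfolding bounded_clinear_def
    by (auto intro!: bounded_linear_intro[where K = 1] simp: add scale scaleR_scaleC)
qed

section \<open>Characters\<close>

lemma cmod_character: "z \<in> space torus \<Longrightarrow> cmod (character n z) = 1"
  by (simp add: character_def space_torus prod_norm[symmetric] norm_power_int)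

lemma character_eq_prod:
  assumes "finite U" "{j. n j \<noteq> 0} \<subseteq> U"
  shows "character n z = (\<Prod>j\<in>U. z j powi n j)"
  unfolding character_def using assms by (intro prod.mono_neutral_left) auto

lemma char_index_add: "n \<in> char_index \<Longrightarrow> k \<in> char_index \<Longrightarrow> n + k \<in> char_index"
  unfolding char_index_def
  by (auto intro!: finite_subset[of "{j. n j + k j \<noteq> 0}" "{j. n j \<noteq> 0} \<union> {j. k j \<noteq> 0}"])

lemma char_index_uminus: "n \<in> char_index \<Longrightarrow> - n \<in> char_index"
  by (simp add: char_index_def fun_Compl_def)

lemma character_add:
  assumes n: "n \<in> char_index" and k: "k \<in> char_index" and z: "z \<in> space torus"
  shows "character (n + k) z = character n z * character k z"
proof -
  let ?U = "{j. n j \<noteq> 0} \<union> {j. k j \<noteq> 0}"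
  have U: "finite ?U"
    using n k by (simp add: char_index_def)
  have "z j \<noteq> 0" for j
    using z by (metis (mono_tags, lifting) mem_Collect_eq norm_zero space_torus zero_neq_one)
  then show ?thesis
    using U by (subst (1 2 3) character_eq_prod[OF U]) (auto simp: power_int_add prod.distrib)
qed

lemma character_zero: "character 0 z = 1"
  by (simp add: character_def)

text \<open>Both sides are inverse to \<open>character n z\<close>, a number of modulus 1.\<close>

lemma cnj_character:
  assumes n: "n \<in> char_index" and z: "z \<in> space torus"
  shows "cnj (character n z) = character (- n) z"
proof -
  have "character (- n) z * character n z = 1"
    using character_add[OF char_index_uminus[OF n] n z] by (simp add: character_zero)
  moreover have "character n z * cnj (character n z) = 1"
    using cmod_character[OF z, of n] by (simp add: complex_norm_square[symmetric])
  ultimately show ?thesis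
    by (metis mult.assoc mult.commute mult_1)
qed

lemma powi_borel_measurable_circle: "(\<lambda>w. w powi k) \<in> borel_measurable circle_measure"
proof -
  have "(\<lambda>w::complex. w) \<in> borel_measurable circle_measure"
    unfolding circle_measure_def by (simp add: measurable_restrict_space1)
  then show ?thesis
    unfolding power_int_def by (cases "0 \<le> k") (auto intro!: borel_measurable_power borel_measurable_inverse)
qed

lemma cis_measurable_circle:
  "cis \<in> uniform_measure lborel {0..<2 * pi} \<rightarrow>\<^sub>M restrict_space borel (sphere 0 1)"
proof -
  have "cis \<in> borel_measurable borel"
    by (intro borel_measurable_continuous_onI continuous_intros)
  then show ?thesis
    by (intro measurable_restrict_space2) auto
qed

lemma integral_circle_powi:
  assumes "k \<noteq> 0"
  shows "(LINT w|circle_measure. w powi k) = 0"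
proof -
  \<comment> \<open>An antiderivative of the integrand with period \<open>2 * pi\<close>.\<close>
  define F where "F t = cis (of_int k * t) / (\<i> * of_int k)" for t
  have cis_meas: "(\<lambda>t. cis (of_int k * t)) \<in> borel_measurable lborel"
    by simp (intro borel_measurable_continuous_onI continuous_intros)
  have dens: "indicator {0..<2 * pi} t / emeasure lborel {0..<2 * pi}
      = ennreal (indicator {0..<2 * pi} t / (2 * pi))" for t
    by (auto simp: indicator_def divide_ennreal[of 1 "2 * pi", simplified])
  have "(LINT w|circle_measure. w powi k) = (LINT t|uniform_measure lborel {0..<2 * pi}. cis t powi k)"
    unfolding circle_measure_def using powi_borel_measurable_circle[of k]
    by (intro integral_distr cis_measurable_circle) (simp add: circle_measure_def)
  also have "\<dots> = (LINT t|lborel. (indicator {0..<2 * pi} t / (2 * pi)) *\<^sub>R cis (of_int k * t))"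
    unfolding uniform_measure_def dens cis_power_int using cis_meas by (intro integral_density) auto
  \<comment> \<open>The fundamental theorem of calculus wants a closed interval; the added endpoint is a null set.\<close>
  also have "\<dots> = (LINT t|lborel. (1 / (2 * pi)) *\<^sub>R (indicator {0..2 * pi} t *\<^sub>R cis (of_int k * t)))"
  proof (rule integral_cong_AE)
    show "AE t in lborel. (indicator {0..<2 * pi} t / (2 * pi)) *\<^sub>R cis (of_int k * t)
        = (1 / (2 * pi)) *\<^sub>R (indicator {0..2 * pi} t *\<^sub>R cis (of_int k * t))"
      using AE_lborel_singleton[of "2 * pi"] by eventually_elim (auto simp: indicator_def)
  qed (use cis_meas in auto)
  also have "\<dots> = (1 / (2 * pi)) *\<^sub>R (LINT t|lborel. indicator {0..2 * pi} t *\<^sub>R cis (of_int k * t))"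
    by (rule integral_scaleR_right)
  also have "(LINT t|lborel. indicator {0..2 * pi} t *\<^sub>R cis (of_int k * t)) = F (2 * pi) - F 0"
  proof (rule integral_FTC_atLeastAtMost)
    fix t
    show "(F has_vector_derivative cis (of_int k * t)) (at t within {0..2 * pi})"
      unfolding F_def has_vector_derivative_def using assms
      by (auto intro!: derivative_eq_intros simp: scaleR_conv_of_real fun_eq_iff field_simps)
  qed (auto intro!: continuous_intros)
  also have "F (2 * pi) = F 0"
  proof -
    have "cis (of_int k * (2 * pi)) = cis (2 * pi) powi k"
      by (rule cis_power_int[symmetric])
    then show ?thesis
      by (simp add: F_def)
  qed
  finally show ?thesis by simp
qed

text \<open>A character depends on finitely many coordinates. Its integral therefore is one over a finite
  product of circles and factorises; each factor with nonzero exponent vanishes.\<close>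

lemma integral_character:
  assumes n: "n \<in> char_index"
  shows "(LINT z|torus. character n z) = of_bool (n = 0)"
proof (cases "n = 0")
  case True
  interpret prob_space torus by (rule prob_space_torus)
  show ?thesis
    using True by (simp add: character_zero prob_space)
next
  case False
  define J where "J = {j. n j \<noteq> 0}"
  have J: "finite J"
    using n by (simp add: J_def char_index_def)
  obtain i where i: "i \<in> J"
    using False by (auto simp: J_def fun_eq_iff)
  interpret product_prob_space "\<lambda>_::'a. circle_measure" UNIV
    by (intro product_prob_space.intro product_sigma_finite.intro product_prob_space_axioms.intro
        prob_space_imp_sigma_finite prob_space_circle_measure)
  have space: "space circle_measure = sphere 0 1"
    by (simp add: circle_measure_def space_restrict_space)
  have int: "integrable circle_measure (\<lambda>w. w powi k)" for k
    by (rule finite_measure.integrable_const_bound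
        [OF prob_space.finite_measure[OF prob_space_circle_measure], where B = 1])
      (auto simp: space norm_power_int powi_borel_measurable_circle intro!: AE_I2)
  have "(LINT z|torus. character n z) = (LINT z|torus. (\<Prod>j\<in>J. restrict z J j powi n j))"
    by (simp add: character_def J_def[symmetric])
  also have "\<dots> = (LINT z|distr torus (\<Pi>\<^sub>M j\<in>J. circle_measure) (\<lambda>z. restrict z J). (\<Prod>j\<in>J. z j powi n j))"
    unfolding torus_def
    by (intro integral_distr[symmetric] measurable_restrict_subset borel_measurable_prod
        measurable_compose[OF _ powi_borel_measurable_circle] measurable_component_singleton) auto
  also have "\<dots> = (LINT z|(\<Pi>\<^sub>M j\<in>J. circle_measure). (\<Prod>j\<in>J. z j powi n j))"
    unfolding torus_def by (simp only: distr_PiM_restrict_finite[OF J subset_UNIV])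
  also have "\<dots> = (\<Prod>j\<in>J. LINT w|circle_measure. w powi n j)"
    by (rule product_integral_prod[OF J int])
  also have "\<dots> = 0"
    using i by (intro prod_zero J bexI[of _ i]) (simp add: J_def integral_circle_powi)
  finally show ?thesis
    using False by simp
qed

lemma orthonormal_characters: "orthonormal_on char_index (\<lambda>n. abs_torus_L2 (character n))"
  unfolding orthonormal_on_def
proof (intro ballI)
  fix k l :: "'a \<Rightarrow> int" assume k: "k \<in> char_index" and l: "l \<in> char_index"
  have "cinner (abs_torus_L2 (character k)) (abs_torus_L2 (character l))
      = (LINT z|torus. cnj (character k z) * character l z)"
    by (intro cinner_abs_L2 square_integrable_character)
  also have "\<dots> = (LINT z|torus. character (- k + l) z)"
    by (intro Bochner_Integration.integral_cong refl)
      (simp add: cnj_character character_add k l char_index_uminus del: uminus_add_conv_diff)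
  also have "\<dots> = of_bool (k = l)"
    by (subst integral_character[OF char_index_add[OF char_index_uminus[OF k] l]]) auto
  finally show "cinner (abs_torus_L2 (character k)) (abs_torus_L2 (character l)) = of_bool (k = l)" .
qed

section \<open>Big Hankel operators with monomial symbols\<close>

lemma abs_torus_L2_eqI:
  "square_integrable torus f \<Longrightarrow> square_integrable torus g \<Longrightarrow> (AE z in torus. f z = g z) \<Longrightarrow>
    abs_torus_L2 f = abs_torus_L2 g"
  by (rule Quotient3_rel_abs[OF Quotient3_torus_L2]) (simp add: L2_rel_def)

lemma square_integrable_unimodular:
  assumes "\<phi> \<in> borel_measurable M" "\<forall>z\<in>space M. cmod (\<phi> z) = 1" "square_integrable M f"
  shows "square_integrable M (\<lambda>z. \<phi> z * f z)"
proof -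
  have "integrable M (\<lambda>z. (cmod (\<phi> z * f z))\<^sup>2) \<longleftrightarrow> integrable M (\<lambda>z. (cmod (f z))\<^sup>2)"
    by (rule Bochner_Integration.integrable_cong) (simp_all add: norm_mult assms)
  then show ?thesis
    using assms by (auto simp: square_integrable_def)
qed

text \<open>Multiplication by a unimodular function is isometric on square integrable functions, and
  compatible with almost everywhere equality; so it does not matter which representative \<open>mult_L2\<close>
  picks.\<close>

lemma
  assumes \<phi>: "\<phi> \<in> borel_measurable torus" "\<forall>z\<in>space torus. cmod (\<phi> z) = 1"
  shows mult_L2_abs: "square_integrable torus f \<Longrightarrow> mult_L2 \<phi> (abs_torus_L2 f) = abs_torus_L2 (\<lambda>z. \<phi> z * f z)"
    and bounded_clinear_mult_L2: "bounded_clinear (mult_L2 \<phi>)"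
proof -
  note sq = square_integrable_unimodular[OF \<phi>]
  show mult: "mult_L2 \<phi> (abs_torus_L2 f) = abs_torus_L2 (\<lambda>z. \<phi> z * f z)" if f: "square_integrable torus f" for f
  proof -
    have "L2_rel (rep_torus_L2 (abs_torus_L2 f)) f"
      by (rule Quotient3_rep_abs[OF Quotient3_torus_L2]) (use f in \<open>simp add: L2_rel_def\<close>)
    then have "AE z in torus. \<phi> z * rep_torus_L2 (abs_torus_L2 f) z = \<phi> z * f z"
      by (auto simp: L2_rel_def elim!: eventually_mono)
    then show ?thesis
      unfolding mult_L2_def by (intro abs_torus_L2_eqI sq square_integrable_rep f)
  qed
  have add: "mult_L2 \<phi> (x + y) = mult_L2 \<phi> x + mult_L2 \<phi> y" for x y
  proof -
    let ?f = "rep_torus_L2 x" and ?g = "rep_torus_L2 y"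
    note fg = square_integrable_rep[of x] square_integrable_rep[of y]
    have abs_add: "abs_torus_L2 f + abs_torus_L2 g = abs_torus_L2 (\<lambda>z. f z + g z)"
      if "square_integrable torus f" "square_integrable torus g" for f g :: "('a \<Rightarrow> complex) \<Rightarrow> complex"
      using that by (subst plus_torus_L2.abs_eq) (auto simp: L2_rel_def eq_onp_def)
    have "mult_L2 \<phi> (abs_torus_L2 ?f + abs_torus_L2 ?g) = mult_L2 \<phi> (abs_torus_L2 ?f) + mult_L2 \<phi> (abs_torus_L2 ?g)"
      using fg by (simp only: abs_add mult square_integrable_add sq distrib_left)
    then show ?thesis
      by simp
  qed
  have scale: "mult_L2 \<phi> (c *\<^sub>C x) = c *\<^sub>C mult_L2 \<phi> x" for c x
  proof -
    let ?f = "rep_torus_L2 x"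
    note f = square_integrable_rep[of x]
    have abs_scale: "c *\<^sub>C abs_torus_L2 f = abs_torus_L2 (\<lambda>z. c * f z)"
      if "square_integrable torus f" for f :: "('a \<Rightarrow> complex) \<Rightarrow> complex"
      using that by (subst scaleC_torus_L2.abs_eq) (auto simp: L2_rel_def eq_onp_def)
    have "mult_L2 \<phi> (c *\<^sub>C abs_torus_L2 ?f) = c *\<^sub>C mult_L2 \<phi> (abs_torus_L2 ?f)"
      using f by (simp only: abs_scale mult square_integrable_scale sq mult.left_commute)
    then show ?thesis
      by simp
  qed
  have "norm (mult_L2 \<phi> x) = norm x" for x
  proof -
    let ?f = "rep_torus_L2 x"
    note f = square_integrable_rep[of x]
    have "(norm (mult_L2 \<phi> (abs_torus_L2 ?f)))\<^sup>2 = (LINT z|torus. (cmod (\<phi> z * ?f z))\<^sup>2)"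
      by (simp only: mult[OF f] norm_abs_L2[OF sq[OF f]])
    also have "\<dots> = (LINT z|torus. (cmod (?f z))\<^sup>2)"
      by (intro Bochner_Integration.integral_cong refl) (simp add: norm_mult \<phi>)
    also have "\<dots> = (norm (abs_torus_L2 ?f))\<^sup>2"
      by (simp only: norm_abs_L2[OF f])
    finally show ?thesis
      by (simp add: power2_eq_iff_nonneg)
  qed
  then show "bounded_clinear (mult_L2 \<phi>)"
    unfolding bounded_clinear_def
    by (auto intro!: bounded_linear_intro[where K = 1] simp: add scale scaleR_scaleC)
qed

lemma character_multiplier:
  "character n \<in> borel_measurable torus" "\<forall>z\<in>space torus. cmod (character n z) = 1"
  using square_integrable_character[of n] by (auto simp: square_integrable_def cmod_character)

lemma mult_L2_character:
  assumes "n \<in> char_index" "k \<in> char_index"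
  shows "mult_L2 (character n) (abs_torus_L2 (character k)) = abs_torus_L2 (character (n + k))"
  unfolding mult_L2_abs[OF character_multiplier square_integrable_character]
  using assms
  by (intro abs_torus_L2_eqI square_integrable_unimodular character_multiplier
      square_integrable_character AE_I2) (simp_all add: character_add)

lemma bounded_clinear_Rep_hardy: "bounded_clinear Rep_hardy"
  unfolding bounded_clinear_def
  by (auto intro!: bounded_linear_intro[where K = 1]
      simp: plus_hardy.rep_eq scaleC_hardy.rep_eq scaleR_hardy.rep_eq norm_hardy.rep_eq)

lemma bounded_clinear_Abs_hardy_perp:
  fixes T :: "'a::complex_inner \<Rightarrow> 'd torus_L2"
  assumes T: "bounded_clinear T" and range: "\<And>x. T x \<in> hardy_complement"
  shows "bounded_clinear (\<lambda>x. Abs_hardy_perp (T x))"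
proof -
  note Tb = bounded_clinearD[OF T]
  note sub = complex_vector.subspace_add[OF subspace_hardy_complement range range]
    complex_vector.subspace_scale[OF subspace_hardy_complement range]
  interpret bounded_linear T by (rule Tb(1))
  obtain K where "\<And>x. norm (T x) \<le> norm x * K" using bounded by blast
  then show ?thesis
    unfolding bounded_clinear_def
    by (intro conjI allI bounded_linear_intro[where K = K])
      (simp_all add: Rep_hardy_perp_inject[symmetric] plus_hardy_perp.rep_eq scaleC_hardy_perp.rep_eq
        scaleR_hardy_perp.rep_eq norm_hardy_perp.rep_eq Abs_hardy_perp_inverse range sub Tb(2,4) scaleR
        scaleR_scaleC[where 'a="'d torus_L2"])
qed

lemma bounded_clinear_big_hankel: "bounded_clinear (big_hankel (character n))"
  unfolding big_hankel_def[abs_def]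
  by (intro bounded_clinear_Abs_hardy_perp orth_proj_props subspace_hardy_complement
      closed_hardy_complement bounded_clinear_mult_L2 character_multiplier bounded_clinear_Rep_hardy
      bounded_clinear_compose[of "orth_proj hardy_complement"] bounded_clinear_compose[of "mult_L2 _"])

definition hardy_basis :: "('d \<Rightarrow> int) \<Rightarrow> 'd hardy" where
  "hardy_basis n = Abs_hardy (abs_torus_L2 (character n))"

definition hardy_perp_basis :: "('d \<Rightarrow> int) \<Rightarrow> 'd hardy_perp" where
  "hardy_perp_basis n = Abs_hardy_perp (abs_torus_L2 (character n))"

lemma character_in_hardy_space: "n \<in> hardy_index \<Longrightarrow> abs_torus_L2 (character n) \<in> hardy_space"
  unfolding hardy_space_def by (intro subsetD[OF subset_closure_span] imageI)

text \<open>The vectors orthogonal to the given character form a closed subspace which, by orthogonality,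
  contains the characters that generate the Hardy space.\<close>

lemma character_in_hardy_complement:
  assumes "n \<in> char_index - hardy_index"
  shows "abs_torus_L2 (character n) \<in> hardy_complement"
proof -
  let ?x = "abs_torus_L2 (character n)"
  let ?M = "{h. cinner h ?x = 0}"
  have "closed ?M"
    by (intro closed_Collect_eq continuous_on_const
        linear_continuous_on[OF bounded_bilinear.bounded_linear_left[OF bounded_bilinear_cinner]])
  moreover have "complex_vector.subspace ?M"
    by (auto simp: complex_vector.subspace_def cinner_add_left cinner_scaleC_left)
  moreover have "(\<lambda>n. abs_torus_L2 (character n)) ` hardy_index \<subseteq> ?M"
  proof (intro image_subsetI CollectI)
    fix k :: "'a \<Rightarrow> int" assume "k \<in> hardy_index"
    then have k: "k \<in> char_index" "k \<noteq> n"
      using assms by (auto simp: hardy_index_def)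
    have n: "n \<in> char_index"
      using assms by blast
    show "cinner (abs_torus_L2 (character k)) ?x = 0"
      using orthonormal_characters[unfolded orthonormal_on_def, rule_format, OF k(1) n] k(2) by simp
  qed
  ultimately have "hardy_space \<subseteq> ?M"
    unfolding hardy_space_def by (intro closure_minimal complex_vector.span_minimal)
  then show ?thesis
    unfolding hardy_complement_def by blast
qed

lemma Rep_hardy_basis: "n \<in> hardy_index \<Longrightarrow> Rep_hardy (hardy_basis n) = abs_torus_L2 (character n)"
  by (simp add: hardy_basis_def Abs_hardy_inverse character_in_hardy_space)

lemma orthonormal_hardy_basis: "orthonormal_on hardy_index hardy_basis"
  using orthonormal_characters
  by (auto simp: orthonormal_on_def cinner_hardy.rep_eq Rep_hardy_basis hardy_index_def)

lemma orthonormal_hardy_perp_basis: "orthonormal_on (char_index - hardy_index) hardy_perp_basis"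
  using orthonormal_characters
  by (auto simp: orthonormal_on_def cinner_hardy_perp.rep_eq hardy_perp_basis_def
      Abs_hardy_perp_inverse character_in_hardy_complement)

text \<open>The Hardy space is by definition the closed span of these characters, but inside the ambient
  space; the inclusion \<open>Rep_hardy\<close> is linear and isometric, so density can be pulled back along it.\<close>

lemma total_hardy_basis: "total_set (hardy_basis ` hardy_index)"
proof -
  let ?S = "complex_vector.span (hardy_basis ` hardy_index)"
  let ?R = "complex_vector.span ((\<lambda>n. abs_torus_L2 (character n)) ` hardy_index)"
  have lift: "\<exists>y\<in>?S. Rep_hardy y = x" if "x \<in> ?R" for x
    using that
  proof (induction rule: complex_vector.span_induct_alt)
    case base
    show ?case
      using complex_vector.span_zero zero_hardy.rep_eq by blast
  next
    case (step c b x)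
    then obtain n y where "n \<in> hardy_index" "b = Rep_hardy (hardy_basis n)" "y \<in> ?S" "x = Rep_hardy y"
      by (auto simp: Rep_hardy_basis)
    then show ?case
      by (intro bexI[of _ "c *\<^sub>C hardy_basis n + y"])
        (auto simp: plus_hardy.rep_eq scaleC_hardy.rep_eq
          intro: complex_vector.span_add complex_vector.span_scale complex_vector.span_base)
  qed
  have "h \<in> closure ?S" for h
    unfolding closure_approachable
  proof (intro allI impI)
    fix \<epsilon> :: real assume "0 < \<epsilon>"
    then obtain x where x: "x \<in> ?R" "dist x (Rep_hardy h) < \<epsilon>"
      using Rep_hardy[of h] unfolding hardy_space_def closure_approachable by blast
    then obtain y where "y \<in> ?S" "Rep_hardy y = x"
      using lift by blast
    moreover have "dist y h = dist (Rep_hardy y) (Rep_hardy h)"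
      by (simp add: dist_norm norm_hardy.rep_eq minus_hardy.rep_eq)
    ultimately show "\<exists>y\<in>?S. dist y h < \<epsilon>"
      using x by metis
  qed
  then show ?thesis
    by (auto simp: total_set_def)
qed

text \<open>The product of the two characters is again a character. It lies in the Hardy space or in its
  complement, so the projection either annihilates or fixes it.\<close>

lemma big_hankel_basis:
  assumes n: "n \<in> char_index" and k: "k \<in> hardy_index"
  shows "big_hankel (character n) (hardy_basis k)
    = (if n + k \<in> char_index - hardy_index then hardy_perp_basis (n + k) else 0)"
proof -
  let ?c = "abs_torus_L2 (character (n + k))"
  have kc: "k \<in> char_index" and nk: "n + k \<in> char_index"
    using k n by (auto simp: hardy_index_def intro: char_index_add)
  have "big_hankel (character n) (hardy_basis k) = Abs_hardy_perp (orth_proj hardy_complement ?c)"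
    by (simp add: big_hankel_def Rep_hardy_basis k mult_L2_character n kc)
  moreover have "orth_proj hardy_complement ?c = (if n + k \<in> hardy_index then 0 else ?c)"
  proof (rule orth_proj_eqI[OF subspace_hardy_complement])
    show "(if n + k \<in> hardy_index then 0 else ?c) \<in> hardy_complement"
      using nk complex_vector.subspace_0[OF subspace_hardy_complement]
      by (auto intro: character_in_hardy_complement)
    fix s :: "'a torus_L2" assume "s \<in> hardy_complement"
    then have "cinner ?c s = 0" if "n + k \<in> hardy_index"
      using character_in_hardy_space[OF that] by (auto simp: hardy_complement_def)
    then show "cinner s (?c - (if n + k \<in> hardy_index then 0 else ?c)) = 0"
      by (auto simp: cinner_commute[of s])
  qed
  ultimately show ?thesis
    using nk by (simp add: hardy_perp_basis_def zero_hardy_perp_def)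
qed

theorem corollary5p3:
  assumes "2 \<le> CARD('d::countable) \<or> infinite (UNIV :: 'd set)"
  shows "SAP TYPE('b::cstar_algebra) TYPE('l::chilbert_space)
    (char_index - hardy_index :: ('d \<Rightarrow> int) set) (\<lambda>n. big_hankel (character n))"
  by (rule SAP_truncated_translations[OF orthonormal_hardy_basis total_hardy_basis
        orthonormal_hardy_perp_basis bounded_clinear_big_hankel]) (simp add: big_hankel_basis)

end
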